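(* Let $S=\{z: a<\mathrm{Im}\,z<b\}$ be a strip. Let $K(z)$ be a function which is non-zero on the whole strip $S$, and such that furthermore $K(z)-1\in\{\!\{a,b\}\!\}$ and $\mathrm{ind}\,K(x+ia)=0$. Consider the Wiener–Hopf factorisation problem: it is required to find two functions $K^{\pm}(z)$, analytic in the half-planes $\{z:a<\mathrm{Im}\,z\}$ and $\{z:\mathrm{Im}\,z<b\}$ respectively, belonging to the classes $\{\!\{a,\infty\}\!\}$ and $\{\!\{-\infty,b\}\!\}$ respectively, such that $$K(z)=K^{+}(z)K^{-}(z)\qquad\text{on the strip } a<\mathrm{Im}\,z<b.$$ The solution of this problem can be expressed as $$K^{+}(z)=\exp\left(\frac{1}{\sqrt{2\pi}}\int_{b}^{\infty}\kappa(t)\,e^{izt}\,dt\right)\quad\text{and}\quad K^{-}(z)=\exp\left(-\frac{1}{\sqrt{2\pi}}\int_{-\infty}^{a}\kappa(t)\,e^{izt}\,dt\right),$$ where $\kappa(t)$ is the inverse Fourier transform of $\ln K(t)$.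
   Context: The Fourier transform of a function $f(t)$ is $F(x)=\frac{1}{\sqrt{2\pi}}\int_{-\infty}^{\infty} f(t)e^{ixt}\,dt$, $-\infty<x<\infty$; the same formula is used for complex $x$ whenever the integral is absolutely convergent. The inverse Fourier transform of $F$ is $f(t)=\frac{1}{\sqrt{2\pi}}\int_{-\infty}^{\infty}F(x)e^{-ixt}\,dx$. $\{\!\{0\}\!\}$ is the intersection of $L_2(\mathbb{R})$ with the Hölder continuous functions on $\mathbb{R}$. $\{0\}$ is the pre-image of $\{\!\{0\}\!\}$ under the Fourier transform. For real $a$, $f\in\{a\}$ means that $e^{-ax}f(x)\in\{0\}$ (a shift in the Fourier space). For a function $f$ on the real axis put $f_+(t)=f(t)$ for $t>0$, $f_+(t)=0$ for $t<0$; and $f_-(t)=0$ for $t>0$, $f_-(t)=-f(t)$ for $t<0$. We write $f\in\{a,b\}$ if $f_+\in\{a\}$ and $f_-\in\{b\}$. The class $\{a,\infty\}$ consists of the functions $f_+$ with $f\in\{a\}$, and the class $\{-\infty,b\}$ consists of the functions $f_-$ with $f\in\{b\}$. The classes of Fourier transforms of functions in $\{a,b\}$, $\{a,\infty\}$, $\{-\infty,b\}$ are denoted $\{\!\{a,b\}\!\}$, $\{\!\{a,\infty\}\!\}$, $\{\!\{-\infty,b\}\!\}$; their members are analytic in $a<\mathrm{Im}\,z<b$, in $\mathrm{Im}\,z>a$ and in $\mathrm{Im}\,z<b$ respectively. The index of a continuous non-zero function $k(t)$ on the real line is $\mathrm{ind}(k(t))=\frac{1}{2\pi}\big(\lim_{t\to+\infty}\arg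 k(t)-\lim_{t\to-\infty}\arg k(t)\big)$, i.e. the winding number of the curve $(\mathrm{Re}\,k(t),\mathrm{Im}\,k(t))$, $t\in\mathbb{R}$; $\mathrm{ind}\,K(x+ia)$ is the index of the function $x\mapsto K(x+ia)$, $x\in\mathbb{R}$. Zero index ensures that the logarithm is single-valued.
   Formalization: The classes are required of K^+−1 and K^-−1 instead of K^±; the integrals run over (0,∞) and (−∞,0) instead of (b,∞) and (−∞,a); the sign in the exponent of K^- is plus; ln K is the branch vanishing at infinity and κ is its inverse transform along lines in the strip. *)

theory Defs
  imports "HOL-Complex_Analysis.Complex_Analysis"
begin

section \<open>The Fourier transform\<close>

definition fourier :: "(real \<Rightarrow> complex) \<Rightarrow> complex \<Rightarrow> complex" where
  "fourier f z = 1 / sqrt (2 * pi) * (LINT t|lborel. f t * exp (\<i> * z * of_real t))"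

definition L2 :: "(real \<Rightarrow> complex) set" where
  "L2 = {f \<in> borel_measurable lborel. integrable lborel (\<lambda>t. (cmod (f t))\<^sup>2)}"

definition fourier_cut :: "real \<Rightarrow> (real \<Rightarrow> complex) \<Rightarrow> real \<Rightarrow> complex" where
  "fourier_cut R f x =
     1 / sqrt (2 * pi) * (LINT t:{-R..R}|lborel. f t * exp (\<i> * of_real x * of_real t))"

text \<open>
  On the real line the transform is the unitary one of \<open>L\<^sub>2\<close>: the defining integral need not
  converge absolutely and is read as the limit in mean of the integrals over \<open>[-R, R]\<close>.
  Either function is determined by the other only up to a null set, hence relations.
\<close>

definition has_L2_fourier :: "(real \<Rightarrow> complex) \<Rightarrow> (real \<Rightarrow> complex) \<Rightarrow> bool" where
  "has_L2_fourier f F \<longleftrightarrow> f \<in> L2 \<and> F \<in> L2 \<and>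
     ((\<lambda>R. \<integral>\<^sup>+x. ennreal ((cmod (F x - fourier_cut R f x))\<^sup>2) \<partial>lborel) \<longlongrightarrow> 0) at_top"

text \<open>The kernel \<open>exp (-i x t)\<close> of the inverse transform is obtained by reflecting the argument.\<close>

definition has_L2_inverse_fourier :: "(real \<Rightarrow> complex) \<Rightarrow> (real \<Rightarrow> complex) \<Rightarrow> bool" where
  "has_L2_inverse_fourier F f \<longleftrightarrow> F \<in> L2 \<and> f \<in> L2 \<and>
     ((\<lambda>R. \<integral>\<^sup>+t. ennreal ((cmod (f t - fourier_cut R F (- t)))\<^sup>2) \<partial>lborel) \<longlongrightarrow> 0) at_top"


section \<open>The function classes\<close>

definition Hoelder_continuous :: "(real \<Rightarrow> complex) \<Rightarrow> bool" where
  "Hoelder_continuous F \<longleftrightarrow>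
     (\<exists>\<mu> A. 0 < \<mu> \<and> \<mu> \<le> 1 \<and> (\<forall>x y. cmod (F x - F y) \<le> A * \<bar>x - y\<bar> powr \<mu>))"

text \<open>The classes \<open>{{0}}\<close>, \<open>{0}\<close> and \<open>{a}\<close>.\<close>

definition hat_class0 :: "(real \<Rightarrow> complex) set" where
  "hat_class0 = {F \<in> L2. Hoelder_continuous F}"

definition class0 :: "(real \<Rightarrow> complex) set" where
  "class0 = {f. \<exists>F \<in> hat_class0. has_L2_fourier f F}"

definition class1 :: "real \<Rightarrow> (real \<Rightarrow> complex) set" where
  "class1 a = {f. (\<lambda>x. of_real (exp (- a * x)) * f x) \<in> class0}"

definition plus_part :: "(real \<Rightarrow> complex) \<Rightarrow> real \<Rightarrow> complex" where
  "plus_part f t = (if t > 0 then f t else 0)"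

definition minus_part :: "(real \<Rightarrow> complex) \<Rightarrow> real \<Rightarrow> complex" where
  "minus_part f t = (if t < 0 then - f t else 0)"

text \<open>The classes \<open>{a, b}\<close>, \<open>{a, \<infinity>}\<close> and \<open>{-\<infinity>, b}\<close>.\<close>

definition class2 :: "real \<Rightarrow> real \<Rightarrow> (real \<Rightarrow> complex) set" where
  "class2 a b = {f. plus_part f \<in> class1 a \<and> minus_part f \<in> class1 b}"

definition class_right :: "real \<Rightarrow> (real \<Rightarrow> complex) set" where
  "class_right a = plus_part ` class1 a"

definition class_left :: "real \<Rightarrow> (real \<Rightarrow> complex) set" where
  "class_left b = minus_part ` class1 b"

definition strip :: "real \<Rightarrow> real \<Rightarrow> complex set" where
  "strip a b = {z. a < Im z \<and> Im z < b}"

text \<open>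
  Transforms of functions in \<open>C\<close>, regarded as functions on the open domain \<open>D\<close>, where the
  defining integral converges absolutely; values outside \<open>D\<close> are irrelevant.
\<close>

definition fourier_image :: "complex set \<Rightarrow> (real \<Rightarrow> complex) set \<Rightarrow> (complex \<Rightarrow> complex) set" where
  "fourier_image D C = {F. \<exists>f \<in> C. \<forall>z \<in> D.
     integrable lborel (\<lambda>t. f t * exp (\<i> * z * of_real t)) \<and> F z = fourier f z}"

definition hat_class2 :: "real \<Rightarrow> real \<Rightarrow> (complex \<Rightarrow> complex) set" where
  "hat_class2 a b = fourier_image (strip a b) (class2 a b)"

definition hat_class_right :: "real \<Rightarrow> (complex \<Rightarrow> complex) set" where
  "hat_class_right a = fourier_image {z. a < Im z} (class_right a)"

definition hat_class_left :: "real \<Rightarrow> (complex \<Rightarrow> complex) set" where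
  "hat_class_left b = fourier_image {z. Im z < b} (class_left b)"


section \<open>Index, logarithm and factorisation\<close>

text \<open>The index is defined only for continuous functions without zeros.\<close>

definition has_index :: "(real \<Rightarrow> complex) \<Rightarrow> real \<Rightarrow> bool" where
  "has_index k r \<longleftrightarrow> continuous_on UNIV k \<and> (\<forall>t. k t \<noteq> 0) \<and>
     (\<exists>\<theta> l m. continuous_on UNIV \<theta> \<and> (\<forall>t. k t = of_real (cmod (k t)) * cis (\<theta> t)) \<and>
        (\<theta> \<longlongrightarrow> l) at_top \<and> (\<theta> \<longlongrightarrow> m) at_bot \<and> r = (l - m) / (2 * pi))"

text \<open>
  \<open>x \<mapsto> K (x + i a)\<close> on the lower edge of the strip, as the boundary value of \<open>K\<close> from
  inside the strip.
\<close>

definition lower_edge :: "(complex \<Rightarrow> complex) \<Rightarrow> real \<Rightarrow> real \<Rightarrow> complex" where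
  "lower_edge K a x = Lim (at_right a) (\<lambda>y. K (Complex x y))"

text \<open>
  The single-valued branch of \<open>ln K\<close> on the strip, normalised to vanish at infinity (recall
  that \<open>K\<close> tends to 1 there).
\<close>

definition is_strip_ln :: "real \<Rightarrow> real \<Rightarrow> (complex \<Rightarrow> complex) \<Rightarrow> (complex \<Rightarrow> complex) \<Rightarrow> bool" where
  "is_strip_ln a b K L \<longleftrightarrow> L holomorphic_on strip a b \<and> (\<forall>z \<in> strip a b. exp (L z) = K z) \<and>
     (\<forall>c. a < c \<and> c < b \<longrightarrow>
        ((\<lambda>x. L (Complex x c)) \<longlongrightarrow> 0) at_top \<and> ((\<lambda>x. L (Complex x c)) \<longlongrightarrow> 0) at_bot)"

text \<open>
  \<open>\<kappa> t\<close> is \<open>1 / sqrt (2 \<pi>)\<close> times the integral of \<open>G z * exp (-i z t)\<close> along any line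
  \<open>Im z = c\<close> in the strip.  With \<open>z = x + i c\<close> the kernel is \<open>exp (c t) * exp (-i x t)\<close>, and
  the factor \<open>exp (c t)\<close> is moved to the side of \<open>\<kappa>\<close>.
\<close>

definition is_strip_inverse_fourier ::
    "real \<Rightarrow> real \<Rightarrow> (complex \<Rightarrow> complex) \<Rightarrow> (real \<Rightarrow> complex) \<Rightarrow> bool" where
  "is_strip_inverse_fourier a b G \<kappa> \<longleftrightarrow> (\<forall>c. a < c \<and> c < b \<longrightarrow>
     has_L2_inverse_fourier (\<lambda>x. G (Complex x c)) (\<lambda>t. of_real (exp (- c * t)) * \<kappa> t))"

text \<open>
  Class membership is required of \<open>K\<^sup>+ - 1\<close> and \<open>K\<^sup>- - 1\<close>, as it is for \<open>K - 1\<close>: members of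
  the classes tend to 0 at infinity, whereas the factors tend to 1.
\<close>

definition Wiener_Hopf_factors ::
    "real \<Rightarrow> real \<Rightarrow> (complex \<Rightarrow> complex) \<Rightarrow> (complex \<Rightarrow> complex) \<Rightarrow> (complex \<Rightarrow> complex) \<Rightarrow> bool" where
  "Wiener_Hopf_factors a b K Kp Km \<longleftrightarrow>
     Kp holomorphic_on {z. a < Im z} \<and> Km holomorphic_on {z. Im z < b} \<and>
     (\<lambda>z. Kp z - 1) \<in> hat_class_right a \<and> (\<lambda>z. Km z - 1) \<in> hat_class_left b \<and>
     (\<forall>z \<in> strip a b. K z = Kp z * Km z)"

end

theory Submission
  imports Defs "HOL-Probability.Probability"
begin

text \<open>
  The logarithm turns the factorisation \<open>K = K\<^sup>+ * K\<^sup>-\<close> into a decomposition of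
  \<open>ln K\<close> into a sum, and for the transform \<open>ln K = fourier \<kappa>\<close> the decomposition is
  obtained by cutting \<open>\<kappa>\<close> at \<open>t = 0\<close>. Three things have to be shown.

  First, a single-valued \<open>ln K\<close> that vanishes at both ends of each line exists
  (\<open>strip_ln_exists\<close>). A logarithm on the strip has limits in \<open>2 \<pi> i \<int>\<close> at the two
  ends, and the index compares them: near the lower edge \<open>K\<close> is uniformly close to its
  boundary values, because the part of \<open>K\<close> that comes from \<open>t > 0\<close> is the Poisson integral
  of a Hoelder continuous function (\<open>fourier_boundary_uniform\<close>).

  Second, \<open>\<kappa>\<close> exists, is the same for all lines, and has \<open>ln K\<close> as its absolutely
  convergent transform. This holds for every function that is holomorphic on the strip, bounded
  on closed substrips and square integrable on lines (\<open>Paley_Wiener_strip\<close>), and \<open>ln K\<close> is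
  such a function because \<open>\<bar>ln K\<bar> \<le> 2 \<bar>K - 1\<bar>\<close> far out
  (\<open>strip_ln_bounds\<close>). Since \<open>exp (- c t) \<kappa>(t)\<close> is square integrable for all \<open>c\<close>
  between \<open>a\<close> and \<open>b\<close>, the half of \<open>\<kappa>\<close> on \<open>t > 0\<close> has an absolutely convergent
  transform on all of \<open>Im z > a\<close>, and the other half on \<open>Im z < b\<close>.

  Third, the factors minus 1 belong to the stated classes, that is, they have Hoelder continuous
  and square integrable boundary values (\<open>right_factor_in_hat_class_right\<close>,
  \<open>left_factor_in_hat_class_left\<close>). The reason is that \<open>K\<^sup>+ = K / K\<^sup>-\<close> and that
  \<open>K\<^sup>-\<close> is holomorphic and without zeros across the lower edge. So \<open>K\<^sup>+\<close>
  inherits its boundary behaviour there from \<open>K\<close>, and Liouville's theorem identifies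
  \<open>K\<^sup>+ - 1\<close> as the transform of a function on \<open>t > 0\<close>. Reflection in the origin
  exchanges the factors.

  Transforms in mean are compared with absolutely convergent ones through Bessel's inequality,
  which follows from Gaussian regularisation (\<open>Bessel_inequality\<close>, \<open>has_L2_fourier_approx\<close>).
\<close>

section \<open>Square integrable functions\<close>

text \<open>
  Taking values in \<open>ennreal\<close> keeps estimates free of finiteness conditions. The limits in mean
  that define the transforms are statements that an energy tends to 0.
\<close>

definition energy :: "(real \<Rightarrow> complex) \<Rightarrow> ennreal" where
  "energy f = (\<integral>\<^sup>+x. ennreal ((cmod (f x))\<^sup>2) \<partial>lborel)"

abbreviation real_fourier :: "(real \<Rightarrow> complex) \<Rightarrow> real \<Rightarrow> complex" where
  "real_fourier f x \<equiv> fourier f (complex_of_real x)"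

lemma L2_iff: "f \<in> L2 \<longleftrightarrow> f \<in> borel_measurable borel \<and> energy f < \<infinity>"
proof (cases "f \<in> borel_measurable borel")
  case True
  then show ?thesis
    by (auto simp: L2_def energy_def integrable_iff_bounded)
qed (auto simp: L2_def)

lemma energy_add_le:
  assumes [measurable]: "f \<in> borel_measurable borel" "g \<in> borel_measurable borel"
  shows "energy (\<lambda>x. f x + g x) \<le> 2 * energy f + 2 * energy g"
proof -
  have pt: "ennreal ((cmod (f x + g x))\<^sup>2)
      \<le> 2 * ennreal ((cmod (f x))\<^sup>2) + 2 * ennreal ((cmod (g x))\<^sup>2)" for x
  proof -
    have "(cmod (f x + g x))\<^sup>2 \<le> (cmod (f x) + cmod (g x))\<^sup>2"
      by (intro power_mono norm_triangle_ineq) auto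
    also have "\<dots> \<le> 2 * (cmod (f x))\<^sup>2 + 2 * (cmod (g x))\<^sup>2"
      using sum_squares_bound[of "cmod (f x)" "cmod (g x)"] by (simp add: power2_sum)
    finally have "ennreal ((cmod (f x + g x))\<^sup>2) \<le> ennreal (2 * (cmod (f x))\<^sup>2 + 2 * (cmod (g x))\<^sup>2)"
      by (rule ennreal_leI)
    then show ?thesis
      by (simp add: ennreal_mult)
  qed
  have "energy (\<lambda>x. f x + g x) \<le>
      (\<integral>\<^sup>+x. 2 * ennreal ((cmod (f x))\<^sup>2) + 2 * ennreal ((cmod (g x))\<^sup>2) \<partial>lborel)"
    unfolding energy_def by (intro nn_integral_mono pt)
  also have "\<dots> = 2 * energy f + 2 * energy g"
    unfolding energy_def by (simp add: nn_integral_add nn_integral_cmult)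
  finally show ?thesis .
qed

lemma energy_diff_le:
  assumes "f \<in> borel_measurable borel" "g \<in> borel_measurable borel"
  shows "energy (\<lambda>x. f x - g x) \<le> 2 * energy f + 2 * energy g"
proof -
  have "energy (\<lambda>x. - g x) = energy g"
    by (simp add: energy_def)
  with energy_add_le[of f "\<lambda>x. - g x"] assms show ?thesis
    by simp
qed

lemma energy_mono:
  assumes "\<And>x. cmod (f x) \<le> cmod (g x)"
  shows "energy f \<le> energy g"
  unfolding energy_def by (intro nn_integral_mono ennreal_leI power_mono assms) auto

lemma energy_mono_cmult:
  assumes "\<And>x. cmod (f x) \<le> C * cmod (g x)" and [measurable]: "g \<in> borel_measurable borel"
  shows "energy f \<le> ennreal (C\<^sup>2) * energy g"
proof -
  have "energy f \<le> (\<integral>\<^sup>+x. ennreal (C\<^sup>2) * ennreal ((cmod (g x))\<^sup>2) \<partial>lborel)"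
    unfolding energy_def
  proof (intro nn_integral_mono)
    fix x
    have "(cmod (f x))\<^sup>2 \<le> (C * cmod (g x))\<^sup>2"
      by (intro power_mono assms) auto
    then show "ennreal ((cmod (f x))\<^sup>2) \<le> ennreal (C\<^sup>2) * ennreal ((cmod (g x))\<^sup>2)"
      by (simp add: ennreal_mult[symmetric] power_mult_distrib ennreal_leI)
  qed
  also have "\<dots> = ennreal (C\<^sup>2) * energy g"
    unfolding energy_def by (rule nn_integral_cmult) measurable
  finally show ?thesis .
qed

lemma energy_reflect:
  assumes [measurable]: "f \<in> borel_measurable borel"
  shows "energy (\<lambda>x. f (- x)) = energy f"
  unfolding energy_def
  by (subst (2) nn_integral_real_affine[of _ "-1" 0]) auto

lemma L2D: "f \<in> L2 \<Longrightarrow> f \<in> borel_measurable borel" "f \<in> L2 \<Longrightarrow> energy f < \<infinity>"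
  by (auto simp: L2_iff)

lemma L2_mono_cmult:
  assumes "g \<in> L2" "f \<in> borel_measurable borel" "\<And>x. cmod (f x) \<le> C * cmod (g x)"
  shows "f \<in> L2"
proof -
  have "energy f \<le> ennreal (C\<^sup>2) * energy g"
    by (rule energy_mono_cmult[OF assms(3) L2D(1)[OF assms(1)]])
  also have "\<dots> < \<infinity>"
    using L2D(2)[OF assms(1)] by (simp add: ennreal_mult_less_top)
  finally show ?thesis
    using assms(2) by (simp add: L2_iff)
qed

lemma L2_add:
  assumes "f \<in> L2" "g \<in> L2"
  shows "(\<lambda>x. f x + g x) \<in> L2"
proof -
  have "energy (\<lambda>x. f x + g x) \<le> 2 * energy f + 2 * energy g"
    using assms by (intro energy_add_le L2D)
  also have "\<dots> < \<infinity>"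
    using L2D(2)[OF assms(1)] L2D(2)[OF assms(2)] by (simp add: ennreal_mult_less_top)
  finally show ?thesis
    using L2D(1)[OF assms(1)] L2D(1)[OF assms(2)] by (auto simp: L2_iff)
qed

lemma L2_reflect: "f \<in> L2 \<Longrightarrow> (\<lambda>x. f (- x)) \<in> L2"
  by (auto simp: L2_iff energy_reflect)

lemma indicator_L2: "(\<lambda>t. complex_of_real (indicator {a..b} t)) \<in> L2"
proof -
  have "integrable lborel (indicator {a..b} :: real \<Rightarrow> real)"
    by (intro integrable_real_indicator) (auto simp: emeasure_lborel_Icc_eq)
  moreover have "(cmod (complex_of_real (indicator {a..b} t)))\<^sup>2 = indicator {a..b} t" for t
    by (simp add: indicator_def)
  ultimately show ?thesis
    by (simp add: L2_def)
qed

lemma integrable_mult_L2: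
  assumes "f \<in> L2" "g \<in> L2"
  shows "integrable lborel (\<lambda>x. f x * g x)"
proof (rule Bochner_Integration.integrable_bound)
  show "integrable lborel (\<lambda>x. (cmod (f x))\<^sup>2 + (cmod (g x))\<^sup>2)"
    using assms by (auto simp: L2_def)
  show "(\<lambda>x. f x * g x) \<in> borel_measurable lborel"
    using assms by (auto simp: L2_def)
  show "AE x in lborel. norm (f x * g x) \<le> norm ((cmod (f x))\<^sup>2 + (cmod (g x))\<^sup>2)"
  proof (intro always_eventually allI)
    fix x
    have "2 * (cmod (f x) * cmod (g x)) \<le> (cmod (f x))\<^sup>2 + (cmod (g x))\<^sup>2"
      using sum_squares_bound[of "cmod (f x)" "cmod (g x)"] by simp
    moreover have "0 \<le> cmod (f x) * cmod (g x)" by simp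
    ultimately have "cmod (f x) * cmod (g x) \<le> (cmod (f x))\<^sup>2 + (cmod (g x))\<^sup>2"
      by linarith
    then show "norm (f x * g x) \<le> norm ((cmod (f x))\<^sup>2 + (cmod (g x))\<^sup>2)"
      by (simp add: norm_mult)
  qed
qed

lemma Cauchy_Schwarz_energy:
  assumes [measurable]: "f \<in> borel_measurable borel" "g \<in> borel_measurable borel"
  shows "(\<integral>\<^sup>+x. ennreal (cmod (f x * g x)) \<partial>lborel)\<^sup>2 \<le> energy f * energy g"
proof -
  have "(\<integral>\<^sup>+x. ennreal (cmod (f x)) * ennreal (cmod (g x)) \<partial>lborel)\<^sup>2
     \<le> (\<integral>\<^sup>+x. (ennreal (cmod (f x)))\<^sup>2 \<partial>lborel) * (\<integral>\<^sup>+x. (ennreal (cmod (g x)))\<^sup>2 \<partial>lborel)"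
    by (rule Cauchy_Schwarz_nn_integral) measurable
  then show ?thesis
    by (simp add: energy_def ennreal_mult norm_mult ennreal_power)
qed

section \<open>Fourier transforms of integrable functions\<close>

lemma norm_exp_i_real [simp]: "cmod (exp (\<i> * of_real x * of_real t)) = 1"
  by simp

lemma borel_measurable_fourier [measurable]:
  assumes [measurable]: "f \<in> borel_measurable borel"
  shows "real_fourier f \<in> borel_measurable borel"
  unfolding fourier_def by measurable

lemma integrable_mult_bounded:
  fixes f g :: "real \<Rightarrow> complex"
  assumes "integrable lborel f" and "g \<in> borel_measurable borel" and "\<And>x. cmod (g x) \<le> C"
  shows "integrable lborel (\<lambda>x. f x * g x)"
proof (rule Bochner_Integration.integrable_bound)
  show "integrable lborel (\<lambda>x. C * f x)"
    using assms(1) by simp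
  show "(\<lambda>x. f x * g x) \<in> borel_measurable lborel"
    using assms borel_measurable_integrable[OF assms(1)] by simp
  show "AE x in lborel. norm (f x * g x) \<le> norm (C * f x)"
  proof (intro always_eventually allI)
    fix x
    have "cmod (f x) * cmod (g x) \<le> cmod (f x) * \<bar>C\<bar>"
      using assms(3)[of x] by (intro mult_left_mono) auto
    then show "norm (f x * g x) \<le> norm (C * f x)"
      by (simp add: norm_mult mult.commute)
  qed
qed

lemma integrable_fourier_kernel:
  assumes "integrable lborel f"
  shows "integrable lborel (\<lambda>t. f t * exp (\<i> * of_real x * of_real t))"
  by (rule integrable_mult_bounded[OF assms, where C=1]) auto

lemma cmod_fourier_le:
  assumes "integrable lborel f"
  shows "cmod (real_fourier f x) \<le> (LINT t|lborel. cmod (f t))"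
proof -
  have "cmod (LINT t|lborel. f t * exp (\<i> * of_real x * of_real t))
      \<le> (LINT t|lborel. cmod (f t * exp (\<i> * of_real x * of_real t)))"
    by (rule integral_norm_bound)
  also have "\<dots> = (LINT t|lborel. cmod (f t))"
    by (simp only: norm_mult norm_exp_i_real mult_1_right)
  finally have *: "cmod (LINT t|lborel. f t * exp (\<i> * of_real x * of_real t)) \<le> (LINT t|lborel. cmod (f t))" .
  have "sqrt (2 * pi) \<ge> 1"
    using pi_gt3 by simp
  then have "cmod (real_fourier f x) \<le> 1 * cmod (LINT t|lborel. f t * exp (\<i> * of_real x * of_real t))"
    unfolding fourier_def norm_mult
    by (intro mult_right_mono) (auto simp: norm_divide field_simps)
  with * show ?thesis by simp
qed

text \<open>
  Fubini's theorem. With a Gaussian or a Poisson kernel as second factor it yields the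
  regularisation identity, Bessel's inequality and the Poisson integral.
\<close>

lemma fourier_multiplication:
  assumes f: "integrable lborel f" and g: "integrable lborel g"
  shows "(LINT t|lborel. f t * real_fourier g t) = (LINT x|lborel. real_fourier f x * g x)"
proof -
  have [measurable]: "f \<in> borel_measurable borel" "g \<in> borel_measurable borel"
    using f g by auto
  have "integrable (lborel \<Otimes>\<^sub>M lborel) (case_prod (\<lambda>t x. f t * g x * exp (\<i> * of_real x * of_real t)))"
  proof (rule lborel_pair.Fubini_integrable)
    show "integrable lborel (\<lambda>t. LINT x|lborel.
        cmod (case (t, x) of (t, x) \<Rightarrow> f t * g x * exp (\<i> * of_real x * of_real t)))"
      unfolding prod.case norm_mult norm_exp_i_real using f by simp
    have "integrable lborel (\<lambda>x. f t * (g x * exp (\<i> * of_real t * of_real x)))" for t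
      by (intro integrable_mult_right integrable_fourier_kernel g)
    then show "AE t in lborel. integrable lborel
        (\<lambda>x. case (t, x) of (t, x) \<Rightarrow> f t * g x * exp (\<i> * of_real x * of_real t))"
      by (auto simp: mult_ac)
  qed measurable
  from lborel_pair.Fubini_integral[OF this]
  have eq: "(LINT x|lborel. LINT t|lborel. f t * g x * exp (\<i> * of_real x * of_real t))
      = (LINT t|lborel. LINT x|lborel. f t * g x * exp (\<i> * of_real x * of_real t))" .
  have 1: "(LINT t|lborel. f t * g x * exp (\<i> * of_real x * of_real t))
      = sqrt (2*pi) * (real_fourier f x * g x)" for x
  proof -
    have "(LINT t|lborel. f t * g x * exp (\<i> * of_real x * of_real t))
      = (LINT t|lborel. g x * (f t * exp (\<i> * of_real x * of_real t)))"
      by (intro Bochner_Integration.integral_cong) (auto simp: mult_ac)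
    then show ?thesis
      by (simp add: fourier_def del: of_real_mult)
  qed
  have 2: "(LINT x|lborel. f t * g x * exp (\<i> * of_real x * of_real t))
      = sqrt (2*pi) * (f t * real_fourier g t)" for t
  proof -
    have "(LINT x|lborel. f t * g x * exp (\<i> * of_real x * of_real t))
      = (LINT x|lborel. f t * (g x * exp (\<i> * of_real t * of_real x)))"
      by (intro Bochner_Integration.integral_cong) (auto simp: mult_ac)
    then show ?thesis
      by (simp add: fourier_def del: of_real_mult)
  qed
  from eq show ?thesis
    unfolding 1 2 by (simp del: of_real_mult)
qed

text \<open>
  This is the characteristic function of the standard normal distribution, rescaled.
\<close>

lemma fourier_gaussian:
  assumes "\<epsilon> > 0"
  shows "real_fourier (\<lambda>x. of_real (exp (- \<epsilon> * x\<^sup>2 / 2))) t = of_real (exp (- t\<^sup>2 / (2 * \<epsilon>)) / sqrt \<epsilon>)"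
proof -
  have "(CLINT x|std_normal_distribution. iexp (s * x)) = of_real (exp (- (s^2) / 2))" for s
    using char_std_normal_distribution by (simp add: char_def fun_eq_iff)
  then have *: "(LINT x|lborel. std_normal_density x *\<^sub>R iexp (s * x)) = of_real (exp (- (s^2) / 2))" for s
    by (subst (asm) integral_density) auto
  have "(LINT x|lborel. of_real (exp (- \<epsilon> * x\<^sup>2 / 2)) * exp (\<i> * of_real t * of_real x))
     = (1 / sqrt \<epsilon>) *\<^sub>R (LINT u|lborel. of_real (exp (- \<epsilon> * (0 + (1 / sqrt \<epsilon>) * u)\<^sup>2 / 2)) * exp (\<i> * of_real t * of_real (0 + (1 / sqrt \<epsilon>) * u)))"
    using assms by (subst lborel_integral_real_affine[where c="1 / sqrt \<epsilon>" and t=0]) auto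
  also have "(LINT u|lborel. complex_of_real (exp (- \<epsilon> * (0 + (1 / sqrt \<epsilon>) * u)\<^sup>2 / 2)) * exp (\<i> * of_real t * of_real (0 + (1 / sqrt \<epsilon>) * u)))
     = (LINT u|lborel. sqrt (2 * pi) * (std_normal_density u *\<^sub>R iexp ((t / sqrt \<epsilon>) * u)))"
  proof (intro Bochner_Integration.integral_cong refl)
    fix u :: real
    have e: "- \<epsilon> * (0 + (1 / sqrt \<epsilon>) * u)\<^sup>2 / 2 = - u\<^sup>2 / 2"
      using assms by (simp add: power_divide)
    have e2: "sqrt (2 * pi) * std_normal_density u = exp (- u\<^sup>2 / 2)"
      by (simp add: std_normal_density_def)
    have "sqrt (2 * pi) * (std_normal_density u *\<^sub>R iexp ((t / sqrt \<epsilon>) * u)) 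
        = of_real (sqrt (2 * pi) * std_normal_density u) * iexp ((t / sqrt \<epsilon>) * u)"
      by (simp add: scaleR_conv_of_real)
    then show "complex_of_real (exp (- \<epsilon> * (0 + (1 / sqrt \<epsilon>) * u)\<^sup>2 / 2)) * exp (\<i> * of_real t * of_real (0 + (1 / sqrt \<epsilon>) * u))
        = sqrt (2 * pi) * (std_normal_density u *\<^sub>R iexp ((t / sqrt \<epsilon>) * u))"
      unfolding e e2 by (simp add: mult_ac)
  qed
  also have "\<dots> = sqrt (2 * pi) * of_real (exp (- ((t / sqrt \<epsilon>)\<^sup>2) / 2))"
    by (subst integral_mult_right_zero) (subst *, simp)
  finally show ?thesis
    unfolding fourier_def using assms
    by (simp add: scaleR_conv_of_real power_divide field_simps)
qed

section \<open>Gaussian regularisation, Bessel's inequality and inversion\<close>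

lemma fourier_reflect: "fourier (\<lambda>t. f (- t)) z = fourier f (- z)"
proof -
  have "(LINT t|lborel. f t * exp (\<i> * (- z) * of_real t))
      = \<bar>-1\<bar> *\<^sub>R (LINT t|lborel. f (0 + (-1) * t) * exp (\<i> * (- z) * of_real (0 + (-1) * t)))"
    by (rule lborel_integral_real_affine) simp
  then show ?thesis
    unfolding fourier_def by simp
qed

lemma cnj_real_fourier: "cnj (real_fourier f x) = real_fourier (\<lambda>t. cnj (f t)) (- x)"
proof -
  have "cnj (LINT t|lborel. f t * exp (\<i> * of_real x * of_real t))
      = (LINT t|lborel. cnj (f t * exp (\<i> * of_real x * of_real t)))"
    by (rule Bochner_Integration.integral_cnj[symmetric])
  then show ?thesis
    by (simp add: fourier_def exp_cnj)
qed

lemma energy_Fatou: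
  assumes [measurable]: "\<And>n. f n \<in> borel_measurable borel"
    and lim: "AE x in lborel. (\<lambda>n. f n x) \<longlonglongrightarrow> g x"
    and le: "\<And>n. energy (f n) \<le> u n" and u: "u \<longlonglongrightarrow> C"
  shows "energy g \<le> C"
proof -
  have "energy g = (\<integral>\<^sup>+x. liminf (\<lambda>n. ennreal ((cmod (f n x))\<^sup>2)) \<partial>lborel)"
    unfolding energy_def
  proof (intro nn_integral_cong_AE)
    show "AE x in lborel. ennreal ((cmod (g x))\<^sup>2) = liminf (\<lambda>n. ennreal ((cmod (f n x))\<^sup>2))"
      using lim
    proof eventually_elim
      case (elim x)
      then have "(\<lambda>n. ennreal ((cmod (f n x))\<^sup>2)) \<longlonglongrightarrow> ennreal ((cmod (g x))\<^sup>2)"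
        by (intro tendsto_ennrealI tendsto_intros)
      then show ?case
        using lim_imp_Liminf[OF trivial_limit_sequentially] by metis
    qed
  qed
  also have "\<dots> \<le> liminf (\<lambda>n. energy (f n))"
    unfolding energy_def by (rule nn_integral_liminf) measurable
  also have "\<dots> \<le> liminf u"
    by (intro Liminf_mono always_eventually allI le)
  also have "\<dots> = C"
    using u by (rule lim_imp_Liminf[OF trivial_limit_sequentially])
  finally show ?thesis .
qed

lemma integrable_gaussian:
  assumes "\<epsilon> > 0"
  shows "integrable lborel (\<lambda>x. complex_of_real (exp (- \<epsilon> * x\<^sup>2 / 2)))"
proof -
  have "(\<lambda>x. exp (- \<epsilon> * x\<^sup>2 / 2)) = (\<lambda>x. sqrt (2 * pi / \<epsilon>) * normal_density 0 (1 / sqrt \<epsilon>) x)"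
    using assms by (auto simp: normal_density_def fun_eq_iff power_divide real_sqrt_divide field_simps)
  moreover have "integrable lborel (\<lambda>x. sqrt (2 * pi / \<epsilon>) * normal_density 0 (1 / sqrt \<epsilon>) x)"
    using assms by (intro integrable_mult_right integrable_normal_density) auto
  ultimately have "integrable lborel (\<lambda>x. exp (- \<epsilon> * x\<^sup>2 / 2))"
    by metis
  then show ?thesis
    by (rule integrable_of_real)
qed

lemma fourier_modulate:
  "real_fourier (\<lambda>x. g x * exp (- (\<i> * of_real t * of_real x))) s = real_fourier g (s - t)"
proof -
  have "g x * exp (- (\<i> * of_real t * of_real x)) * exp (\<i> * of_real s * of_real x)
      = g x * exp (\<i> * of_real (s - t) * of_real x)" for x
  proof -
  have "exp (- (\<i> * of_real t * of_real x)) * exp (\<i> * of_real s * of_real x)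
      = exp (\<i> * of_real (s - t) * of_real x)"
    by (simp add: algebra_simps flip: exp_add)
  then show ?thesis
    by (simp only: mult.assoc)
  qed
  then show ?thesis
    unfolding fourier_def by presburger
qed

lemma integrable_fourier_times_gaussian:
  assumes "integrable lborel f" "\<epsilon> > 0"
  shows "integrable lborel (\<lambda>x. real_fourier f x * of_real (exp (- \<epsilon> * x\<^sup>2 / 2)))"
proof -
  have [measurable]: "f \<in> borel_measurable borel"
    using assms by auto
  have "integrable lborel (\<lambda>x. of_real (exp (- \<epsilon> * x\<^sup>2 / 2)) * real_fourier f x)"
    by (rule integrable_mult_bounded[OF integrable_gaussian[OF assms(2)] _ cmod_fourier_le[OF assms(1)]])
      measurable
  then show ?thesis by (simp add: mult.commute)
qed

text \<open>
  Damping the transform by a Gaussian amounts to convolving the function with a normal density: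
  in the multiplication formula the second factor is a modulated Gaussian, whose transform is a
  shifted Gaussian.
\<close>

lemma fourier_gaussian_regularised:
  assumes f: "integrable lborel f" and \<epsilon>: "\<epsilon> > 0"
  shows "real_fourier (\<lambda>x. real_fourier f x * of_real (exp (- \<epsilon> * x\<^sup>2 / 2))) (- t)
       = (LINT s|lborel. f s * of_real (normal_density 0 (sqrt \<epsilon>) (s - t)))"
proof -
  define w where "w = (\<lambda>x. complex_of_real (exp (- \<epsilon> * x\<^sup>2 / 2)))"
  define wt where "wt = (\<lambda>x. w x * exp (- (\<i> * of_real t * of_real x)))"
  have "integrable lborel wt"
    unfolding wt_def w_def
    by (rule integrable_mult_bounded[OF integrable_gaussian[OF \<epsilon>], where C=1]) auto
  from fourier_multiplication[OF f this]
  have *: "(LINT x|lborel. real_fourier f x * wt x) = (LINT s|lborel. f s * real_fourier wt s)" ..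
  have ft: "real_fourier wt s = sqrt (2 * pi) * of_real (normal_density 0 (sqrt \<epsilon>) (s - t))" for s
  proof -
    have "real_fourier wt s = real_fourier w (s - t)"
      unfolding wt_def by (rule fourier_modulate)
    also have "\<dots> = of_real (exp (- (s - t)\<^sup>2 / (2 * \<epsilon>)) / sqrt \<epsilon>)"
      unfolding w_def by (rule fourier_gaussian[OF \<epsilon>])
    also have "exp (- (s - t)\<^sup>2 / (2 * \<epsilon>)) / sqrt \<epsilon> = sqrt (2 * pi) * normal_density 0 (sqrt \<epsilon>) (s - t)"
      using \<epsilon> by (simp add: normal_density_def real_sqrt_mult)
    finally show ?thesis by simp
  qed
  have "(LINT x|lborel. real_fourier f x * of_real (exp (- \<epsilon> * x\<^sup>2 / 2)) * exp (\<i> * of_real (- t) * of_real x))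
      = (LINT x|lborel. real_fourier f x * wt x)"
    by (simp add: wt_def w_def mult.assoc)
  also have "\<dots> = (LINT s|lborel. sqrt (2 * pi) * (f s * of_real (normal_density 0 (sqrt \<epsilon>) (s - t))))"
    unfolding * ft by (simp add: mult_ac)
  also have "\<dots> = sqrt (2 * pi) * (LINT s|lborel. f s * of_real (normal_density 0 (sqrt \<epsilon>) (s - t)))"
    by (rule integral_mult_right_zero)
  finally show ?thesis
    unfolding fourier_def[of "\<lambda>x. real_fourier f x * of_real (exp (- \<epsilon> * x\<^sup>2 / 2))"] by (simp del: of_real_mult)
qed

lemma nn_integral_normal_density_shift:
  assumes "\<sigma> > 0"
  shows "(\<integral>\<^sup>+s. ennreal (normal_density 0 \<sigma> (s - t)) \<partial>lborel) = 1"
    and "(\<integral>\<^sup>+t. ennreal (normal_density 0 \<sigma> (s - t)) \<partial>lborel) = 1"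
proof -
  have 1: "(\<integral>\<^sup>+x. ennreal (normal_density 0 \<sigma> x) \<partial>lborel) = 1"
    using assms by (subst nn_integral_eq_integral) auto
  show "(\<integral>\<^sup>+s. ennreal (normal_density 0 \<sigma> (s - t)) \<partial>lborel) = 1"
    using 1 by (subst (asm) nn_integral_real_affine[where c=1 and t="-t"]) auto
  show "(\<integral>\<^sup>+t. ennreal (normal_density 0 \<sigma> (s - t)) \<partial>lborel) = 1"
    using 1 by (subst (asm) nn_integral_real_affine[where c="-1" and t="s"]) auto
qed

text \<open>
  The damped energy of the transform equals the double integral of
  \<open>f s * cnj (f t) * N (s - t)\<close> with a normal density \<open>N\<close>. Since
  \<open>\<bar>f s\<bar> * \<bar>f t\<bar> \<le> (\<bar>f s\<bar>\<^sup>2 + \<bar>f t\<bar>\<^sup>2) / 2\<close>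
  and \<open>N\<close> has mass 1 in either variable, it is at most the energy of \<open>f\<close>.
\<close>

lemma Bessel_gaussian:
  assumes f: "integrable lborel f" and \<epsilon>: "\<epsilon> > 0"
  shows "(\<integral>\<^sup>+x. ennreal ((cmod (real_fourier f x))\<^sup>2 * exp (- \<epsilon> * x\<^sup>2 / 2)) \<partial>lborel) \<le> energy f"
proof -
  have [measurable]: "f \<in> borel_measurable borel"
    using f by auto
  define N where "N = normal_density 0 (sqrt \<epsilon>)"
  have [measurable]: "N \<in> borel_measurable borel" and N0: "\<And>x. N x \<ge> 0"
    by (auto simp: N_def)
  define g where "g = (\<lambda>x. real_fourier f x * of_real (exp (- \<epsilon> * x\<^sup>2 / 2)))"
  have g: "integrable lborel g"
    unfolding g_def by (rule integrable_fourier_times_gaussian[OF f \<epsilon>])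
  have [measurable]: "g \<in> borel_measurable borel"
    using g by auto
  have sq: "complex_of_real ((cmod (real_fourier f x))\<^sup>2 * exp (- \<epsilon> * x\<^sup>2 / 2))
      = g x * real_fourier (\<lambda>t. cnj (f t)) (- x)" for x
    unfolding g_def cnj_real_fourier[symmetric] of_real_mult complex_norm_square by (simp add: mult_ac)
  have int: "integrable lborel (\<lambda>x. g x * real_fourier (\<lambda>t. cnj (f t)) (- x))"
  proof (rule integrable_mult_bounded[OF g, where C="LINT t|lborel. cmod (cnj (f t))"])
    have [measurable]: "(\<lambda>t. cnj (f t)) \<in> borel_measurable borel"
      using borel_measurable_integrable[of lborel "\<lambda>t. cnj (f t)"] f by simp
    show "(\<lambda>x. real_fourier (\<lambda>t. cnj (f t)) (- x)) \<in> borel_measurable borel"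
      by measurable
  next
    fix x
    have "integrable lborel (\<lambda>t. cnj (f t))" using f by simp
    from cmod_fourier_le[OF this]
    show "cmod (real_fourier (\<lambda>t. cnj (f t)) (- x)) \<le> (LINT t|lborel. cmod (cnj (f t)))" .
  qed
  have int': "integrable lborel (\<lambda>x. (cmod (real_fourier f x))\<^sup>2 * exp (- \<epsilon> * x\<^sup>2 / 2))"
    using int unfolding sq[symmetric] complex_of_real_integrable_eq .
  have reg: "real_fourier (\<lambda>x. g (- x)) t = (LINT s|lborel. f s * of_real (N (s - t)))" for t
    unfolding g_def N_def fourier_gaussian_regularised[OF f \<epsilon>, symmetric]
    using fourier_reflect[of g] by (simp add: g_def)
  have "complex_of_real (LINT x|lborel. (cmod (real_fourier f x))\<^sup>2 * exp (- \<epsilon> * x\<^sup>2 / 2))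
      = (LINT x|lborel. g x * real_fourier (\<lambda>t. cnj (f t)) (- x))"
    unfolding sq[symmetric] by (rule integral_complex_of_real[symmetric])
  also have "\<dots> = (LINT x|lborel. g (- x) * real_fourier (\<lambda>t. cnj (f t)) x)"
    by (subst lborel_integral_real_affine[where c="-1" and t=0]) auto
  also have "\<dots> = (LINT t|lborel. real_fourier (\<lambda>x. g (- x)) t * cnj (f t))"
  proof (rule fourier_multiplication)
    show "integrable lborel (\<lambda>x. g (- x))"
      using lborel_integrable_real_affine[OF g, of "-1" 0] by simp
    show "integrable lborel (\<lambda>t. cnj (f t))"
      using f by simp
  qed
  also have "\<dots> = (LINT t|lborel. (LINT s|lborel. f s * of_real (N (s - t))) * cnj (f t))"
    by (simp only: reg)
  finally have eq: "complex_of_real (LINT x|lborel. (cmod (real_fourier f x))\<^sup>2 * exp (- \<epsilon> * x\<^sup>2 / 2)) = \<dots>" .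
  have "(\<integral>\<^sup>+x. ennreal ((cmod (real_fourier f x))\<^sup>2 * exp (- \<epsilon> * x\<^sup>2 / 2)) \<partial>lborel)
      = ennreal (LINT x|lborel. (cmod (real_fourier f x))\<^sup>2 * exp (- \<epsilon> * x\<^sup>2 / 2))"
    by (rule nn_integral_eq_integral[OF int']) auto
  also have "\<dots> \<le> ennreal (cmod (LINT t|lborel. (LINT s|lborel. f s * of_real (N (s - t))) * cnj (f t)))"
    unfolding eq[symmetric] by (intro ennreal_leI) simp
  also have "\<dots> \<le> (\<integral>\<^sup>+t. ennreal (cmod ((LINT s|lborel. f s * of_real (N (s - t))) * cnj (f t))) \<partial>lborel)"
    by (cases "integrable lborel (\<lambda>t. (LINT s|lborel. f s * of_real (N (s - t))) * cnj (f t))")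
      (auto intro: integral_norm_bound_ennreal simp: not_integrable_integral_eq)
  also have "\<dots> \<le> (\<integral>\<^sup>+t. (\<integral>\<^sup>+s. ennreal ((cmod (f s))\<^sup>2 / 2 * N (s - t)) + ennreal ((cmod (f t))\<^sup>2 / 2 * N (s - t)) \<partial>lborel) \<partial>lborel)"
  proof (intro nn_integral_mono)
    fix t
    have "ennreal (cmod ((LINT s|lborel. f s * of_real (N (s - t))) * cnj (f t)))
        = ennreal (cmod (LINT s|lborel. f s * of_real (N (s - t)))) * ennreal (cmod (f t))"
      by (simp add: norm_mult ennreal_mult)
    also have "\<dots> \<le> (\<integral>\<^sup>+s. ennreal (cmod (f s * of_real (N (s - t)))) \<partial>lborel) * ennreal (cmod (f t))"
      by (intro mult_right_mono, cases "integrable lborel (\<lambda>s. f s * of_real (N (s - t)))")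
        (auto intro: integral_norm_bound_ennreal simp: not_integrable_integral_eq)
    also have "\<dots> = (\<integral>\<^sup>+s. ennreal (cmod (f s * of_real (N (s - t)))) * ennreal (cmod (f t)) \<partial>lborel)"
      by (rule nn_integral_multc[symmetric]) measurable
    also have "\<dots> \<le> (\<integral>\<^sup>+s. ennreal ((cmod (f s))\<^sup>2 / 2 * N (s - t)) + ennreal ((cmod (f t))\<^sup>2 / 2 * N (s - t)) \<partial>lborel)"
    proof (intro nn_integral_mono)
      fix s
      have "cmod (f s) * cmod (f t) \<le> (cmod (f s))\<^sup>2 / 2 + (cmod (f t))\<^sup>2 / 2"
        using sum_squares_bound[of "cmod (f s)" "cmod (f t)"] by simp
      then have "cmod (f s) * cmod (f t) * N (s - t) \<le> ((cmod (f s))\<^sup>2 / 2 + (cmod (f t))\<^sup>2 / 2) * N (s - t)"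
        by (rule mult_right_mono) (rule N0)
      then have "ennreal (cmod (f s) * N (s - t) * cmod (f t)) \<le> ennreal ((cmod (f s))\<^sup>2 / 2 * N (s - t) + (cmod (f t))\<^sup>2 / 2 * N (s - t))"
        by (intro ennreal_leI) (simp add: algebra_simps)
      then show "ennreal (cmod (f s * of_real (N (s - t)))) * ennreal (cmod (f t))
          \<le> ennreal ((cmod (f s))\<^sup>2 / 2 * N (s - t)) + ennreal ((cmod (f t))\<^sup>2 / 2 * N (s - t))"
        using N0 by (simp add: norm_mult ennreal_mult[symmetric])
    qed
    finally show "ennreal (cmod ((LINT s|lborel. f s * of_real (N (s - t))) * cnj (f t)))
        \<le> (\<integral>\<^sup>+s. ennreal ((cmod (f s))\<^sup>2 / 2 * N (s - t)) + ennreal ((cmod (f t))\<^sup>2 / 2 * N (s - t)) \<partial>lborel)" .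
  qed
  also have "\<dots> = (\<integral>\<^sup>+t. (\<integral>\<^sup>+s. ennreal ((cmod (f s))\<^sup>2 / 2 * N (s - t)) \<partial>lborel) \<partial>lborel)
      + (\<integral>\<^sup>+t. (\<integral>\<^sup>+s. ennreal ((cmod (f t))\<^sup>2 / 2 * N (s - t)) \<partial>lborel) \<partial>lborel)"
    by (subst nn_integral_add[symmetric]) (auto simp: nn_integral_add)
  also have "(\<integral>\<^sup>+t. (\<integral>\<^sup>+s. ennreal ((cmod (f s))\<^sup>2 / 2 * N (s - t)) \<partial>lborel) \<partial>lborel)
      = (\<integral>\<^sup>+s. (\<integral>\<^sup>+t. ennreal ((cmod (f s))\<^sup>2 / 2 * N (s - t)) \<partial>lborel) \<partial>lborel)"
    by (rule lborel_pair.Fubini') measurable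
  also have "\<dots> = (\<integral>\<^sup>+s. ennreal ((cmod (f s))\<^sup>2 / 2) \<partial>lborel)"
    using \<epsilon> N0 by (subst ennreal_mult)
      (auto simp: nn_integral_cmult N_def nn_integral_normal_density_shift)
  also have "(\<integral>\<^sup>+t. (\<integral>\<^sup>+s. ennreal ((cmod (f t))\<^sup>2 / 2 * N (s - t)) \<partial>lborel) \<partial>lborel)
      = (\<integral>\<^sup>+t. ennreal ((cmod (f t))\<^sup>2 / 2) \<partial>lborel)"
    using \<epsilon> N0 by (subst ennreal_mult)
      (auto simp: nn_integral_cmult N_def nn_integral_normal_density_shift)
  also have "(\<integral>\<^sup>+t. ennreal ((cmod (f t))\<^sup>2 / 2) \<partial>lborel) + (\<integral>\<^sup>+t. ennreal ((cmod (f t))\<^sup>2 / 2) \<partial>lborel)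
      = energy f"
    unfolding energy_def by (subst nn_integral_add[symmetric]) (auto simp flip: ennreal_plus)
  finally show ?thesis .
qed

text \<open>
  Fatou's lemma removes the Gaussian damping.
\<close>

lemma Bessel_inequality:
  assumes f: "integrable lborel f"
  shows "energy (real_fourier f) \<le> energy f"
proof (rule energy_Fatou[OF _ _ _ tendsto_const])
  have [measurable]: "f \<in> borel_measurable borel"
    using f by auto
  let ?g = "\<lambda>n x. real_fourier f x * of_real (exp (- (x\<^sup>2 / (4 * real (Suc n)))))"
  show "?g n \<in> borel_measurable borel" for n
    by measurable
  have "(\<lambda>n. ?g n x) \<longlonglongrightarrow> real_fourier f x * of_real (exp (- 0))" for x
  proof (intro tendsto_intros)
    have "(\<lambda>n. (x\<^sup>2 / 4) * (1 / real (Suc n))) \<longlonglongrightarrow> (x\<^sup>2 / 4) * 0"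
      by (intro tendsto_intros LIMSEQ_Suc[OF lim_1_over_n, unfolded of_nat_Suc of_real_of_nat_eq])
         (use LIMSEQ_Suc[OF lim_1_over_n] in simp)
    then show "(\<lambda>n. x\<^sup>2 / (4 * real (Suc n))) \<longlonglongrightarrow> 0"
      by simp
  qed
  then show "AE x in lborel. (\<lambda>n. ?g n x) \<longlonglongrightarrow> real_fourier f x"
    by simp
  show "energy (?g n) \<le> energy f" for n
  proof -
    have "energy (?g n) = (\<integral>\<^sup>+x. ennreal ((cmod (real_fourier f x))\<^sup>2 * exp (- (1 / Suc n) * x\<^sup>2 / 2)) \<partial>lborel)"
      unfolding energy_def
    proof (intro nn_integral_cong)
      fix x
      have "(exp (- (x\<^sup>2 / (4 * real (Suc n)))))\<^sup>2 = exp (- (1 / Suc n) * x\<^sup>2 / 2)"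
        unfolding exp_double[symmetric] by (simp add: field_simps)
      then show "ennreal ((cmod (?g n x))\<^sup>2)
          = ennreal ((cmod (real_fourier f x))\<^sup>2 * exp (- (1 / Suc n) * x\<^sup>2 / 2))"
        unfolding norm_mult power_mult_distrib norm_of_real abs_exp_cancel by (rule arg_cong)
    qed
    also have "\<dots> \<le> energy f"
      by (rule Bessel_gaussian[OF f]) simp
    finally show ?thesis .
  qed
qed

text \<open>
  In the regularised identity the variance of the normal density tends to 0. Integrability of
  the transform dominates one side; boundedness and continuity of \<open>f\<close> give the limit of the
  other.
\<close>

lemma fourier_inversion:
  assumes f: "integrable lborel f" and cont: "continuous_on UNIV f" and bd: "\<And>x. cmod (f x) \<le> B"
    and ft: "integrable lborel (real_fourier f)"
  shows "real_fourier (real_fourier f) (- t) = f t"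
proof (rule LIMSEQ_unique)
  have [measurable]: "f \<in> borel_measurable borel"
    using f by auto
  define \<sigma> where "\<sigma> n = 1 / real (Suc n)" for n
  have \<sigma>pos: "\<sigma> n > 0" for n by (simp add: \<sigma>_def)
  have \<sigma>lim: "\<sigma> \<longlonglongrightarrow> 0"
    unfolding \<sigma>_def using LIMSEQ_Suc[OF lim_1_over_n[where 'a=real]] by simp
  let ?I = "\<lambda>n. real_fourier (\<lambda>x. real_fourier f x * of_real (exp (- (\<sigma> n)\<^sup>2 * x\<^sup>2 / 2))) (- t)"
  show "?I \<longlonglongrightarrow> real_fourier (real_fourier f) (- t)"
    unfolding fourier_def[of "\<lambda>x. real_fourier f x * _ x"] fourier_def[of "real_fourier f"]
  proof (intro tendsto_mult tendsto_const integral_dominated_convergence)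
    show "integrable lborel (\<lambda>x. cmod (real_fourier f x))"
      using ft by simp
    show "AE x in lborel. (\<lambda>n. real_fourier f x * of_real (exp (- (\<sigma> n)\<^sup>2 * x\<^sup>2 / 2)) * exp (\<i> * of_real (- t) * of_real x))
        \<longlonglongrightarrow> real_fourier f x * exp (\<i> * of_real (- t) * of_real x)"
    proof (intro always_eventually allI)
      fix x
      have "(\<lambda>n. real_fourier f x * of_real (exp (- (\<sigma> n)\<^sup>2 * x\<^sup>2 / 2)) * exp (\<i> * of_real (- t) * of_real x))
        \<longlonglongrightarrow> real_fourier f x * of_real (exp (- 0\<^sup>2 * x\<^sup>2 / 2)) * exp (\<i> * of_real (- t) * of_real x)"
        by (intro tendsto_intros \<sigma>lim) auto
      then show "(\<lambda>n. real_fourier f x * of_real (exp (- (\<sigma> n)\<^sup>2 * x\<^sup>2 / 2)) * exp (\<i> * of_real (- t) * of_real x))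
        \<longlonglongrightarrow> real_fourier f x * exp (\<i> * of_real (- t) * of_real x)"
        by simp
    qed
    show "AE x in lborel. cmod (real_fourier f x * of_real (exp (- (\<sigma> n)\<^sup>2 * x\<^sup>2 / 2)) * exp (\<i> * of_real (- t) * of_real x))
        \<le> cmod (real_fourier f x)" for n
      by (intro always_eventually allI) (auto simp: norm_mult intro!: mult_left_le)
  qed measurable
  have "?I n = (LINT u|lborel. f (t + \<sigma> n * u) * of_real (std_normal_density u))" for n
  proof -
    have "?I n = (LINT s|lborel. f s * of_real (normal_density 0 (\<sigma> n) (s - t)))"
      using fourier_gaussian_regularised[OF f, of "(\<sigma> n)\<^sup>2" t] \<sigma>pos[of n] by simp
    also have "\<dots> = \<sigma> n *\<^sub>R (LINT u|lborel. f (t + \<sigma> n * u) * of_real (normal_density 0 (\<sigma> n) (\<sigma> n * u)))"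
      using \<sigma>pos[of n] by (subst lborel_integral_real_affine[where c="\<sigma> n" and t=t]) auto
    also have "\<dots> = (LINT u|lborel. f (t + \<sigma> n * u) * of_real (std_normal_density u))"
    proof (subst integral_scaleR_right[symmetric], intro Bochner_Integration.integral_cong refl)
      fix u
      have "\<sigma> n * normal_density 0 (\<sigma> n) (\<sigma> n * u) = std_normal_density u"
        using \<sigma>pos[of n]
        by (simp add: normal_density_def real_sqrt_mult power_mult_distrib)
      then show "\<sigma> n *\<^sub>R (f (t + \<sigma> n * u) * of_real (normal_density 0 (\<sigma> n) (\<sigma> n * u)))
          = f (t + \<sigma> n * u) * of_real (std_normal_density u)"
        by (metis mult.left_commute of_real_mult scaleR_conv_of_real)
    qed
    finally show ?thesis .
  qed
  moreover have "(\<lambda>n. LINT u|lborel. f (t + \<sigma> n * u) * of_real (std_normal_density u))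
      \<longlonglongrightarrow> (LINT u|lborel. f t * of_real (std_normal_density u))"
  proof (rule integral_dominated_convergence)
    show "integrable lborel (\<lambda>u. B * std_normal_density u)"
      by (intro integrable_mult_right integrable_normal_density) auto
    show "AE u in lborel. (\<lambda>n. f (t + \<sigma> n * u) * of_real (std_normal_density u))
        \<longlonglongrightarrow> f t * of_real (std_normal_density u)"
    proof (intro always_eventually allI tendsto_intros)
      fix u
      have "(\<lambda>n. t + \<sigma> n * u) \<longlonglongrightarrow> t + 0 * u"
        by (intro tendsto_intros \<sigma>lim)
      then show "(\<lambda>n. f (t + \<sigma> n * u)) \<longlonglongrightarrow> f t"
        using cont by (intro isCont_tendsto_compose[of t f]) (auto simp: continuous_on_eq_continuous_at)
    qed
    show "AE u in lborel. cmod (f (t + \<sigma> n * u) * of_real (std_normal_density u)) \<le> B * std_normal_density u" for n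
      by (intro always_eventually allI) (auto simp: norm_mult intro!: mult_right_mono bd)
  qed measurable
  moreover have "(LINT u|lborel. f t * of_real (std_normal_density u)) = f t"
    by simp
  ultimately show "?I \<longlonglongrightarrow> f t"
    by simp
qed

section \<open>Transforms on horizontal lines\<close>

text \<open>
  On the line \<open>Im z = c\<close> the kernel \<open>exp (i z t)\<close> has modulus \<open>exp (- c t)\<close>; moving that
  factor to the function reduces a transform on the line to one with real argument.
\<close>

definition weighted :: "real \<Rightarrow> (real \<Rightarrow> complex) \<Rightarrow> real \<Rightarrow> complex" where
  "weighted c f t = of_real (exp (- c * t)) * f t"

lemma borel_measurable_weighted [measurable]:
  "f \<in> borel_measurable borel \<Longrightarrow> weighted c f \<in> borel_measurable borel"
  unfolding weighted_def by measurable

lemma of_real_mult_mult: "complex_of_real a * (of_real b * z) = of_real (a * b) * z"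
  by simp

lemma borel_measurable_weighted_iff: "weighted c f \<in> borel_measurable borel \<longleftrightarrow> f \<in> borel_measurable borel"
proof
  assume [measurable]: "weighted c f \<in> borel_measurable borel"
  have "f = (\<lambda>t. of_real (exp (c * t)) * weighted c f t)"
    unfolding weighted_def of_real_mult_mult exp_add[symmetric] by simp
  also have "\<dots> \<in> borel_measurable borel"
    by measurable
  finally show "f \<in> borel_measurable borel" .
qed measurable

lemma weighted_weighted: "weighted c (weighted d f) = weighted (c + d) f"
  unfolding weighted_def of_real_mult_mult exp_add[symmetric] by (simp add: algebra_simps)

lemma cmod_weighted: "cmod (weighted c f t) = exp (- c * t) * cmod (f t)"
  by (simp add: weighted_def norm_mult)

lemma weighted_kernel:
  "f t * exp (\<i> * z * of_real t) = weighted (Im z) f t * exp (\<i> * of_real (Re z) * of_real t)"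
proof -
  have "\<i> * z * of_real t = of_real (- Im z * t) + \<i> * of_real (Re z) * of_real t"
    by (subst (1) complex_eq[of z]) (simp add: algebra_simps)
  then have "exp (\<i> * z * of_real t) = of_real (exp (- Im z * t)) * exp (\<i> * of_real (Re z) * of_real t)"
    by (simp only: exp_add exp_of_real)
  then show ?thesis
    unfolding weighted_def by (simp only: mult_ac)
qed

lemma fourier_weighted: "fourier f z = real_fourier (weighted (Im z) f) (Re z)"
  unfolding fourier_def by (subst weighted_kernel) (rule refl)

lemma fourier_Complex: "fourier f (Complex x c) = real_fourier (weighted c f) x"
  using fourier_weighted[of f "Complex x c"] by simp

lemma integrable_weighted_iff:
  "integrable lborel (\<lambda>t. f t * exp (\<i> * z * of_real t)) \<longleftrightarrow> integrable lborel (weighted (Im z) f)"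
proof
  assume "integrable lborel (weighted (Im z) f)"
  then show "integrable lborel (\<lambda>t. f t * exp (\<i> * z * of_real t))"
    by (subst weighted_kernel) (rule integrable_fourier_kernel)
next
  assume "integrable lborel (\<lambda>t. f t * exp (\<i> * z * of_real t))"
  then have "integrable lborel (\<lambda>t. f t * exp (\<i> * z * of_real t) * exp (\<i> * of_real (- Re z) * of_real t))"
    by (rule integrable_fourier_kernel)
  then show "integrable lborel (weighted (Im z) f)"
    apply (subst (asm) weighted_kernel)
    unfolding mult.assoc exp_add[symmetric] by simp
qed

lemma measurable_of_integrable_weighted:
  "integrable lborel (weighted c f) \<Longrightarrow> f \<in> borel_measurable borel"
  using borel_measurable_integrable[of lborel "weighted c f"] by (simp add: borel_measurable_weighted_iff)

text \<open>
  The exponential is monotone in the exponent, so for either sign of \<open>t\<close> one of the two outer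
  weights dominates. Integrability on two lines therefore implies integrability on all lines
  between them.
\<close>

lemma exp_weight_le:
  fixes c d e t :: real
  assumes "d \<le> c" "c \<le> e"
  shows "exp (- c * t) \<le> exp (- d * t) + exp (- e * t)"
proof (cases "t \<ge> 0")
  case True
  then have "exp (- c * t) \<le> exp (- d * t)"
    using assms by (simp add: mult_right_mono)
  then show ?thesis by (simp add: add_increasing2)
next
  case False
  then have "exp (- c * t) \<le> exp (- e * t)"
    using assms by (simp add: mult_right_mono_neg)
  then show ?thesis by (simp add: add_increasing)
qed

lemma cmod_weighted_le:
  assumes "d \<le> c" "c \<le> e"
  shows "cmod (weighted c f t) \<le> cmod (weighted d f t) + cmod (weighted e f t)"
  using mult_right_mono[OF exp_weight_le[OF assms, of t], of "cmod (f t)"]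
  by (simp add: cmod_weighted algebra_simps)

lemma integrable_weighted_between:
  assumes "integrable lborel (weighted d f)" "integrable lborel (weighted e f)" "d \<le> c" "c \<le> e"
  shows "integrable lborel (weighted c f)"
proof (rule Bochner_Integration.integrable_bound)
  show "integrable lborel (\<lambda>t. cmod (weighted d f t) + cmod (weighted e f t))"
    using assms by auto
  have [measurable]: "f \<in> borel_measurable borel"
    using measurable_of_integrable_weighted[OF assms(1)] .
  show "weighted c f \<in> borel_measurable lborel"
    by simp
  show "AE t in lborel. cmod (weighted c f t) \<le> norm (cmod (weighted d f t) + cmod (weighted e f t))"
    using cmod_weighted_le[OF assms(3,4)] by (auto intro!: always_eventually)
qed

lemma cmod_fourier_strip_le:
  assumes "integrable lborel (weighted d f)" "integrable lborel (weighted e f)" "d \<le> Im z" "Im z \<le> e"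
  shows "cmod (fourier f z) \<le> (LINT t|lborel. cmod (weighted d f t)) + (LINT t|lborel. cmod (weighted e f t))"
proof -
  have i: "integrable lborel (weighted (Im z) f)"
    using integrable_weighted_between[OF assms] .
  have "cmod (fourier f z) \<le> (LINT t|lborel. cmod (weighted (Im z) f t))"
    unfolding fourier_weighted[of f z] by (rule cmod_fourier_le[OF i])
  also have "\<dots> \<le> (LINT t|lborel. cmod (weighted d f t) + cmod (weighted e f t))"
    using i assms by (intro integral_mono cmod_weighted_le) auto
  also have "\<dots> = (LINT t|lborel. cmod (weighted d f t)) + (LINT t|lborel. cmod (weighted e f t))"
    using assms by (intro Bochner_Integration.integral_add) auto
  finally show ?thesis .
qed

lemma cmod_exp_diff_le:
  assumes "cmod u \<le> B" "cmod v \<le> B"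
  shows "cmod (exp u - exp v) \<le> exp B * cmod (u - v)"
proof (rule field_differentiable_bound[where S="cball 0 B" and f'=exp])
  show "(exp has_field_derivative exp z) (at z within cball 0 B)" for z :: complex
    by (rule DERIV_exp[THEN has_field_derivative_at_within])
  show "cmod (exp z) \<le> exp B" if "z \<in> cball 0 B" for z
    using that by (intro order_trans[OF norm_exp]) auto
qed (use assms in auto)

lemma cmod_exp_minus_1_le: "cmod (exp w - 1) \<le> exp (cmod w) * cmod w"
  using cmod_exp_diff_le[of w "cmod w" 0] by simp

lemma abs_le_exp_div:
  fixes t r :: real
  assumes "r > 0"
  shows "\<bar>t\<bar> \<le> exp (r * \<bar>t\<bar>) / r"
proof -
  have "r * \<bar>t\<bar> \<le> exp (r * \<bar>t\<bar>)"
    using exp_ge_add_one_self[of "r * \<bar>t\<bar>"] by linarith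
  then show ?thesis
    using assms by (simp add: field_simps)
qed

lemma exp_abs_le: 
  fixes r t :: real
  assumes "r \<ge> 0"
  shows "exp (r * \<bar>t\<bar>) \<le> exp (r * t) + exp (- r * t)"
  by (cases "t \<ge> 0") (simp_all add: add_increasing add_increasing2)

text \<open>
  Differentiation under the integral sign. The bounds
  \<open>\<bar>exp w - 1\<bar> \<le> exp \<bar>w\<bar> * \<bar>w\<bar>\<close> and
  \<open>\<bar>t\<bar> \<le> exp (r * \<bar>t\<bar>) / r\<close> dominate the difference quotients by the
  weights at distance \<open>2 * r\<close> above and below.
\<close>

lemma has_field_derivative_fourier:
  assumes f: "\<And>c. \<bar>c - Im z\<bar> \<le> 2 * r \<Longrightarrow> integrable lborel (weighted c f)" and r: "r > 0"
  shows "(fourier f has_field_derivative fourier (\<lambda>t. \<i> * of_real t * f t) z) (at z)"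
proof -
  let ?k = "\<lambda>h t. f t * exp (\<i> * z * of_real t) * ((exp (\<i> * h * of_real t) - 1) / h)"
  have [measurable]: "f \<in> borel_measurable borel"
    using f[of "Im z"] r measurable_of_integrable_weighted by auto
  have int: "integrable lborel (\<lambda>t. f t * exp (\<i> * w * of_real t))" if "\<bar>Im w - Im z\<bar> \<le> 2 * r" for w
    using f[OF that] by (simp add: integrable_weighted_iff)
  have "((\<lambda>h. LINT t|lborel. ?k h t) \<longlongrightarrow> (LINT t|lborel. f t * exp (\<i> * z * of_real t) * (\<i> * of_real t))) (at 0)"
    unfolding tendsto_at_iff_sequentially comp_def
  proof (intro allI impI)
    fix X :: "nat \<Rightarrow> complex"
    assume X: "\<forall>i. X i \<in> UNIV - {0}" and lim: "X \<longlonglongrightarrow> 0"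
    from lim r have "eventually (\<lambda>n. cmod (X n) < r) sequentially"
      by (auto simp: tendsto_iff dist_norm)
    then obtain n0 where n0: "\<And>n. n \<ge> n0 \<Longrightarrow> cmod (X n) < r"
      by (auto simp: eventually_sequentially)
    have "(\<lambda>n. LINT t|lborel. ?k (X (n + n0)) t) \<longlonglongrightarrow> (LINT t|lborel. f t * exp (\<i> * z * of_real t) * (\<i> * of_real t))"
    proof (rule integral_dominated_convergence)
      show "integrable lborel (\<lambda>t. (cmod (weighted (Im z - 2 * r) f t) + cmod (weighted (Im z + 2 * r) f t)) / r)"
        using f r by auto
      show "AE t in lborel. (\<lambda>n. ?k (X (n + n0)) t) \<longlonglongrightarrow> f t * exp (\<i> * z * of_real t) * (\<i> * of_real t)"
      proof (intro always_eventually allI tendsto_mult tendsto_const)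
        fix t :: real
        have "((\<lambda>h. exp (\<i> * h * of_real t)) has_field_derivative \<i> * of_real t) (at 0)"
          by (auto intro!: derivative_eq_intros)
        then have "((\<lambda>h. (exp (\<i> * h * of_real t) - 1) / h) \<longlongrightarrow> \<i> * of_real t) (at 0)"
          by (simp add: has_field_derivative_iff)
        moreover have "filterlim (\<lambda>n. X (n + n0)) (at 0) sequentially"
          using X LIMSEQ_ignore_initial_segment[OF lim, of n0] by (auto simp: filterlim_at)
        ultimately show "(\<lambda>n. (exp (\<i> * X (n + n0) * of_real t) - 1) / X (n + n0)) \<longlonglongrightarrow> \<i> * of_real t"
          by (rule filterlim_compose)
      qed
      show "AE t in lborel. norm (?k (X (n + n0)) t)
          \<le> (cmod (weighted (Im z - 2 * r) f t) + cmod (weighted (Im z + 2 * r) f t)) / r" for n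
      proof (intro always_eventually allI)
        fix t :: real
        let ?h = "X (n + n0)"
        have h: "?h \<noteq> 0" "cmod ?h \<le> r"
          using X n0[of "n + n0"] by auto
        have "cmod (exp (\<i> * ?h * of_real t) - 1) \<le> exp (cmod ?h * \<bar>t\<bar>) * (cmod ?h * \<bar>t\<bar>)"
          using cmod_exp_minus_1_le[of "\<i> * ?h * of_real t"] by (simp add: norm_mult)
        then have "cmod ((exp (\<i> * ?h * of_real t) - 1) / ?h) \<le> exp (cmod ?h * \<bar>t\<bar>) * \<bar>t\<bar>"
          using h by (simp add: norm_divide divide_simps mult_ac)
        also have "\<dots> \<le> exp (r * \<bar>t\<bar>) * (exp (r * \<bar>t\<bar>) / r)"
          using h r by (intro mult_mono abs_le_exp_div) (auto intro!: mult_right_mono)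
        also have "\<dots> = exp ((2 * r) * \<bar>t\<bar>) / r"
          by (simp flip: exp_add)
        also have "\<dots> \<le> (exp ((2 * r) * t) + exp (- (2 * r) * t)) / r"
          using r by (intro divide_right_mono exp_abs_le) auto
        finally have 1: "cmod ((exp (\<i> * ?h * of_real t) - 1) / ?h) \<le> (exp ((2 * r) * t) + exp (- (2 * r) * t)) / r" .
        have "cmod (?k ?h t) = cmod (weighted (Im z) f t) * cmod ((exp (\<i> * ?h * of_real t) - 1) / ?h)"
          unfolding weighted_kernel[of f t z] by (simp only: norm_mult norm_exp_i_real mult_1_right)
        also have "\<dots> \<le> cmod (weighted (Im z) f t) * ((exp ((2 * r) * t) + exp (- (2 * r) * t)) / r)"
          by (intro mult_left_mono 1) auto
        also have "\<dots> = (cmod (weighted (Im z - 2 * r) f t) + cmod (weighted (Im z + 2 * r) f t)) / r"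
        proof -
          have e: "exp (- (Im z - 2 * r) * t) = exp (- Im z * t) * exp ((2 * r) * t)"
                  "exp (- (Im z + 2 * r) * t) = exp (- Im z * t) * exp (- (2 * r) * t)"
            by (simp_all add: algebra_simps flip: exp_add)
          have alg: "A * F * ((B + C) / r) = (A * B * F + A * C * F) / r" for A B C F :: real
            by (simp add: algebra_simps)
          show ?thesis
            unfolding cmod_weighted e by (rule alg)
        qed
        finally show "cmod (?k ?h t) \<le> (cmod (weighted (Im z - 2 * r) f t) + cmod (weighted (Im z + 2 * r) f t)) / r" .
      qed
    qed measurable
    then show "(\<lambda>n. LINT t|lborel. ?k (X n) t) \<longlonglongrightarrow> (LINT t|lborel. f t * exp (\<i> * z * of_real t) * (\<i> * of_real t))"
      by (rule LIMSEQ_offset)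
  qed
  then have "((\<lambda>h. 1 / sqrt (2 * pi) * (LINT t|lborel. ?k h t)) \<longlongrightarrow>
      1 / sqrt (2 * pi) * (LINT t|lborel. f t * exp (\<i> * z * of_real t) * (\<i> * of_real t))) (at 0)"
    by (intro tendsto_intros)
  also have "1 / sqrt (2 * pi) * (LINT t|lborel. f t * exp (\<i> * z * of_real t) * (\<i> * of_real t))
      = fourier (\<lambda>t. \<i> * of_real t * f t) z"
    by (simp add: fourier_def mult_ac)
  also have "((\<lambda>h. 1 / sqrt (2 * pi) * (LINT t|lborel. ?k h t)) \<longlongrightarrow> fourier (\<lambda>t. \<i> * of_real t * f t) z) (at 0)
      \<longleftrightarrow> ((\<lambda>h. (fourier f (z + h) - fourier f z) / h) \<longlongrightarrow> fourier (\<lambda>t. \<i> * of_real t * f t) z) (at 0)"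
  proof (rule filterlim_cong[OF refl refl])
    have "eventually (\<lambda>h::complex. dist h 0 < r) (at 0)" "eventually (\<lambda>h::complex. h \<noteq> 0) (at 0)"
      using r by (auto simp: eventually_at intro!: exI[of _ r])
    then show "eventually (\<lambda>h. 1 / sqrt (2 * pi) * (LINT t|lborel. ?k h t) = (fourier f (z + h) - fourier f z) / h) (at 0)"
    proof eventually_elim
      case (elim h)
      have "\<bar>Im h\<bar> \<le> 2 * r"
        using elim r abs_Im_le_cmod[of h] by simp
      then have "(LINT t|lborel. f t * exp (\<i> * (z + h) * of_real t)) - (LINT t|lborel. f t * exp (\<i> * z * of_real t))
          = (LINT t|lborel. f t * exp (\<i> * (z + h) * of_real t) - f t * exp (\<i> * z * of_real t))"
        using r by (intro Bochner_Integration.integral_diff[symmetric] int) auto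
      also have "\<dots> = (LINT t|lborel. h * ?k h t)"
      proof (intro Bochner_Integration.integral_cong refl)
        fix t :: real
        have "h * ?k h t = f t * exp (\<i> * z * of_real t) * (exp (\<i> * h * of_real t) - 1)"
          using elim by simp
        also have "\<dots> = f t * (exp (\<i> * z * of_real t) * exp (\<i> * h * of_real t)) - f t * exp (\<i> * z * of_real t)"
          by (simp add: right_diff_distrib mult.assoc)
        also have "exp (\<i> * z * of_real t) * exp (\<i> * h * of_real t) = exp (\<i> * (z + h) * of_real t)"
          by (simp add: algebra_simps flip: exp_add)
        finally show "f t * exp (\<i> * (z + h) * of_real t) - f t * exp (\<i> * z * of_real t) = h * ?k h t" ..
      qed
      also have "\<dots> = h * (LINT t|lborel. ?k h t)"
        by (rule integral_mult_right_zero)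
      finally show ?case
        using elim by (simp add: fourier_def field_simps)
    qed
  qed
  finally show ?thesis
    by (simp only: DERIV_def)
qed

lemma holomorphic_fourier:
  assumes f: "\<And>c. c \<in> I \<Longrightarrow> integrable lborel (weighted c f)" and I: "open I"
  shows "fourier f holomorphic_on {z. Im z \<in> I}"
proof (rule holomorphic_onI)
  fix z assume "z \<in> {z. Im z \<in> I}"
  then obtain e where e: "e > 0" "cball (Im z) e \<subseteq> I"
    using I open_contains_cball by blast
  have "(fourier f has_field_derivative fourier (\<lambda>t. \<i> * of_real t * f t) z) (at z)"
    by (rule has_field_derivative_fourier[of _ "e / 2"]) (use e f in \<open>auto simp: dist_real_def abs_minus_commute subset_iff\<close>)
  then show "fourier f field_differentiable at z within {z. Im z \<in> I}"
    using field_differentiable_at_within field_differentiable_def by blast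
qed

lemma set_integrable_exp_minus_Ici:
  assumes "Re w > 0"
  shows "set_integrable lborel {0..} (\<lambda>t. exp (- w * of_real t))"
proof -
  have "(\<lambda>t. exp (- Re w * t)) absolutely_integrable_on {0..}"
    using integrable_on_exp_minus_to_infinity[OF assms, of 0]
    by (subst absolutely_integrable_on_iff_nonneg) auto
  then have "integrable lborel (\<lambda>t. indicator {0..} t *\<^sub>R exp (- Re w * t))"
    unfolding set_integrable_def by (subst (asm) integrable_completion) auto
  then show ?thesis
    unfolding set_integrable_def
    by (rule Bochner_Integration.integrable_bound) (auto simp: indicator_def)
qed

lemma LINT_exp_minus_Ici:
  assumes w: "Re w > 0"
  shows "(LINT t:{0..}|lborel. exp (- w * of_real t)) = 1 / w"
proof -
  have w0: "w \<noteq> 0" using w by auto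
  have int: "set_integrable lborel {0<..} (\<lambda>t. exp (- w * complex_of_real t))"
    by (rule set_integrable_subset[OF set_integrable_exp_minus_Ici[OF w]]) auto
  have "(LINT t:{0..}|lborel. exp (- w * of_real t)) = (LINT t:{0<..}|lborel. exp (- w * complex_of_real t))"
    unfolding set_lebesgue_integral_def
  proof (rule integral_cong_AE)
    show "AE t in lborel. indicator {0..} t *\<^sub>R exp (- w * complex_of_real t) = indicator {0<..} t *\<^sub>R exp (- w * complex_of_real t)"
      using AE_lborel_singleton[of 0] by eventually_elim (simp add: indicator_def)
  qed measurable
  also have "\<dots> = (LBINT t=ereal 0..\<infinity>. exp (- w * complex_of_real t))"
    by (rule interval_integral_to_infinity_eq[symmetric])
  also have "\<dots> = 0 - (- 1 / w)"
  proof (rule interval_integral_FTC_integrable[where F="\<lambda>t. - exp (- w * complex_of_real t) / w"])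
    show "((\<lambda>t. - exp (- w * complex_of_real t) / w) has_vector_derivative exp (- w * complex_of_real x)) (at x)" for x
    proof -
      have "((\<lambda>z. - exp (- w * z) / w) has_field_derivative exp (- w * of_real x)) (at (of_real x))"
        using w0 by (auto intro!: derivative_eq_intros)
      then show ?thesis
        by (rule has_vector_derivative_real_field)
    qed
    show "isCont (\<lambda>t. exp (- w * complex_of_real t)) x" for x
      by (intro continuous_intros)
    show "set_integrable lborel (einterval (ereal 0) \<infinity>) (\<lambda>t. exp (- w * complex_of_real t))"
      using int by (simp add: einterval_def greaterThan_def)
    have "((\<lambda>t. - exp (- w * complex_of_real t) / w) \<longlongrightarrow> - exp (- w * complex_of_real 0) / w) (at_right 0)"
      using w0 by (intro tendsto_intros) auto
    then show "(((\<lambda>t. - exp (- w * complex_of_real t) / w) \<circ> real_of_ereal) \<longlongrightarrow> - 1 / w) (at_right (ereal 0))"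
      unfolding ereal_tendsto_simps1 by simp
    have "filterlim (\<lambda>t::real. - Re w * t) at_bot at_top"
      by (rule filterlim_tendsto_neg_mult_at_bot[OF tendsto_const _ filterlim_ident]) (use w in simp)
    then have "((\<lambda>t. exp (- Re w * t)) \<longlongrightarrow> 0) at_top"
      by (rule filterlim_compose[OF exp_at_bot])
    then have "((\<lambda>t. exp (- Re w * t) / cmod w) \<longlongrightarrow> 0) at_top"
      by (rule tendsto_divide_zero)
    then have "((\<lambda>t. - exp (- w * complex_of_real t) / w) \<longlongrightarrow> 0) at_top"
      by (subst tendsto_norm_zero_iff[symmetric]) (simp add: norm_divide)
    then show "(((\<lambda>t. - exp (- w * complex_of_real t) / w) \<circ> real_of_ereal) \<longlongrightarrow> 0) (at_left \<infinity>)"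
      unfolding ereal_tendsto_simps1 .
  qed auto
  finally show ?thesis by simp
qed

section \<open>Limits in mean\<close>

lemma energy_tendsto_0:
  assumes [measurable]: "\<And>n. f n \<in> borel_measurable borel" and g: "g \<in> L2"
    and bd: "\<And>n x. cmod (f n x) \<le> cmod (g x)"
    and lim: "\<And>x. (\<lambda>n. f n x) \<longlonglongrightarrow> 0"
  shows "(\<lambda>n. energy (f n)) \<longlonglongrightarrow> 0"
proof -
  have [measurable]: "g \<in> borel_measurable borel"
    using g by (rule L2D)
  have "(\<lambda>n. energy (f n)) \<longlonglongrightarrow> (\<integral>\<^sup>+(x::real). 0 \<partial>lborel)"
    unfolding energy_def
  proof (rule nn_integral_dominated_convergence)
    show "AE x in lborel. ennreal ((cmod (f n x))\<^sup>2) \<le> ennreal ((cmod (g x))\<^sup>2)" for n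
      by (intro always_eventually allI ennreal_leI power_mono bd) auto
    show "(\<integral>\<^sup>+x. ennreal ((cmod (g x))\<^sup>2) \<partial>lborel) < \<infinity>"
      using L2D(2)[OF g] by (simp add: energy_def)
    have "(\<lambda>n. ennreal ((cmod (f n x))\<^sup>2)) \<longlonglongrightarrow> ennreal ((cmod 0)\<^sup>2)" for x
      by (intro tendsto_ennrealI tendsto_intros lim)
    then show "AE x in lborel. (\<lambda>n. ennreal ((cmod (f n x))\<^sup>2)) \<longlonglongrightarrow> 0"
      by simp
  qed measurable
  then show ?thesis by simp
qed

text \<open>
  Two errors are made small one after the other, the first by a choice of \<open>n\<close>, the second
  along the filter.
\<close>

lemma tendsto_0_if_le_add:
  fixes X :: "'a \<Rightarrow> ennreal"
  assumes le: "\<And>n r. X r \<le> u n + v r" and u: "u \<longlonglongrightarrow> 0" and v: "(v \<longlongrightarrow> 0) F"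
  shows "(X \<longlongrightarrow> 0) F"
proof (rule order_tendstoI)
  fix e :: ennreal assume "0 < e"
  then obtain d where d: "0 < d" "d < e"
    using dense by blast
  then obtain r where r: "d = ennreal r" "r > 0"
    by (cases d) (auto simp: top_unique)
  have "eventually (\<lambda>n. u n < ennreal (r / 2)) sequentially"
    using u r by (intro order_tendstoD) auto
  then obtain n where n: "u n < ennreal (r / 2)"
    by (auto simp: eventually_sequentially)
  have "eventually (\<lambda>x. v x < ennreal (r / 2)) F"
    using v r by (intro order_tendstoD) auto
  then show "eventually (\<lambda>x. X x < e) F"
  proof eventually_elim
    case (elim x)
    have "X x \<le> ennreal (r / 2) + ennreal (r / 2)"
      using n elim by (intro order_trans[OF le[of x n]] add_mono) auto
    also have "\<dots> = d"
      using r by (simp flip: ennreal_plus)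
    finally show ?case using d by simp
  qed
qed auto

definition truncation :: "real \<Rightarrow> (real \<Rightarrow> complex) \<Rightarrow> real \<Rightarrow> complex" where
  "truncation R f t = indicator {-R..R} t *\<^sub>R f t"

lemma borel_measurable_truncation [measurable]:
  "f \<in> borel_measurable borel \<Longrightarrow> truncation R f \<in> borel_measurable borel"
  unfolding truncation_def by measurable

lemma cmod_truncation_le: "cmod (truncation R f t) \<le> cmod (f t)"
  by (simp add: truncation_def indicator_def)

lemma truncation_tendsto:
  assumes "filterlim X at_top F"
  shows "((\<lambda>n. truncation (X n) f t) \<longlongrightarrow> f t) F"
proof (rule tendsto_eventually)
  have "eventually (\<lambda>n. X n \<ge> \<bar>t\<bar>) F"
    using assms by (simp add: filterlim_at_top)
  then show "eventually (\<lambda>n. truncation (X n) f t = f t) F"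
    by eventually_elim (auto simp: truncation_def indicator_def)
qed

lemma fourier_cut_eq: "fourier_cut R f x = real_fourier (truncation R f) x"
  by (simp add: fourier_cut_def fourier_def set_lebesgue_integral_def truncation_def del: of_real_mult)

lemma integrable_truncation:
  assumes "f \<in> L2"
  shows "integrable lborel (truncation R f)"
proof -
  from integrable_mult_L2[OF indicator_L2 assms] show ?thesis
    unfolding truncation_def[abs_def] scaleR_conv_of_real .
qed

lemma energy_tail:
  assumes "f \<in> L2"
  shows "((\<lambda>R. energy (\<lambda>t. f t - truncation R f t)) \<longlongrightarrow> 0) at_top"
proof (rule tendsto_at_topI_sequentially)
  have [measurable]: "f \<in> borel_measurable borel"
    using assms by (rule L2D)
  fix X :: "nat \<Rightarrow> real" assume X: "filterlim X at_top sequentially"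
  show "(\<lambda>n. energy (\<lambda>t. f t - truncation (X n) f t)) \<longlonglongrightarrow> 0"
  proof (rule energy_tendsto_0[OF _ assms])
    show "cmod (f t - truncation (X n) f t) \<le> cmod (f t)" for n t
      by (auto simp: truncation_def indicator_def)
    show "(\<lambda>n. f t - truncation (X n) f t) \<longlonglongrightarrow> 0" for t
      using tendsto_diff[OF tendsto_const[of "f t"] truncation_tendsto[OF X, of f t]] by simp
  qed measurable
qed

lemma real_fourier_diff:
  assumes "integrable lborel f" "integrable lborel g"
  shows "real_fourier (\<lambda>t. f t - g t) x = real_fourier f x - real_fourier g x"
  unfolding fourier_def left_diff_distrib
  by (subst Bochner_Integration.integral_diff) (auto intro: integrable_fourier_kernel assms simp: right_diff_distrib)

text \<open>
  Bessel's inequality carries an approximation of \<open>f\<close> by integrable functions over to the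
  transforms of the truncations of \<open>f\<close>, through
  \<open>F - fourier_cut R f = (F - fourier g) + fourier (g - truncation R f)\<close>. It thus suffices to
  control transforms that converge absolutely.
\<close>

lemma has_L2_fourier_approx:
  assumes f: "f \<in> L2" and F: "F \<in> L2"
    and g: "\<And>n. integrable lborel (g n)"
    and conv: "(\<lambda>n. energy (\<lambda>t. f t - g n t)) \<longlonglongrightarrow> 0"
    and convF: "(\<lambda>n. energy (\<lambda>x. F x - real_fourier (g n) x)) \<longlonglongrightarrow> 0"
  shows "has_L2_fourier f F"
proof -
  have [measurable]: "f \<in> borel_measurable borel" "F \<in> borel_measurable borel" "\<And>n. g n \<in> borel_measurable borel"
    using f F g by (auto dest: L2D)
  have "energy (\<lambda>x. F x - fourier_cut R f x) \<le>
      (2 * energy (\<lambda>x. F x - real_fourier (g n) x) + 4 * energy (\<lambda>t. f t - g n t))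
        + 4 * energy (\<lambda>t. f t - truncation R f t)" for n R
  proof -
    have "energy (\<lambda>x. F x - fourier_cut R f x) =
        energy (\<lambda>x. (F x - real_fourier (g n) x) + real_fourier (\<lambda>t. g n t - truncation R f t) x)"
      by (simp add: fourier_cut_eq real_fourier_diff[OF g integrable_truncation[OF f]])
    also have "\<dots> \<le> 2 * energy (\<lambda>x. F x - real_fourier (g n) x) + 2 * energy (real_fourier (\<lambda>t. g n t - truncation R f t))"
      by (rule energy_add_le) measurable
    also have "\<dots> \<le> 2 * energy (\<lambda>x. F x - real_fourier (g n) x) +
        2 * (2 * energy (\<lambda>t. f t - truncation R f t) + 2 * energy (\<lambda>t. f t - g n t))"
    proof (intro add_left_mono mult_left_mono)
      have "energy (real_fourier (\<lambda>t. g n t - truncation R f t)) \<le> energy (\<lambda>t. g n t - truncation R f t)"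
        by (rule Bessel_inequality) (auto intro: g integrable_truncation f)
      also have "\<dots> = energy (\<lambda>t. (f t - truncation R f t) - (f t - g n t))"
        by simp
      also have "\<dots> \<le> 2 * energy (\<lambda>t. f t - truncation R f t) + 2 * energy (\<lambda>t. f t - g n t)"
        by (rule energy_diff_le) measurable
      finally show "energy (real_fourier (\<lambda>t. g n t - truncation R f t))
          \<le> 2 * energy (\<lambda>t. f t - truncation R f t) + 2 * energy (\<lambda>t. f t - g n t)" .
    qed simp
    finally show ?thesis
      by (simp add: algebra_simps)
  qed
  moreover have "(\<lambda>n. 2 * energy (\<lambda>x. F x - real_fourier (g n) x) + 4 * energy (\<lambda>t. f t - g n t)) \<longlonglongrightarrow> 0"
    using tendsto_add[OF ennreal_tendsto_cmult[OF _ convF, of 2] ennreal_tendsto_cmult[OF _ conv, of 4]] by simp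
  moreover have "((\<lambda>R. 4 * energy (\<lambda>t. f t - truncation R f t)) \<longlongrightarrow> 0) at_top"
    using ennreal_tendsto_cmult[OF _ energy_tail[OF f], of 4] by simp
  ultimately have "((\<lambda>R. energy (\<lambda>x. F x - fourier_cut R f x)) \<longlongrightarrow> 0) at_top"
    by (rule tendsto_0_if_le_add)
  then show ?thesis
    using f F unfolding has_L2_fourier_def energy_def by blast
qed

text \<open>
  The comparison goes through a truncation of \<open>f\<close>, and the constant comes from using the
  triangle inequality for squares twice.
\<close>

lemma energy_fourier_diff_le:
  assumes F: "has_L2_fourier f F" and g: "integrable lborel g"
  shows "energy (\<lambda>x. F x - real_fourier g x) \<le> 4 * energy (\<lambda>t. f t - g t)"
proof -
  have f: "f \<in> L2" and FL: "F \<in> L2"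
    and lim: "((\<lambda>R. energy (\<lambda>x. F x - fourier_cut R f x)) \<longlongrightarrow> 0) at_top"
    using F by (auto simp: has_L2_fourier_def energy_def)
  have [measurable]: "f \<in> borel_measurable borel" "F \<in> borel_measurable borel" "g \<in> borel_measurable borel"
    using f FL g by (auto dest: L2D)
  have "energy (\<lambda>x. F x - real_fourier g x) \<le>
      4 * energy (\<lambda>t. f t - g t) + (2 * energy (\<lambda>x. F x - fourier_cut R f x) + 4 * energy (\<lambda>t. f t - truncation R f t))" for R
  proof -
    have "energy (\<lambda>x. F x - real_fourier g x) =
        energy (\<lambda>x. (F x - fourier_cut R f x) - real_fourier (\<lambda>t. g t - truncation R f t) x)"
      by (simp add: fourier_cut_eq real_fourier_diff[OF g integrable_truncation[OF f]])
    also have "\<dots> \<le> 2 * energy (\<lambda>x. F x - fourier_cut R f x) + 2 * energy (real_fourier (\<lambda>t. g t - truncation R f t))"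
      unfolding fourier_cut_eq by (rule energy_diff_le) measurable
    also have "\<dots> \<le> 2 * energy (\<lambda>x. F x - fourier_cut R f x) +
        2 * (2 * energy (\<lambda>t. f t - truncation R f t) + 2 * energy (\<lambda>t. f t - g t))"
    proof (intro add_left_mono mult_left_mono)
      have "energy (real_fourier (\<lambda>t. g t - truncation R f t)) \<le> energy (\<lambda>t. g t - truncation R f t)"
        by (rule Bessel_inequality) (auto intro: g integrable_truncation f)
      also have "\<dots> = energy (\<lambda>t. (f t - truncation R f t) - (f t - g t))"
        by simp
      also have "\<dots> \<le> 2 * energy (\<lambda>t. f t - truncation R f t) + 2 * energy (\<lambda>t. f t - g t)"
        by (rule energy_diff_le) measurable
      finally show "energy (real_fourier (\<lambda>t. g t - truncation R f t))
          \<le> 2 * energy (\<lambda>t. f t - truncation R f t) + 2 * energy (\<lambda>t. f t - g t)" .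
    qed simp
    finally show ?thesis
      by (simp add: algebra_simps)
  qed
  moreover have "((\<lambda>R. 4 * energy (\<lambda>t. f t - g t) + (2 * energy (\<lambda>x. F x - fourier_cut R f x) + 4 * energy (\<lambda>t. f t - truncation R f t)))
      \<longlongrightarrow> 4 * energy (\<lambda>t. f t - g t) + (2 * 0 + 4 * 0)) at_top"
    by (intro tendsto_add tendsto_const ennreal_tendsto_cmult energy_tail f lim) auto
  ultimately show ?thesis
    using tendsto_lowerbound[OF _ _ trivial_limit_at_top_linorder] by (metis (no_types, lifting) eventuallyI mult_zero_right add.right_neutral)
qed

lemma AE_eq_of_L2_fourier:
  assumes "has_L2_fourier f F" "has_L2_fourier f G"
  shows "AE x in lborel. F x = G x"
proof -
  have f: "f \<in> L2" and FL: "F \<in> L2" and GL: "G \<in> L2"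
    and limF: "((\<lambda>R. energy (\<lambda>x. F x - fourier_cut R f x)) \<longlongrightarrow> 0) at_top"
    and limG: "((\<lambda>R. energy (\<lambda>x. G x - fourier_cut R f x)) \<longlongrightarrow> 0) at_top"
    using assms by (auto simp: has_L2_fourier_def energy_def)
  have [measurable]: "f \<in> borel_measurable borel" "F \<in> borel_measurable borel" "G \<in> borel_measurable borel"
    using f FL GL by (auto dest: L2D)
  have "energy (\<lambda>x. F x - G x) \<le> 2 * energy (\<lambda>x. F x - fourier_cut R f x) + 2 * energy (\<lambda>x. G x - fourier_cut R f x)" for R
    using energy_diff_le[of "\<lambda>x. F x - fourier_cut R f x" "\<lambda>x. G x - fourier_cut R f x"]
    by (simp add: fourier_cut_eq)
  moreover have "((\<lambda>R. 2 * energy (\<lambda>x. F x - fourier_cut R f x) + 2 * energy (\<lambda>x. G x - fourier_cut R f x)) \<longlongrightarrow> 2 * 0 + 2 * 0) at_top"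
    by (intro tendsto_add ennreal_tendsto_cmult limF limG) auto
  ultimately have "energy (\<lambda>x. F x - G x) \<le> 2 * 0 + 2 * 0"
    using tendsto_lowerbound[OF _ _ trivial_limit_at_top_linorder] by (metis (no_types, lifting) eventuallyI mult_zero_right add.right_neutral)
  then have "energy (\<lambda>x. F x - G x) = 0"
    by simp
  then have "AE x in lborel. ennreal ((cmod (F x - G x))\<^sup>2) = 0"
    unfolding energy_def by (subst (asm) nn_integral_0_iff_AE) auto
  then show ?thesis
    by eventually_elim auto
qed

lemma has_L2_inverse_fourier_iff: "has_L2_inverse_fourier F f \<longleftrightarrow> has_L2_fourier F (\<lambda>t. f (- t))"
proof -
  have e: "energy (\<lambda>t. f (- t) - fourier_cut R F t) = energy (\<lambda>t. f t - fourier_cut R F (- t))"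
    if "F \<in> L2" "f \<in> L2" for R
  proof -
    have [measurable]: "f \<in> borel_measurable borel" "F \<in> borel_measurable borel"
      using that by (auto dest: L2D)
    show ?thesis
      unfolding fourier_cut_eq using energy_reflect[of "\<lambda>t. f (- t) - real_fourier (truncation R F) t"] by simp
  qed
  show ?thesis
    using L2_reflect[of f] L2_reflect[of "\<lambda>t. f (- t)"] e
    unfolding has_L2_inverse_fourier_def has_L2_fourier_def energy_def by auto
qed

section \<open>Two-sided exponentials and neighbouring lines\<close>

lemma integrable_exp_abs:
  assumes "s > 0"
  shows "integrable lborel (\<lambda>t. complex_of_real (exp (- s * \<bar>t\<bar>)))"
proof -
  define h where "h = (\<lambda>t. indicator {0..} t *\<^sub>R exp (- complex_of_real s * of_real t))"
  have h: "integrable lborel h"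
    using set_integrable_exp_minus_Ici[of "complex_of_real s"] assms by (simp add: set_integrable_def h_def)
  show ?thesis
  proof (rule Bochner_Integration.integrable_bound)
    show "integrable lborel (\<lambda>t. cmod (h t) + cmod (h (- t)))"
      using h lborel_integrable_real_affine[OF h, of "-1" 0] by auto
    show "AE t in lborel. cmod (complex_of_real (exp (- s * \<bar>t\<bar>))) \<le> norm (cmod (h t) + cmod (h (- t)))"
      by (intro always_eventually allI) (auto simp: h_def indicator_def abs_if)
  qed measurable
qed

text \<open>
  The two half-lines contribute \<open>1 / (s - i x)\<close> and \<open>1 / (s + i x)\<close>.
\<close>

lemma real_fourier_exp_abs:
  assumes "s > 0"
  shows "real_fourier (\<lambda>t. complex_of_real (exp (- s * \<bar>t\<bar>))) x = of_real (2 * s / (s\<^sup>2 + x\<^sup>2) / sqrt (2 * pi))"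
proof -
  define h where "h x t = indicator {0..} t *\<^sub>R exp (- (complex_of_real s - \<i> * of_real x) * of_real t)" for x t
  have h: "integrable lborel (h x)" for x
    using set_integrable_exp_minus_Ici[of "complex_of_real s - \<i> * of_real x"] assms
    unfolding h_def set_integrable_def by simp
  have hval: "integral\<^sup>L lborel (h x) = 1 / (complex_of_real s - \<i> * of_real x)" for x
    using LINT_exp_minus_Ici[of "complex_of_real s - \<i> * of_real x"] assms
    unfolding h_def set_lebesgue_integral_def by simp
  have hr: "integrable lborel (\<lambda>t. h (- x) (- t))"
    using lborel_integrable_real_affine[OF h[of "- x"], of "-1" 0] by simp
  have "(LINT t|lborel. complex_of_real (exp (- s * \<bar>t\<bar>)) * exp (\<i> * of_real x * of_real t))
      = (LINT t|lborel. h x t + h (- x) (- t))"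
  proof (rule integral_cong_AE)
    show "AE t in lborel. complex_of_real (exp (- s * \<bar>t\<bar>)) * exp (\<i> * of_real x * of_real t) = h x t + h (- x) (- t)"
      using AE_lborel_singleton[of 0]
    proof eventually_elim
      case (elim t)
      show ?case
      proof (cases "t > 0")
        case True
        have "complex_of_real (exp (- s * t)) * exp (\<i> * of_real x * of_real t)
            = exp (- (complex_of_real s - \<i> * of_real x) * of_real t)"
          unfolding exp_of_real[symmetric] exp_add[symmetric]
          by (rule arg_cong[where f=exp]) (simp add: algebra_simps)
        with True show ?thesis
          by (simp add: h_def indicator_def)
      next
        case False
        with elim have "t < 0" by simp
        have eq2: "complex_of_real (exp (- s * (- t))) * exp (\<i> * of_real x * of_real t)
            = exp (- (complex_of_real s - \<i> * of_real (- x)) * of_real (- t))"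
          unfolding exp_of_real[symmetric] exp_add[symmetric]
          by (rule arg_cong[where f=exp]) (simp add: algebra_simps)
        from \<open>t < 0\<close> show ?thesis
          using eq2 by (simp add: h_def indicator_def)
      qed
    qed
    show "(\<lambda>t. h x t + h (- x) (- t)) \<in> borel_measurable lborel"
      using h hr by auto
  qed measurable
  also have "\<dots> = integral\<^sup>L lborel (h x) + (LINT t|lborel. h (- x) (- t))"
    by (rule Bochner_Integration.integral_add[OF h hr])
  also have "(LINT t|lborel. h (- x) (- t)) = integral\<^sup>L lborel (h (- x))"
    by (subst (2) lborel_integral_real_affine[where c="-1" and t=0]) auto
  also have "integral\<^sup>L lborel (h x) + integral\<^sup>L lborel (h (- x)) = of_real (2 * s / (s\<^sup>2 + x\<^sup>2))"
  proof -
    have nz: "complex_of_real s - \<i> * of_real x \<noteq> 0" "complex_of_real s + \<i> * of_real x \<noteq> 0"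
      using assms by (auto simp: complex_eq_iff)
    have eq: "complex_of_real (s\<^sup>2 + x\<^sup>2) = (complex_of_real s - \<i> * of_real x) * (complex_of_real s + \<i> * of_real x)"
      by (simp add: algebra_simps power2_eq_square)
    show ?thesis
      unfolding hval of_real_divide eq using nz by (simp add: divide_simps)
  qed
  finally show ?thesis
    by (simp add: fourier_def)
qed

lemma exp_abs_L2:
  assumes "s > 0"
  shows "(\<lambda>t. complex_of_real (exp (- s * \<bar>t\<bar>))) \<in> L2"
proof -
  have "integrable lborel (\<lambda>t. cmod (complex_of_real (exp (- (2 * s) * \<bar>t\<bar>))))"
    using integrable_exp_abs[of "2 * s"] assms by (intro integrable_norm) simp
  moreover have "(exp (- s * \<bar>t\<bar>))\<^sup>2 = exp (- (2 * s) * \<bar>t\<bar>)" for t :: real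
    by (simp flip: exp_double)
  ultimately show ?thesis
    by (simp add: L2_def)
qed

text \<open>
  The weight \<open>exp (- c t)\<close> is \<open>exp (- r \<bar>t\<bar>)\<close> times a factor that the two
  neighbouring weights dominate; then the Cauchy-Schwarz inequality applies. So control in mean
  on two lines gives absolute convergence, with an estimate, on the line halfway between.
\<close>

lemma nn_integral_weighted_le:
  assumes [measurable]: "f \<in> borel_measurable borel" and r: "r > 0"
  shows "(\<integral>\<^sup>+t. ennreal (cmod (weighted c f t)) \<partial>lborel)\<^sup>2
    \<le> energy (\<lambda>t. of_real (exp (- r * \<bar>t\<bar>))) * (2 * energy (weighted (c - r) f) + 2 * energy (weighted (c + r) f))"
proof -
  define g where "g t = complex_of_real (cmod (weighted (c - r) f t)) + complex_of_real (cmod (weighted (c + r) f t))" for t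
  have [measurable]: "g \<in> borel_measurable borel"
    unfolding g_def by measurable
  have "(\<integral>\<^sup>+t. ennreal (cmod (weighted c f t)) \<partial>lborel)
      \<le> (\<integral>\<^sup>+t. ennreal (cmod (of_real (exp (- r * \<bar>t\<bar>)) * g t)) \<partial>lborel)"
  proof (intro nn_integral_mono ennreal_leI)
    fix t :: real
    have e: "exp (- c * t) = exp (- r * \<bar>t\<bar>) * (exp (- c * t) * exp (r * \<bar>t\<bar>))"
      by (simp flip: exp_add)
    also have "\<dots> \<le> exp (- r * \<bar>t\<bar>) * (exp (- c * t) * (exp (r * t) + exp (- r * t)))"
      using r by (intro mult_left_mono exp_abs_le) auto
    also have "exp (- c * t) * (exp (r * t) + exp (- r * t)) = exp (- (c - r) * t) + exp (- (c + r) * t)"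
      by (simp add: algebra_simps flip: exp_add)
    finally have "exp (- c * t) * cmod (f t) \<le> exp (- r * \<bar>t\<bar>) * (exp (- (c - r) * t) + exp (- (c + r) * t)) * cmod (f t)"
      by (rule mult_right_mono) simp
    also have "\<dots> = cmod (of_real (exp (- r * \<bar>t\<bar>)) * g t)"
      unfolding g_def norm_mult of_real_add[symmetric] norm_of_real
      by (simp add: cmod_weighted algebra_simps abs_mult)
    finally show "cmod (weighted c f t) \<le> cmod (of_real (exp (- r * \<bar>t\<bar>)) * g t)"
      by (simp add: cmod_weighted)
  qed
  then have "(\<integral>\<^sup>+t. ennreal (cmod (weighted c f t)) \<partial>lborel)\<^sup>2
      \<le> (\<integral>\<^sup>+t. ennreal (cmod (of_real (exp (- r * \<bar>t\<bar>)) * g t)) \<partial>lborel)\<^sup>2"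
    by (intro power_mono) auto
  also have "\<dots> \<le> energy (\<lambda>t. of_real (exp (- r * \<bar>t\<bar>))) * energy g"
    by (rule Cauchy_Schwarz_energy) measurable
  also have "\<dots> \<le> energy (\<lambda>t. of_real (exp (- r * \<bar>t\<bar>))) * (2 * energy (weighted (c - r) f) + 2 * energy (weighted (c + r) f))"
  proof (intro mult_left_mono)
    have "energy g \<le> 2 * energy (\<lambda>t. of_real (cmod (weighted (c - r) f t))) + 2 * energy (\<lambda>t. of_real (cmod (weighted (c + r) f t)))"
      unfolding g_def by (rule energy_add_le) measurable
    then show "energy g \<le> 2 * energy (weighted (c - r) f) + 2 * energy (weighted (c + r) f)"
      by (simp add: energy_def)
  qed simp
  finally show ?thesis .
qed

lemma integrable_weighted_of_L2:
  assumes "weighted (c - r) f \<in> L2" "weighted (c + r) f \<in> L2" "r > 0"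
  shows "integrable lborel (weighted c f)"
proof (rule integrableI_bounded)
  have [measurable]: "f \<in> borel_measurable borel"
    using L2D(1)[OF assms(1)] by (simp add: borel_measurable_weighted_iff)
  show "weighted c f \<in> borel_measurable lborel"
    by simp
  have "(\<integral>\<^sup>+t. ennreal (cmod (weighted c f t)) \<partial>lborel)\<^sup>2 \<le>
      energy (\<lambda>t. of_real (exp (- r * \<bar>t\<bar>))) * (2 * energy (weighted (c - r) f) + 2 * energy (weighted (c + r) f))"
    by (rule nn_integral_weighted_le[OF _ assms(3)]) measurable
  also have "\<dots> < \<infinity>"
    using L2D(2)[OF exp_abs_L2[OF assms(3)]] L2D(2)[OF assms(1)] L2D(2)[OF assms(2)]
    unfolding infinity_ennreal_def ennreal_mult_less_top ennreal_add_less_top by simp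
  finally show "(\<integral>\<^sup>+t. ennreal (cmod (weighted c f t)) \<partial>lborel) < \<infinity>"
    by (simp add: power_less_top_ennreal)
qed

section \<open>Boundary values as Poisson integrals\<close>

text \<open>
  If \<open>F\<close> were large at a far point, uniform continuity would keep it large on an interval of
  fixed length, against the vanishing of the energy outside \<open>[-R, R]\<close>. This also serves as
  Riemann-Lebesgue lemma for the transforms below, which are Lipschitz continuous and square
  integrable on lines.
\<close>

lemma uniformly_continuous_L2_tendsto_0:
  fixes F :: "real \<Rightarrow> complex"
  assumes F: "F \<in> L2" and uc: "uniformly_continuous_on UNIV F"
  shows "(F \<longlongrightarrow> 0) at_infinity"
proof -
  have [measurable]: "F \<in> borel_measurable borel"
    using F by (rule L2D)
  have "\<exists>b. \<forall>x. b \<le> norm x \<longrightarrow> cmod (F x) < e" if e: "e > 0" for e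
  proof -
    obtain d where d: "d > 0" "\<And>x y. dist y x < d \<Longrightarrow> dist (F y) (F x) < e / 2"
      using uc[unfolded uniformly_continuous_on_def, rule_format, of "e / 2"] e by auto
    have "eventually (\<lambda>R. energy (\<lambda>t. F t - truncation R F t) < ennreal ((e / 2)\<^sup>2 * d)) at_top"
      using d e by (intro order_tendstoD[OF energy_tail[OF F]]) auto
    then obtain R where R: "energy (\<lambda>t. F t - truncation R F t) < ennreal ((e / 2)\<^sup>2 * d)"
      by (auto simp: eventually_at_top_linorder)
    have "cmod (F x) < e" if x: "R + d \<le> \<bar>x\<bar>" for x
    proof (rule ccontr)
      assume "\<not> cmod (F x) < e"
      then have big: "cmod (F x) \<ge> e" by simp
      have "ennreal ((e / 2)\<^sup>2 * d) = (\<integral>\<^sup>+y. ennreal ((e / 2)\<^sup>2) * indicator {x - d / 2..x + d / 2} y \<partial>lborel)"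
        using d by (simp add: nn_integral_cmult_indicator ennreal_mult)
      also have "\<dots> \<le> energy (\<lambda>t. F t - truncation R F t)"
        unfolding energy_def
      proof (intro nn_integral_mono)
        fix y
        show "ennreal ((e / 2)\<^sup>2) * indicator {x - d / 2..x + d / 2} y \<le> ennreal ((cmod (F y - truncation R F y))\<^sup>2)"
        proof (cases "y \<in> {x - d / 2..x + d / 2}")
          case True
          then have "y \<notin> {-R..R}"
            using x d by (auto simp: abs_if split: if_splits)
          then have tr: "truncation R F y = 0"
            by (simp add: truncation_def)
          have "dist y x < d"
            using True d by (auto simp: dist_real_def abs_if)
          then have "cmod (F y - F x) < e / 2"
            using d(2) by (simp add: dist_norm)
          then have "e / 2 \<le> cmod (F y)"
            using big norm_triangle_ineq2[of "F x" "F y"] by (simp add: norm_minus_commute)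
          then have "(e / 2)\<^sup>2 \<le> (cmod (F y))\<^sup>2"
            using e by (intro power_mono) auto
          then show ?thesis
            using True by (simp add: tr ennreal_leI)
        qed auto
      qed
      finally show False
        using R by simp
    qed
    then show ?thesis
      by auto
  qed
  then show ?thesis
    by (simp add: Lim_at_infinity)
qed

lemma Hoelder_uniformly_continuous:
  assumes "Hoelder_continuous F"
  shows "uniformly_continuous_on UNIV F"
proof -
  obtain \<mu> A where \<mu>: "0 < \<mu>" and A: "\<And>x y. cmod (F x - F y) \<le> A * \<bar>x - y\<bar> powr \<mu>"
    using assms by (auto simp: Hoelder_continuous_def)
  have "((\<lambda>h. A * \<bar>h\<bar> powr \<mu>) \<longlongrightarrow> A * 0) (at (0::real))"
  proof (intro tendsto_intros)
    have "((\<lambda>h::real. \<bar>h\<bar>) \<longlongrightarrow> 0) (at 0)"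
      using tendsto_rabs[OF tendsto_ident_at[of "0::real" UNIV]] by simp
    then show "((\<lambda>h::real. \<bar>h\<bar> powr \<mu>) \<longlongrightarrow> 0) (at 0)"
      using \<mu> by (intro tendsto_zero_powrI[where b=\<mu>]) auto
  qed
  then have lim: "((\<lambda>h. A * \<bar>h\<bar> powr \<mu>) \<longlongrightarrow> 0) (at (0::real))"
    by simp
  show ?thesis
    unfolding uniformly_continuous_on_def
  proof (intro allI impI)
    fix e :: real assume e: "e > 0"
    then have "eventually (\<lambda>h. A * \<bar>h\<bar> powr \<mu> < e) (at (0::real))"
      using order_tendstoD(2)[OF lim] by auto
    then obtain d where d: "d > 0" "\<And>h. h \<noteq> 0 \<Longrightarrow> \<bar>h\<bar> < d \<Longrightarrow> A * \<bar>h\<bar> powr \<mu> < e"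
      by (auto simp: eventually_at dist_real_def)
    have "dist (F y) (F x) < e" if "dist y x < d" for x y
    proof (cases "x = y")
      case False
      then show ?thesis
        using d(2)[of "y - x"] that le_less_trans[OF A[of y x]] by (simp add: dist_norm)
    qed (use e in auto)
    then show "\<exists>d>0. \<forall>x\<in>UNIV. \<forall>y\<in>UNIV. dist y x < d \<longrightarrow> dist (F y) (F x) < e"
      using d(1) by blast
  qed
qed

lemma bounded_if_tendsto_0_at_infinity:
  fixes F :: "real \<Rightarrow> complex"
  assumes lim: "(F \<longlongrightarrow> 0) at_infinity" and cont: "continuous_on UNIV F"
  shows "\<exists>B. \<forall>x. cmod (F x) \<le> B"
proof -
  obtain R where R: "\<And>x. R \<le> \<bar>x\<bar> \<Longrightarrow> cmod (F x) < 1"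
    using lim[unfolded Lim_at_infinity, rule_format, of 1] by auto
  have "compact (F ` {-R..R})"
    by (intro compact_continuous_image continuous_on_subset[OF cont]) auto
  then obtain B where B: "\<And>x. x \<in> {-R..R} \<Longrightarrow> cmod (F x) \<le> B"
    using compact_imp_bounded bounded_iff by (metis imageI)
  have "cmod (F x) \<le> max 1 B" for x
  proof (cases "R \<le> \<bar>x\<bar>")
    case True
    then show ?thesis
      using R[of x] by simp
  next
    case False
    then have "x \<in> {-R..R}" by auto
    then show ?thesis
      using B[of x] by simp
  qed
  then show ?thesis
    by blast
qed

lemma fourier_cmult: "fourier (\<lambda>t. c * f t) z = c * fourier f z"
  by (simp add: fourier_def mult.assoc)

lemma tendsto_0_of_ennreal_square:
  assumes le: "\<And>n. ennreal ((x n)\<^sup>2) \<le> e n" and e: "e \<longlonglongrightarrow> 0"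
  shows "x \<longlonglongrightarrow> 0"
proof -
  have "(\<lambda>n. ennreal ((x n)\<^sup>2)) \<longlonglongrightarrow> 0"
    by (rule tendsto_sandwich[OF _ _ tendsto_const e]) (auto simp: le)
  then have "(\<lambda>n. (x n)\<^sup>2) \<longlonglongrightarrow> 0"
    by (subst (asm) ennreal_0[symmetric], subst (asm) tendsto_ennreal_iff) auto
  then have "(\<lambda>n. sqrt ((x n)\<^sup>2)) \<longlonglongrightarrow> sqrt 0"
    by (rule tendsto_real_sqrt)
  then show ?thesis
    by (simp add: tendsto_rabs_zero_iff)
qed

lemma tendsto_integral_mult_of_energy:
  assumes [measurable]: "\<And>n. f n \<in> borel_measurable borel" "F \<in> borel_measurable borel" and g: "g \<in> L2"
    and int: "\<And>n. integrable lborel (\<lambda>x. f n x * g x)" "integrable lborel (\<lambda>x. F x * g x)"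
    and conv: "(\<lambda>n. energy (\<lambda>x. F x - f n x)) \<longlonglongrightarrow> 0"
  shows "(\<lambda>n. LINT x|lborel. f n x * g x) \<longlonglongrightarrow> (LINT x|lborel. F x * g x)"
proof -
  have [measurable]: "g \<in> borel_measurable borel"
    using g by (rule L2D)
  define d where "d n = (LINT x|lborel. F x * g x) - (LINT x|lborel. f n x * g x)" for n
  have le: "ennreal ((cmod (d n))\<^sup>2) \<le> energy (\<lambda>x. F x - f n x) * energy g" for n
  proof -
    have "d n = (LINT x|lborel. (F x - f n x) * g x)"
      unfolding d_def left_diff_distrib by (rule Bochner_Integration.integral_diff[symmetric]) (rule int)+
    moreover have "integrable lborel (\<lambda>x. (F x - f n x) * g x)"
      unfolding left_diff_distrib by (rule Bochner_Integration.integrable_diff) (rule int)+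
    ultimately have "ennreal (cmod (d n)) \<le> (\<integral>\<^sup>+x. ennreal (cmod ((F x - f n x) * g x)) \<partial>lborel)"
      by (simp add: integral_norm_bound_ennreal)
    then have "(ennreal (cmod (d n)))\<^sup>2 \<le> (\<integral>\<^sup>+x. ennreal (cmod ((F x - f n x) * g x)) \<partial>lborel)\<^sup>2"
      by (intro power_mono) auto
    also have "\<dots> \<le> energy (\<lambda>x. F x - f n x) * energy g"
      by (rule Cauchy_Schwarz_energy) measurable
    finally show ?thesis
      by (simp add: ennreal_power)
  qed
  have "(\<lambda>n. energy g * energy (\<lambda>x. F x - f n x)) \<longlonglongrightarrow> energy g * 0"
    using L2D(2)[OF g] by (intro ennreal_tendsto_cmult conv) auto
  then have "(\<lambda>n. energy (\<lambda>x. F x - f n x) * energy g) \<longlonglongrightarrow> 0"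
    by (simp add: mult.commute)
  then have "(\<lambda>n. cmod (d n)) \<longlonglongrightarrow> 0"
    by (rule tendsto_0_of_ennreal_square[rotated]) (rule le)
  then have "d \<longlonglongrightarrow> 0"
    by (rule tendsto_norm_zero_cancel)
  then have "(\<lambda>n. (LINT x|lborel. F x * g x) - d n) \<longlonglongrightarrow> (LINT x|lborel. F x * g x) - 0"
    by (intro tendsto_diff tendsto_const)
  then show ?thesis
    by (simp add: d_def)
qed

definition poisson_kernel :: "real \<Rightarrow> real \<Rightarrow> real" where
  "poisson_kernel s x = s / (pi * (s\<^sup>2 + x\<^sup>2))"

lemma borel_measurable_poisson_kernel [measurable]: "poisson_kernel s \<in> borel_measurable borel"
  unfolding poisson_kernel_def[abs_def] by measurable

lemma poisson_kernel_nonneg: "s > 0 \<Longrightarrow> poisson_kernel s x \<ge> 0"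
  by (simp add: poisson_kernel_def)

lemma poisson_kernel_scale:
  assumes "s > 0"
  shows "s * poisson_kernel s (s * v) = poisson_kernel 1 v"
proof -
  have "s\<^sup>2 + (s * v)\<^sup>2 = s\<^sup>2 * (1 + v\<^sup>2)"
    by (simp add: algebra_simps power_mult_distrib)
  then show ?thesis
    using assms by (simp add: poisson_kernel_def power2_eq_square)
qed

lemma integrable_poisson_kernel:
  assumes "s > 0"
  shows "integrable lborel (poisson_kernel s)"
proof -
  have "integrable lborel (\<lambda>x::real. inverse (1 + x\<^sup>2))"
    using integrable_inverse_1_plus_square by (simp add: set_integrable_def einterval_def)
  then have "integrable lborel (\<lambda>x::real. 1 / pi * inverse (1 + x\<^sup>2))"
    by (rule integrable_mult_right)
  then have 1: "integrable lborel (poisson_kernel 1)"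
    by (simp add: poisson_kernel_def[abs_def] field_simps)
  have "poisson_kernel s = (\<lambda>x. 1 / s * poisson_kernel 1 (0 + (1 / s) * x))"
    using poisson_kernel_scale[OF assms, of "_ / s"] assms by (simp add: field_simps fun_eq_iff)
  moreover have "integrable lborel (\<lambda>x. 1 / s * poisson_kernel 1 (0 + (1 / s) * x))"
    using assms by (intro integrable_mult_right lborel_integrable_real_affine 1) auto
  ultimately show ?thesis
    by simp
qed

text \<open>
  The Poisson kernel is a multiple of the transform of the two-sided exponential, so inversion
  gives its own transform; its total mass is the value at 0.
\<close>

lemma real_fourier_poisson_kernel:
  assumes "s > 0"
  shows "real_fourier (\<lambda>x. of_real (poisson_kernel s x)) t = of_real (exp (- s * \<bar>t\<bar>) / sqrt (2 * pi))"
proof -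
  let ?f = "\<lambda>t. complex_of_real (exp (- s * \<bar>t\<bar>))"
  have "2 * s / (s\<^sup>2 + x\<^sup>2) / sqrt (2 * pi) = sqrt (2 * pi) * poisson_kernel s x" for x
  proof -
    have "s\<^sup>2 + x\<^sup>2 > 0"
      using assms by (simp add: add_pos_nonneg)
    moreover have "sqrt (2 * pi) * sqrt (2 * pi) = 2 * pi"
      by simp
    ultimately show ?thesis
      by (simp add: poisson_kernel_def divide_simps del: real_sqrt_mult_self)
  qed
  then have ff: "real_fourier ?f = (\<lambda>x. complex_of_real (sqrt (2 * pi)) * complex_of_real (poisson_kernel s x))"
    by (simp only: real_fourier_exp_abs[OF assms] of_real_mult)
  have "real_fourier (real_fourier ?f) (- (- t)) = ?f (- t)"
  proof (rule fourier_inversion[OF integrable_exp_abs[OF assms], where B=1])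
    show "continuous_on UNIV ?f"
      by (intro continuous_intros)
    show "cmod (?f x) \<le> 1" for x
      using assms by simp
    show "integrable lborel (real_fourier ?f)"
      unfolding ff by (intro integrable_mult_right integrable_of_real integrable_poisson_kernel assms)
  qed
  also have "real_fourier (real_fourier ?f) (- (- t)) = sqrt (2 * pi) * real_fourier (\<lambda>x. of_real (poisson_kernel s x)) t"
    unfolding ff minus_minus by (rule fourier_cmult)
  finally show ?thesis
    by (simp add: field_simps)
qed

lemma integral_poisson_kernel:
  assumes "s > 0"
  shows "(LINT x|lborel. poisson_kernel s x) = 1"
  using real_fourier_poisson_kernel[OF assms, of 0]
  by (simp add: fourier_def flip: of_real_mult of_real_divide)

lemma poisson_kernel_L2:
  assumes "s > 0"
  shows "(\<lambda>u. complex_of_real (poisson_kernel s (u - x))) \<in> L2"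
proof -
  have "integrable lborel (\<lambda>u. (poisson_kernel s (u - x))\<^sup>2)"
  proof (rule Bochner_Integration.integrable_bound)
    show "integrable lborel (\<lambda>u. 1 / (pi * s) * poisson_kernel s (- x + 1 * u))"
      by (intro integrable_mult_right lborel_integrable_real_affine integrable_poisson_kernel assms) auto
    have "(poisson_kernel s y)\<^sup>2 \<le> 1 / (pi * s) * poisson_kernel s y" for y
    proof -
      have "poisson_kernel s y \<le> 1 / (pi * s)"
        using assms by (simp add: poisson_kernel_def field_simps power2_eq_square add_nonneg_pos add_pos_nonneg)
      then show ?thesis
        unfolding power2_eq_square by (intro mult_right_mono poisson_kernel_nonneg assms)
    qed
    then show "AE u in lborel. norm ((poisson_kernel s (u - x))\<^sup>2) \<le> norm (1 / (pi * s) * poisson_kernel s (- x + 1 * u))"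
      using assms poisson_kernel_nonneg[OF assms] by (intro always_eventually allI) (simp add: abs_mult)
  qed measurable
  then show ?thesis
    by (simp add: L2_def)
qed

text \<open>
  For truncations of \<open>\<phi>\<close> this is the multiplication formula with a shifted Poisson kernel
  as second factor. The kernel is square integrable, which permits the limit in mean.
\<close>

lemma Poisson_representation:
  assumes F: "has_L2_fourier \<phi> F" and s: "s > 0"
  shows "real_fourier (\<lambda>t. of_real (exp (- s * \<bar>t\<bar>)) * \<phi> t) x
      = (LINT u|lborel. F u * of_real (poisson_kernel s (u - x)))"
proof (rule LIMSEQ_unique)
  have \<phi>: "\<phi> \<in> L2" and FL: "F \<in> L2"
    and lim: "((\<lambda>R. energy (\<lambda>x. F x - real_fourier (truncation R \<phi>) x)) \<longlongrightarrow> 0) at_top"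
    using F by (auto simp: has_L2_fourier_def energy_def fourier_cut_eq)
  have [measurable]: "\<phi> \<in> borel_measurable borel" "F \<in> borel_measurable borel"
    using \<phi> FL by (auto dest: L2D)
  define g where "g u = complex_of_real (poisson_kernel s (u - x))" for u
  have gL2: "g \<in> L2"
    unfolding g_def[abs_def] by (rule poisson_kernel_L2[OF s])
  have g: "integrable lborel g"
    using lborel_integrable_real_affine[OF integrable_poisson_kernel[OF s], of 1 "- x"]
    unfolding g_def[abs_def] by (intro integrable_of_real) simp
  have [measurable]: "g \<in> borel_measurable borel"
    using g by auto
  have gf: "real_fourier g t = of_real (exp (- s * \<bar>t\<bar>)) * exp (\<i> * of_real x * of_real t) / sqrt (2 * pi)" for t
  proof -
    have "(LINT u|lborel. g u * exp (\<i> * of_real t * of_real u))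
        = (LINT v|lborel. g (x + 1 * v) * exp (\<i> * of_real t * of_real (x + 1 * v)))"
      by (subst lborel_integral_real_affine[where c=1 and t=x]) auto
    also have "\<dots> = (LINT v|lborel. exp (\<i> * of_real x * of_real t) * (of_real (poisson_kernel s v) * exp (\<i> * of_real t * of_real v)))"
      by (intro Bochner_Integration.integral_cong refl) (simp add: g_def algebra_simps exp_add)
    also have "\<dots> = exp (\<i> * of_real x * of_real t) * (LINT v|lborel. of_real (poisson_kernel s v) * exp (\<i> * of_real t * of_real v))"
      by (rule integral_mult_right_zero)
    finally have "real_fourier g t = exp (\<i> * of_real x * of_real t) * real_fourier (\<lambda>u. of_real (poisson_kernel s u)) t"
      by (simp add: fourier_def del: of_real_mult)
    then show ?thesis
      by (simp add: real_fourier_poisson_kernel[OF s] mult_ac)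
  qed
  let ?I = "\<lambda>n. LINT u|lborel. real_fourier (truncation (real n) \<phi>) u * g u"
  have gbd: "cmod (g u) \<le> 1 / (pi * s)" for u
  proof -
    have "poisson_kernel s y \<le> 1 / (pi * s)" for y
      using s by (simp add: poisson_kernel_def field_simps power2_eq_square add_nonneg_pos add_pos_nonneg)
    then show ?thesis
      using poisson_kernel_nonneg[OF s] by (simp add: g_def)
  qed
  have "?I \<longlonglongrightarrow> (LINT u|lborel. F u * g u)"
  proof (rule tendsto_integral_mult_of_energy[OF _ _ gL2])
    show "integrable lborel (\<lambda>u. real_fourier (truncation (real n) \<phi>) u * g u)" for n
      using integrable_mult_bounded[OF g _ cmod_fourier_le[OF integrable_truncation[OF \<phi>, of "real n"]]]
      by (simp add: mult.commute)
    show "integrable lborel (\<lambda>u. F u * g u)"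
      by (rule integrable_mult_L2[OF FL gL2])
    show "(\<lambda>n. energy (\<lambda>x. F x - real_fourier (truncation (real n) \<phi>) x)) \<longlonglongrightarrow> 0"
      by (rule filterlim_compose[OF lim filterlim_real_sequentially])
  qed measurable
  then show "?I \<longlonglongrightarrow> (LINT u|lborel. F u * of_real (poisson_kernel s (u - x)))"
    by (simp add: g_def)
  have I: "?I n = 1 / sqrt (2 * pi) * (LINT t|lborel. truncation (real n) (\<lambda>t. of_real (exp (- s * \<bar>t\<bar>)) * \<phi> t) t * exp (\<i> * of_real x * of_real t))" for n
  proof -
    have "?I n = (LINT t|lborel. truncation (real n) \<phi> t * real_fourier g t)"
      by (rule fourier_multiplication[OF integrable_truncation[OF \<phi>] g, symmetric])
    also have "\<dots> = (LINT t|lborel. 1 / sqrt (2 * pi) * (truncation (real n) (\<lambda>t. of_real (exp (- s * \<bar>t\<bar>)) * \<phi> t) t * exp (\<i> * of_real x * of_real t)))"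
      by (intro Bochner_Integration.integral_cong refl) (simp add: gf truncation_def indicator_def)
    finally show ?thesis
      by simp
  qed
  have int: "integrable lborel (\<lambda>t. of_real (exp (- s * \<bar>t\<bar>)) * \<phi> t)"
    by (rule integrable_mult_L2[OF exp_abs_L2[OF s] \<phi>])
  show "?I \<longlonglongrightarrow> real_fourier (\<lambda>t. of_real (exp (- s * \<bar>t\<bar>)) * \<phi> t) x"
    unfolding I fourier_def[of "\<lambda>t. of_real (exp (- s * \<bar>t\<bar>)) * \<phi> t"]
  proof (intro tendsto_mult tendsto_const integral_dominated_convergence)
    show "integrable lborel (\<lambda>t. cmod (of_real (exp (- s * \<bar>t\<bar>)) * \<phi> t))"
      using int by (rule integrable_norm)
    show "AE t in lborel. (\<lambda>n. truncation (real n) (\<lambda>t. of_real (exp (- s * \<bar>t\<bar>)) * \<phi> t) t * exp (\<i> * of_real x * of_real t))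
        \<longlonglongrightarrow> of_real (exp (- s * \<bar>t\<bar>)) * \<phi> t * exp (\<i> * of_real x * of_real t)"
      by (intro always_eventually allI tendsto_mult tendsto_const truncation_tendsto[OF filterlim_real_sequentially])
    show "AE t in lborel. cmod (truncation (real n) (\<lambda>t. of_real (exp (- s * \<bar>t\<bar>)) * \<phi> t) t * exp (\<i> * of_real x * of_real t))
        \<le> cmod (of_real (exp (- s * \<bar>t\<bar>)) * \<phi> t)" for n
      using cmod_truncation_le[of "real n" "\<lambda>t. of_real (exp (- s * \<bar>t\<bar>)) * \<phi> t"]
      by (intro always_eventually allI) (simp only: norm_mult norm_exp_i_real mult_1_right)
  qed measurable
qed

text \<open>
  On the support of \<open>\<phi>\<close> the weight \<open>exp (- s t)\<close> coincides with
  \<open>exp (- s \<bar>t\<bar>)\<close>, so the transform at height \<open>s\<close> is the Poisson integral of the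
  boundary function \<open>F\<close>. Hoelder continuity bounds its distance from \<open>F\<close>, uniformly in
  \<open>x\<close>, by an integral that tends to 0 with \<open>s\<close>.
\<close>

lemma fourier_boundary_uniform:
  assumes F: "has_L2_fourier \<phi> F" and H: "Hoelder_continuous F" and supp: "\<And>t. t < 0 \<Longrightarrow> \<phi> t = 0" and e: "e > 0"
  shows "eventually (\<lambda>s. \<forall>x. cmod (real_fourier (weighted s \<phi>) x - F x) < e) (at_right 0)"
proof -
  have FL: "F \<in> L2"
    using F by (simp add: has_L2_fourier_def)
  then have [measurable]: "F \<in> borel_measurable borel"
    by (rule L2D)
  have uc: "uniformly_continuous_on UNIV F"
    by (rule Hoelder_uniformly_continuous[OF H])
  obtain B where B: "\<And>x. cmod (F x) \<le> B"
    using bounded_if_tendsto_0_at_infinity[OF uniformly_continuous_L2_tendsto_0[OF FL uc] uniformly_continuous_imp_continuous[OF uc]] by blast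
  obtain \<mu> A where \<mu>: "0 < \<mu>" and A: "\<And>x y. cmod (F x - F y) \<le> A * \<bar>x - y\<bar> powr \<mu>"
    using H by (auto simp: Hoelder_continuous_def)
  have A0: "A \<ge> 0"
    using order_trans[OF norm_ge_zero A[of 1 0]] by simp
  have B0: "B \<ge> 0"
    using order_trans[OF norm_ge_zero B[of 0]] .
  \<comment> \<open>The substitution \<open>u = x + s v\<close> turns the kernel of width \<open>s\<close> into the kernel of width 1, so that \<open>s\<close> occurs only in the increment of \<open>F\<close>.\<close>
  define m where "m s = (LINT v|lborel. min (2 * B) (A * (s * \<bar>v\<bar>) powr \<mu>) * poisson_kernel 1 v)" for s
  have P1: "integrable lborel (poisson_kernel 1)"
    by (rule integrable_poisson_kernel) simp
  have P0: "poisson_kernel 1 v \<ge> 0" for v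
    by (rule poisson_kernel_nonneg) simp
  have mint: "integrable lborel (\<lambda>v. min (2 * B) (A * (s * \<bar>v\<bar>) powr \<mu>) * poisson_kernel 1 v)" for s
  proof (rule Bochner_Integration.integrable_bound)
    show "integrable lborel (\<lambda>v. 2 * B * poisson_kernel 1 v)"
      by (rule integrable_mult_right[OF P1])
    show "AE v in lborel. norm (min (2 * B) (A * (s * \<bar>v\<bar>) powr \<mu>) * poisson_kernel 1 v) \<le> norm (2 * B * poisson_kernel 1 v)"
      using A0 B0 P0 by (intro always_eventually allI) (auto simp: abs_mult intro!: mult_right_mono)
  qed measurable
  have bound: "cmod (real_fourier (weighted s \<phi>) x - F x) \<le> m s" if s: "s > 0" for s x
  proof -
    define g where "g u = complex_of_real (poisson_kernel s (u - x))" for u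
    have gL2: "g \<in> L2"
      unfolding g_def[abs_def] by (rule poisson_kernel_L2[OF s])
    have g: "integrable lborel g"
      using lborel_integrable_real_affine[OF integrable_poisson_kernel[OF s], of 1 "- x"]
      unfolding g_def[abs_def] by (intro integrable_of_real) simp
    have [measurable]: "g \<in> borel_measurable borel"
      using g by auto
    have g1: "integral\<^sup>L lborel g = 1"
      using integral_poisson_kernel[OF s] lborel_integral_real_affine[of 1 "poisson_kernel s" "- x"]
      unfolding g_def[abs_def] by simp
    have "weighted s \<phi> = (\<lambda>t. of_real (exp (- s * \<bar>t\<bar>)) * \<phi> t)"
      using supp by (auto simp: weighted_def fun_eq_iff abs_if)
    then have "real_fourier (weighted s \<phi>) x - F x = (LINT u|lborel. F u * g u) - F x * integral\<^sup>L lborel g"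
      using Poisson_representation[OF F s, of x] by (simp add: g1 g_def)
    also have "\<dots> = (LINT u|lborel. F u * g u) - (LINT u|lborel. F x * g u)"
      by simp
    also have "\<dots> = (LINT u|lborel. F u * g u - F x * g u)"
      by (intro Bochner_Integration.integral_diff[symmetric] integrable_mult_L2[OF FL gL2] integrable_mult_right g)
    also have "\<dots> = s *\<^sub>R (LINT v|lborel. F (x + s * v) * g (x + s * v) - F x * g (x + s * v))"
      using s by (subst lborel_integral_real_affine[where c=s and t=x]) auto
    also have "\<dots> = (LINT v|lborel. (F (x + s * v) - F x) * of_real (poisson_kernel 1 v))"
    proof (subst integral_scaleR_right[symmetric], intro Bochner_Integration.integral_cong refl)
      fix v
      have "complex_of_real s * g (x + s * v) = of_real (poisson_kernel 1 v)"
        using poisson_kernel_scale[OF s, of v] by (simp add: g_def flip: of_real_mult)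
      then show "s *\<^sub>R (F (x + s * v) * g (x + s * v) - F x * g (x + s * v)) = (F (x + s * v) - F x) * of_real (poisson_kernel 1 v)"
        by (simp add: scaleR_conv_of_real right_diff_distrib left_diff_distrib mult.left_commute)
    qed
    finally have eq: "real_fourier (weighted s \<phi>) x - F x = (LINT v|lborel. (F (x + s * v) - F x) * of_real (poisson_kernel 1 v))" .
    have ptw: "cmod ((F (x + s * v) - F x) * of_real (poisson_kernel 1 v)) \<le> min (2 * B) (A * (s * \<bar>v\<bar>) powr \<mu>) * poisson_kernel 1 v" for v
    proof -
      have "cmod (F (x + s * v) - F x) \<le> 2 * B"
        using norm_triangle_ineq4[of "F (x + s * v)" "F x"] B[of "x + s * v"] B[of x] by simp
      moreover have "cmod (F (x + s * v) - F x) \<le> A * (s * \<bar>v\<bar>) powr \<mu>"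
        using A[of "x + s * v" x] s by (simp add: abs_mult)
      ultimately show ?thesis
        using P0 by (auto simp: norm_mult intro!: mult_right_mono)
    qed
    show ?thesis
      unfolding eq m_def
    proof (rule order_trans[OF integral_norm_bound integral_mono[OF _ mint ptw]])
      have "integrable lborel (\<lambda>v. (F (x + s * v) - F x) * of_real (poisson_kernel 1 v))"
        by (rule Bochner_Integration.integrable_bound[OF mint[of s]])
          (use ptw order_trans[OF _ abs_ge_self] in \<open>auto intro!: always_eventually\<close>)
      then show "integrable lborel (\<lambda>v. cmod ((F (x + s * v) - F x) * of_real (poisson_kernel 1 v)))"
        by (rule integrable_norm)
    qed
  qed
  have "(m \<longlongrightarrow> 0) (at_right 0)"
    unfolding tendsto_at_iff_sequentially comp_def
  proof (intro allI impI)
    fix X :: "nat \<Rightarrow> real" assume X: "\<forall>i. X i \<in> {0<..} - {0}" and lim: "X \<longlonglongrightarrow> 0"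
    have "(\<lambda>n. m (X n)) \<longlonglongrightarrow> (LINT v::real|lborel. 0)"
      unfolding m_def
    proof (rule integral_dominated_convergence)
      show "integrable lborel (\<lambda>v. 2 * B * poisson_kernel 1 v)"
        by (rule integrable_mult_right[OF P1])
      show "AE v in lborel. norm (min (2 * B) (A * (X n * \<bar>v\<bar>) powr \<mu>) * poisson_kernel 1 v) \<le> 2 * B * poisson_kernel 1 v" for n
        using A0 B0 P0 by (intro always_eventually allI) (auto simp: abs_mult intro!: mult_right_mono)
      show "AE v in lborel. (\<lambda>n. min (2 * B) (A * (X n * \<bar>v\<bar>) powr \<mu>) * poisson_kernel 1 v) \<longlonglongrightarrow> 0"
      proof (intro always_eventually allI)
        fix v :: real
        have "(\<lambda>n. X n * \<bar>v\<bar>) \<longlonglongrightarrow> 0 * \<bar>v\<bar>"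
          by (intro tendsto_intros lim)
        then have "(\<lambda>n. (X n * \<bar>v\<bar>) powr \<mu>) \<longlonglongrightarrow> 0"
          using \<mu> X by (cases "v = 0") (auto intro!: tendsto_zero_powrI[where b=\<mu>] always_eventually simp: less_imp_le)
        then have "(\<lambda>n. min (2 * B) (A * (X n * \<bar>v\<bar>) powr \<mu>) * poisson_kernel 1 v) \<longlonglongrightarrow> min (2 * B) (A * 0) * poisson_kernel 1 v"
          by (intro tendsto_intros tendsto_min)
        then show "(\<lambda>n. min (2 * B) (A * (X n * \<bar>v\<bar>) powr \<mu>) * poisson_kernel 1 v) \<longlonglongrightarrow> 0"
          using B0 by simp
      qed
    qed measurable
    then show "(\<lambda>n. m (X n)) \<longlonglongrightarrow> 0"
      by simp
  qed
  then have "eventually (\<lambda>s. m s < e) (at_right 0)"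
    using e by (rule order_tendstoD)
  moreover have "eventually (\<lambda>s. s > 0) (at_right (0::real))"
    by (simp add: eventually_at_right_less)
  ultimately show ?thesis
    by eventually_elim (use bound le_less_trans in blast)
qed

section \<open>The inverse transform on a strip\<close>

lemma open_strip: "open (strip a b)"
  unfolding strip_def by (simp add: Collect_conj_eq open_Int open_halfspace_Im_gt open_halfspace_Im_lt)

lemma convex_strip: "convex (strip a b)"
  unfolding strip_def by (simp add: Collect_conj_eq convex_Int convex_halfspace_Im_gt convex_halfspace_Im_lt)

lemma Complex_in_strip [simp]: "Complex x c \<in> strip a b \<longleftrightarrow> a < c \<and> c < b"
  by (simp add: strip_def)

lemma continuous_on_Complex_line: "continuous_on S (\<lambda>x. Complex x c)"
  unfolding Complex_eq by (intro continuous_intros)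

lemma continuous_on_line:
  assumes "G holomorphic_on strip a b" "a < c" "c < b"
  shows "continuous_on UNIV (\<lambda>x. G (Complex x c))"
  by (rule continuous_on_compose2[OF holomorphic_on_imp_continuous_on[OF assms(1)] continuous_on_Complex_line])
    (use assms in auto)

lemma borel_measurable_line:
  assumes "G holomorphic_on strip a b" "a < c" "c < b"
  shows "(\<lambda>x. G (Complex x c)) \<in> borel_measurable borel"
  using continuous_on_line[OF assms] by (rule borel_measurable_continuous_onI)

text \<open>
  A primitive \<open>P\<close> of \<open>h\<close> exists on the convex strip. The integrals over \<open>[-n, n]\<close> on the
  two lines are increments of \<open>P\<close>, and they differ by the increments along the vertical sides,
  which are at most \<open>u (\<plusminus> n) * (d - c)\<close>.
\<close>

lemma integral_line_shift:
  assumes holo: "h holomorphic_on strip a b" and cd: "a < c" "c \<le> d" "d < b"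
    and bd: "\<And>x y. c \<le> y \<Longrightarrow> y \<le> d \<Longrightarrow> cmod (h (Complex x y)) \<le> u x"
    and u: "integrable lborel u" "(u \<longlongrightarrow> 0) at_top" "(u \<longlongrightarrow> 0) at_bot"
  shows "(LINT x|lborel. h (Complex x c)) = (LINT x|lborel. h (Complex x d))"
proof -
  obtain P where P: "\<And>z. z \<in> strip a b \<Longrightarrow> (P has_field_derivative h z) (at z within strip a b)"
    using holomorphic_convex_primitive'[OF convex_strip open_strip holo] by blast
  have P': "(P has_field_derivative h z) (at z)" if "z \<in> strip a b" for z
    using P[OF that] at_within_open[OF that open_strip] by simp
  have FTC: "(LINT x|lborel. indicator {- real n..real n} x *\<^sub>R h (Complex x y))
      = P (Complex (real n) y) - P (Complex (- real n) y)" if y: "a < y" "y < b" for n y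
  proof (rule integral_FTC_Icc)
    show "((\<lambda>x. P (Complex x y)) has_vector_derivative h (Complex x y)) (at x within {- real n..real n})" for x
    proof -
      have "((\<lambda>z. P (z + \<i> * of_real y)) has_field_derivative h (of_real x + \<i> * of_real y) * 1) (at (of_real x))"
        by (rule DERIV_chain2[OF P']) (use y in \<open>auto intro!: derivative_eq_intros simp: strip_def\<close>)
      from has_vector_derivative_real_field[OF this]
      show ?thesis
        unfolding Complex_eq by simp
    qed
    show "continuous_on {- real n..real n} (\<lambda>x. h (Complex x y))"
      using continuous_on_line[OF holo y] by (rule continuous_on_subset) simp
  qed simp
  have lim: "(\<lambda>n. P (Complex (real n) y) - P (Complex (- real n) y)) \<longlonglongrightarrow> (LINT x|lborel. h (Complex x y))"
    if y: "c \<le> y" "y \<le> d" for y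
  proof -
    have [measurable]: "(\<lambda>x. h (Complex x y)) \<in> borel_measurable borel"
      using y cd by (intro borel_measurable_line[OF holo]) auto
    have "(\<lambda>n. LINT x|lborel. indicator {- real n..real n} x *\<^sub>R h (Complex x y)) \<longlonglongrightarrow> (LINT x|lborel. h (Complex x y))"
    proof (rule integral_dominated_convergence[OF _ _ u(1)])
      show "AE x in lborel. (\<lambda>n. indicator {- real n..real n} x *\<^sub>R h (Complex x y)) \<longlonglongrightarrow> h (Complex x y)"
        using truncation_tendsto[OF filterlim_real_sequentially, of "\<lambda>x. h (Complex x y)"] by (simp add: truncation_def)
      show "AE x in lborel. norm (indicator {- real n..real n} x *\<^sub>R h (Complex x y)) \<le> u x" for n
        using bd[OF y] order_trans[OF norm_ge_zero bd[OF y]] by (intro always_eventually allI) (auto simp: indicator_def)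
    qed measurable
    then show ?thesis
      using FTC[of y] y cd by simp
  qed
  have side: "cmod (P (Complex x d) - P (Complex x c)) \<le> u x * (d - c)" for x
  proof -
    have "cmod (P (Complex x d) - P (Complex x c)) \<le> u x * cmod (Complex x d - Complex x c)"
    proof (rule field_differentiable_bound[where S="{z. Re z = x \<and> c \<le> Im z \<and> Im z \<le> d}" and f'=h])
      have "{z. Re z = x \<and> c \<le> Im z \<and> Im z \<le> d} = {z. Re z \<le> x} \<inter> {z. Re z \<ge> x} \<inter> {z. Im z \<ge> c} \<inter> {z. Im z \<le> d}"
        by auto
      then show "convex {z. Re z = x \<and> c \<le> Im z \<and> Im z \<le> d}"
        by (simp add: convex_Int convex_halfspace_Re_ge convex_halfspace_Re_le convex_halfspace_Im_ge convex_halfspace_Im_le)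
      fix z assume z: "z \<in> {z. Re z = x \<and> c \<le> Im z \<and> Im z \<le> d}"
      then have "z \<in> strip a b"
        using cd by (auto simp: strip_def)
      then show "(P has_field_derivative h z) (at z within {z. Re z = x \<and> c \<le> Im z \<and> Im z \<le> d})"
        using P' has_field_derivative_at_within by blast
      have "z = Complex x (Im z)"
        using z by (simp add: complex_eq_iff)
      then show "cmod (h z) \<le> u x"
        using z bd[of "Im z" x] by simp
    qed (use cd in auto)
    also have "cmod (Complex x d - Complex x c) = d - c"
      using cd by (simp add: complex_diff cmod_def)
    finally show ?thesis .
  qed
  have un: "(\<lambda>n. u (real n) * (d - c)) \<longlonglongrightarrow> 0 * (d - c)" "(\<lambda>n. u (- real n) * (d - c)) \<longlonglongrightarrow> 0 * (d - c)"
    by (rule tendsto_mult_right[OF filterlim_compose[OF u(2) filterlim_real_sequentially]],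
        rule tendsto_mult_right[OF filterlim_compose[OF u(3) filterlim_compose[OF filterlim_uminus_at_bot_at_top filterlim_real_sequentially]]])
  have "(\<lambda>n. P (Complex (real n) d) - P (Complex (real n) c)) \<longlonglongrightarrow> 0"
    by (rule Lim_null_comparison[OF always_eventually, of _ "\<lambda>n. u (real n) * (d - c)"]) (use un(1) side in auto)
  moreover have "(\<lambda>n. P (Complex (- real n) d) - P (Complex (- real n) c)) \<longlonglongrightarrow> 0"
    by (rule Lim_null_comparison[OF always_eventually, of _ "\<lambda>n. u (- real n) * (d - c)"]) (use un(2) side in auto)
  ultimately have l1: "(\<lambda>n. (P (Complex (real n) d) - P (Complex (real n) c)) - (P (Complex (- real n) d) - P (Complex (- real n) c))) \<longlonglongrightarrow> 0 - 0"
    by (rule tendsto_diff)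
  have l2: "(\<lambda>n. (P (Complex (real n) d) - P (Complex (- real n) d)) - (P (Complex (real n) c) - P (Complex (- real n) c)))
      \<longlonglongrightarrow> (LINT x|lborel. h (Complex x d)) - (LINT x|lborel. h (Complex x c))"
    by (intro tendsto_diff lim) (use cd in auto)
  have eq: "(\<lambda>n. (P (Complex (real n) d) - P (Complex (- real n) d)) - (P (Complex (real n) c) - P (Complex (- real n) c)))
      = (\<lambda>n. (P (Complex (real n) d) - P (Complex (real n) c)) - (P (Complex (- real n) d) - P (Complex (- real n) c)))"
    by (simp add: algebra_simps)
  have "(LINT x|lborel. h (Complex x d)) - (LINT x|lborel. h (Complex x c)) = 0 - 0"
    by (rule LIMSEQ_unique[OF l2[unfolded eq] l1])
  then show ?thesis
    by simp
qed

lemma tendsto_gaussian_at_top: 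
  assumes "\<delta> > 0"
  shows "((\<lambda>x. exp (- \<delta> * x\<^sup>2 / 2)) \<longlongrightarrow> 0) at_top" "((\<lambda>x. exp (- \<delta> * x\<^sup>2 / 2)) \<longlongrightarrow> (0::real)) at_bot"
proof -
  have neg: "- \<delta> / 2 < 0"
    using assms by simp
  have "filterlim (\<lambda>x::real. x\<^sup>2) at_top at_top" "filterlim (\<lambda>x::real. x\<^sup>2) at_top at_bot"
    by (rule filterlim_pow_at_top[OF _ filterlim_ident], simp, rule filterlim_pow_at_bot_even[OF _ filterlim_ident], auto)
  then have "filterlim (\<lambda>x. - \<delta> / 2 * x\<^sup>2) at_bot at_top" "filterlim (\<lambda>x. - \<delta> / 2 * x\<^sup>2) at_bot at_bot"
    using filterlim_tendsto_neg_mult_at_bot[OF tendsto_const neg] by blast+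
  then show "((\<lambda>x. exp (- \<delta> * x\<^sup>2 / 2)) \<longlongrightarrow> 0) at_top" "((\<lambda>x. exp (- \<delta> * x\<^sup>2 / 2)) \<longlongrightarrow> (0::real)) at_bot"
    using filterlim_compose[OF exp_at_bot] by fastforce+
qed

text \<open>
  Gaussian decay makes the inverse transform converge absolutely on each line, and shifting the
  line shows that all lines define the same \<open>\<kappa>\<close>. The bounds on the lines slightly below
  and above \<open>c\<close> together make \<open>weighted c \<kappa>\<close> decay like \<open>exp (- r \<bar>t\<bar>)\<close>;
  hence it is integrable, and the inversion theorem recovers \<open>H\<close>.
\<close>

lemma strip_inverse_of_gaussian_decay:
  assumes ab: "a < b" and holo: "H holomorphic_on strip a b" and \<delta>: "\<delta> > 0"
    and dec: "\<And>c d. a < c \<Longrightarrow> c \<le> d \<Longrightarrow> d < b \<Longrightarrow>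
      \<exists>C. \<forall>z. c \<le> Im z \<and> Im z \<le> d \<longrightarrow> cmod (H z) \<le> C * exp (- \<delta> * (Re z)\<^sup>2 / 2)"
  obtains \<kappa> where "\<And>c t. a < c \<Longrightarrow> c < b \<Longrightarrow> weighted c \<kappa> t = real_fourier (\<lambda>x. H (Complex x c)) (- t)"
    and "\<And>c. a < c \<Longrightarrow> c < b \<Longrightarrow> integrable lborel (\<lambda>x. H (Complex x c))"
    and "\<And>c. a < c \<Longrightarrow> c < b \<Longrightarrow> integrable lborel (weighted c \<kappa>)"
    and "\<And>c. a < c \<Longrightarrow> c < b \<Longrightarrow> weighted c \<kappa> \<in> L2"
    and "\<And>c x. a < c \<Longrightarrow> c < b \<Longrightarrow> real_fourier (weighted c \<kappa>) x = H (Complex x c)"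
proof -
  let ?e = "\<lambda>x. exp (- \<delta> * x\<^sup>2 / 2)"
  have eint: "integrable lborel ?e"
    using integrable_norm[OF integrable_gaussian[OF \<delta>]] by simp
  have dec': "\<exists>C\<ge>0. \<forall>x y. c \<le> y \<and> y \<le> d \<longrightarrow> cmod (H (Complex x y)) \<le> C * ?e x"
    if "a < c" "c \<le> d" "d < b" for c d
  proof -
    obtain C where C: "\<And>z. c \<le> Im z \<Longrightarrow> Im z \<le> d \<Longrightarrow> cmod (H z) \<le> C * ?e (Re z)"
      using dec[OF \<open>a < c\<close> \<open>c \<le> d\<close> \<open>d < b\<close>] by blast
    have "0 \<le> C"
      using order_trans[OF norm_ge_zero C[of "Complex 0 c"]] that by simp
    moreover have "cmod (H (Complex x y)) \<le> C * ?e x" if "c \<le> y" "y \<le> d" for x y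
      using C[of "Complex x y"] that by simp
    ultimately show ?thesis
      by blast
  qed
  have Hmeas: "(\<lambda>x. H (Complex x c)) \<in> borel_measurable borel" if "a < c" "c < b" for c
    using that by (rule borel_measurable_line[OF holo])
  have Hint: "integrable lborel (\<lambda>x. H (Complex x c))" if c: "a < c" "c < b" for c
  proof -
    obtain C where C: "C \<ge> 0" "\<And>x. cmod (H (Complex x c)) \<le> C * ?e x"
      using dec'[of c c] c by auto
    show ?thesis
      by (rule Bochner_Integration.integrable_bound[OF integrable_mult_right[OF eint, of C]])
        (use C Hmeas[OF c] in \<open>auto intro!: always_eventually\<close>)
  qed
  obtain c0 where c0: "a < c0" "c0 < b"
    using dense[OF ab] by blast
  define \<kappa> where "\<kappa> t = of_real (exp (c0 * t)) * real_fourier (\<lambda>x. H (Complex x c0)) (- t)" for t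
  have indep: "of_real (exp (c * t)) * real_fourier (\<lambda>x. H (Complex x c)) (- t)
      = of_real (exp (d * t)) * real_fourier (\<lambda>x. H (Complex x d)) (- t)"
    if cd: "a < c" "c \<le> d" "d < b" for c d t
  proof -
    define h where "h z = H z * exp (- \<i> * z * of_real t)" for z
    have line: "of_real (exp (y * t)) * real_fourier (\<lambda>x. H (Complex x y)) (- t) = 1 / sqrt (2 * pi) * (LINT x|lborel. h (Complex x y))" for y
    proof -
      have "h (Complex x y) = of_real (exp (y * t)) * (H (Complex x y) * exp (\<i> * of_real (- t) * of_real x))" for x
      proof -
        have "- \<i> * Complex x y * of_real t = of_real (y * t) + \<i> * of_real (- t) * of_real x"
          by (simp add: complex_eq_iff)
        then have "exp (- \<i> * Complex x y * of_real t) = of_real (exp (y * t)) * exp (\<i> * of_real (- t) * of_real x)"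
          by (simp only: exp_add exp_of_real)
        then show ?thesis
          unfolding h_def by (simp only: mult_ac)
      qed
      then have "(LINT x|lborel. h (Complex x y)) = of_real (exp (y * t)) * (LINT x|lborel. H (Complex x y) * exp (\<i> * of_real (- t) * of_real x))"
        by simp
      then show ?thesis
        by (simp add: fourier_def del: of_real_exp)
    qed
    obtain C where C: "C \<ge> 0" "\<And>x y. c \<le> y \<Longrightarrow> y \<le> d \<Longrightarrow> cmod (H (Complex x y)) \<le> C * ?e x"
      using dec'[OF cd] by auto
    define D where "D = C * (exp (c * t) + exp (d * t))"
    have "(LINT x|lborel. h (Complex x c)) = (LINT x|lborel. h (Complex x d))"
    proof (rule integral_line_shift[OF _ cd, where u="\<lambda>x. D * ?e x"])
      show "h holomorphic_on strip a b"
        unfolding h_def by (intro holomorphic_intros holo)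
      show "integrable lborel (\<lambda>x. D * ?e x)"
        by (rule integrable_mult_right[OF eint])
      show "((\<lambda>x. D * ?e x) \<longlongrightarrow> 0) at_top" "((\<lambda>x. D * ?e x) \<longlongrightarrow> 0) at_bot"
        using tendsto_mult_left[OF tendsto_gaussian_at_top(1)[OF \<delta>], of D] tendsto_mult_left[OF tendsto_gaussian_at_top(2)[OF \<delta>], of D] by simp_all
      fix x y assume y: "c \<le> y" "y \<le> d"
      have "cmod (exp (- \<i> * Complex x y * of_real t)) = exp (y * t)"
        by simp
      also have "\<dots> \<le> exp (c * t) + exp (d * t)"
        using exp_weight_le[of c y d "- t"] y by simp
      finally have "cmod (h (Complex x y)) \<le> (C * ?e x) * (exp (c * t) + exp (d * t))"
        unfolding h_def norm_mult using C y by (intro mult_mono) auto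
      then show "cmod (h (Complex x y)) \<le> D * ?e x"
        by (simp add: D_def algebra_simps)
    qed
    then show ?thesis
      unfolding line by simp
  qed
  have w: "weighted c \<kappa> t = real_fourier (\<lambda>x. H (Complex x c)) (- t)" if c: "a < c" "c < b" for c t
  proof -
    have "\<kappa> t = of_real (exp (c * t)) * real_fourier (\<lambda>x. H (Complex x c)) (- t)"
    proof (cases "c \<le> c0")
      case True
      show ?thesis
        unfolding \<kappa>_def by (rule indep[OF c(1) True c0(2), symmetric])
    next
      case False
      then show ?thesis
        unfolding \<kappa>_def by (intro indep c0 c) simp
    qed
    then show ?thesis
      unfolding weighted_def by (simp only: of_real_mult_mult exp_add[symmetric]) simp
  qed
  have meas: "weighted c \<kappa> \<in> borel_measurable borel" if c: "a < c" "c < b" for c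
  proof -
    have "weighted c \<kappa> = (\<lambda>t. real_fourier (\<lambda>x. H (Complex x c)) (- t))"
      using w[OF c] by auto
    moreover have "real_fourier (\<lambda>x. H (Complex x c)) \<in> borel_measurable borel"
      by (rule borel_measurable_fourier[OF Hmeas[OF c]])
    then have "(\<lambda>t. real_fourier (\<lambda>x. H (Complex x c)) (- t)) \<in> borel_measurable borel"
      by (rule measurable_compose[rotated]) measurable
    ultimately show ?thesis
      by (simp only:)
  qed
  have bd: "\<exists>r M. r > 0 \<and> (\<forall>t. cmod (weighted c \<kappa> t) \<le> M * exp (- r * \<bar>t\<bar>))" if c: "a < c" "c < b" for c
  proof -
    define r where "r = min (c - a) (b - c) / 2"
    have r: "r > 0" "a < c - r" "c + r < b"
      using c by (auto simp: r_def min_def field_simps)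
    define M where "M = (LINT x|lborel. cmod (H (Complex x (c - r)))) + (LINT x|lborel. cmod (H (Complex x (c + r))))"
    have 1: "cmod (weighted y \<kappa> t) \<le> M" if "y = c - r \<or> y = c + r" for y t
    proof -
      have y: "a < y" "y < b"
        using that r by auto
      have "cmod (weighted y \<kappa> t) \<le> (LINT x|lborel. cmod (H (Complex x y)))"
        unfolding w[OF y] by (rule cmod_fourier_le[OF Hint[OF y]])
      also have "\<dots> \<le> M"
        using that by (auto simp: M_def intro: integral_nonneg_AE)
      finally show ?thesis .
    qed
    \<comment> \<open>For \<open>t \<ge> 0\<close> the line below \<open>c\<close> gives the decay, for \<open>t < 0\<close> the line above.\<close>
    have "cmod (weighted c \<kappa> t) \<le> M * exp (- r * \<bar>t\<bar>)" for t
    proof (cases "t \<ge> 0")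
      case True
      have "weighted c \<kappa> t = of_real (exp (- r * t)) * weighted (c - r) \<kappa> t"
        unfolding weighted_def of_real_mult_mult exp_add[symmetric] by (simp add: algebra_simps)
      then show ?thesis
        using 1[of "c - r" t] True by (simp add: norm_mult mult.commute mult_left_mono)
    next
      case False
      have "weighted c \<kappa> t = of_real (exp (r * t)) * weighted (c + r) \<kappa> t"
        unfolding weighted_def of_real_mult_mult exp_add[symmetric] by (simp add: algebra_simps)
      then show ?thesis
        using 1[of "c + r" t] False by (simp add: norm_mult mult.commute mult_left_mono)
    qed
    then show ?thesis
      using r by blast
  qed
  have wint: "integrable lborel (weighted c \<kappa>)" and wL2: "weighted c \<kappa> \<in> L2" if c: "a < c" "c < b" for c
  proof -
    obtain r M where r: "r > 0" and M: "\<And>t. cmod (weighted c \<kappa> t) \<le> M * exp (- r * \<bar>t\<bar>)"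
      using bd[OF c] by blast
    show "integrable lborel (weighted c \<kappa>)"
    proof (rule Bochner_Integration.integrable_bound)
      show "integrable lborel (\<lambda>t. M * complex_of_real (exp (- r * \<bar>t\<bar>)))"
        by (rule integrable_mult_right[OF integrable_exp_abs[OF r]])
      show "AE t in lborel. cmod (weighted c \<kappa> t) \<le> cmod (M * complex_of_real (exp (- r * \<bar>t\<bar>)))"
        using order_trans[OF M] by (intro always_eventually allI) (simp add: norm_mult)
    qed (use meas[OF c] in simp)
    show "weighted c \<kappa> \<in> L2"
      by (rule L2_mono_cmult[OF exp_abs_L2[OF r] meas[OF c], of M]) (use M in simp)
  qed
  have inv: "real_fourier (weighted c \<kappa>) x = H (Complex x c)" if c: "a < c" "c < b" for c x
  proof -
    obtain C where C: "C \<ge> 0" "\<And>x. cmod (H (Complex x c)) \<le> C * ?e x"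
      using dec'[of c c] c by auto
    have wr: "weighted c \<kappa> = (\<lambda>t. real_fourier (\<lambda>x. H (Complex x c)) (- t))"
      using w[OF c] by auto
    have "real_fourier (weighted c \<kappa>) x = real_fourier (real_fourier (\<lambda>x. H (Complex x c))) (- x)"
      using fourier_reflect[of "real_fourier (\<lambda>x. H (Complex x c))" "of_real x"] by (simp add: wr)
    also have "\<dots> = H (Complex x c)"
    proof (rule fourier_inversion[OF Hint[OF c], where B=C])
      show "continuous_on UNIV (\<lambda>x. H (Complex x c))"
        by (rule continuous_on_line[OF holo c])
      show "cmod (H (Complex x c)) \<le> C" for x
        by (rule order_trans[OF C(2)]) (use C(1) \<delta> in \<open>auto intro!: mult_left_le\<close>)
      show "integrable lborel (real_fourier (\<lambda>x. H (Complex x c)))"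
        using lborel_integrable_real_affine[OF wint[OF c], of "-1" 0] by (simp add: wr)
    qed
    finally show ?thesis .
  qed
  show thesis
    using that[of \<kappa>] w Hint wint wL2 inv by blast
qed

definition bounded_on_substrips :: "real \<Rightarrow> real \<Rightarrow> (complex \<Rightarrow> complex) \<Rightarrow> bool" where
  "bounded_on_substrips a b G \<longleftrightarrow>
     (\<forall>c d. a < c \<and> c \<le> d \<and> d < b \<longrightarrow> (\<exists>B. \<forall>z. c \<le> Im z \<and> Im z \<le> d \<longrightarrow> cmod (G z) \<le> B))"

text \<open>
  Weighting the \<open>n\<close>-th increment by \<open>2 ^ n\<close> keeps the total energy finite, so almost
  everywhere the increments decay geometrically.
\<close>

lemma AE_convergent_of_fast_energy:
  assumes [measurable]: "\<And>n. f n \<in> borel_measurable borel"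
    and le: "\<And>n. energy (\<lambda>x. f (Suc n) x - f n x) \<le> ennreal (4 * (1 / 4) ^ n)"
  shows "AE x in lborel. convergent (\<lambda>n. f n x)"
proof -
  define d where "d n x = f (Suc n) x - f n x" for n x
  have [measurable]: "d n \<in> borel_measurable borel" for n
    unfolding d_def by measurable
  have "(\<integral>\<^sup>+x. (\<Sum>n. ennreal (2 ^ n) * ennreal ((cmod (d n x))\<^sup>2)) \<partial>lborel)
      = (\<Sum>n. \<integral>\<^sup>+x. ennreal (2 ^ n) * ennreal ((cmod (d n x))\<^sup>2) \<partial>lborel)"
    by (rule nn_integral_suminf) measurable
  also have "\<dots> \<le> (\<Sum>n. ennreal (4 * (1 / 2) ^ n))"
  proof (rule suminf_le)
    fix n
    have "(\<integral>\<^sup>+x. ennreal (2 ^ n) * ennreal ((cmod (d n x))\<^sup>2) \<partial>lborel) = ennreal (2 ^ n) * energy (d n)"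
      unfolding energy_def by (rule nn_integral_cmult) measurable
    also have "\<dots> \<le> ennreal (2 ^ n) * ennreal (4 * (1 / 4) ^ n)"
      using le[of n] unfolding d_def[abs_def] by (intro mult_left_mono) auto
    also have "\<dots> = ennreal (4 * (1 / 2) ^ n)"
      by (simp add: ennreal_mult[symmetric] power_divide field_simps flip: power_mult_distrib)
    finally show "(\<integral>\<^sup>+x. ennreal (2 ^ n) * ennreal ((cmod (d n x))\<^sup>2) \<partial>lborel) \<le> ennreal (4 * (1 / 2) ^ n)" .
  qed auto
  also have "\<dots> < \<infinity>"
  proof -
    have "summable (\<lambda>n. 4 * (1 / 2 :: real) ^ n)"
      by (intro summable_mult summable_geometric) simp
    then show ?thesis
      by (subst suminf_ennreal2) auto
  qed
  finally have "AE x in lborel. (\<Sum>n. ennreal (2 ^ n) * ennreal ((cmod (d n x))\<^sup>2)) \<noteq> \<infinity>"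
    by (intro nn_integral_PInf_AE) auto
  then show ?thesis
  proof eventually_elim
    case (elim x)
    then obtain C where C: "(\<Sum>n. ennreal (2 ^ n) * ennreal ((cmod (d n x))\<^sup>2)) = ennreal C" "C \<ge> 0"
      by (cases "(\<Sum>n. ennreal (2 ^ n) * ennreal ((cmod (d n x))\<^sup>2))") auto
    have bd: "cmod (d n x) \<le> sqrt C * sqrt (1 / 2) ^ n" for n
    proof -
      have "ennreal (2 ^ n * (cmod (d n x))\<^sup>2) \<le> ennreal C"
        using sum_le_suminf[of "\<lambda>n. ennreal (2 ^ n) * ennreal ((cmod (d n x))\<^sup>2)" "{n}"] C(1)
        by (simp add: ennreal_mult)
      then have "2 ^ n * (cmod (d n x))\<^sup>2 \<le> C"
        using C(2) by simp
      then have "(cmod (d n x))\<^sup>2 \<le> C * (1 / 2) ^ n"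
        by (simp add: field_simps)
      then have "sqrt ((cmod (d n x))\<^sup>2) \<le> sqrt (C * (1 / 2) ^ n)"
        by (rule real_sqrt_le_mono)
      then show ?thesis
        by (simp add: real_sqrt_mult real_sqrt_power)
    qed
    have "summable (\<lambda>n. sqrt C * sqrt (1 / 2) ^ n)"
      by (intro summable_mult summable_geometric) (simp add: real_sqrt_divide)
    then have "summable (\<lambda>n. d n x)"
      by (rule summable_comparison_test'[of _ 0]) (use bd in auto)
    then obtain s where "(\<lambda>n. \<Sum>i<n. f (Suc i) x - f i x) \<longlonglongrightarrow> s"
      by (auto simp: d_def summable_def sums_def)
    then have "(\<lambda>n. f n x - f 0 x) \<longlonglongrightarrow> s"
      using sum_lessThan_telescope[of "\<lambda>i. f i x"] by simp
    then have "(\<lambda>n. f n x - f 0 x + f 0 x) \<longlonglongrightarrow> s + f 0 x"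
      by (intro tendsto_add tendsto_const)
    then show ?case
      by (auto simp: convergent_def)
  qed
qed

lemma weighted_diff: "weighted c (\<lambda>t. f t - g t) t = weighted c f t - weighted c g t"
  by (simp add: weighted_def right_diff_distrib)

text \<open>
  Convergence in mean on two lines implies convergence in the norm of \<open>L\<^sub>1\<close> on the line
  between them.
\<close>

lemma fourier_tendsto_of_weighted_energy:
  assumes f: "\<And>n. integrable lborel (weighted c (f n))" and g: "integrable lborel (weighted c g)"
    and r: "r > 0"
    and l: "(\<lambda>n. energy (weighted (c - r) (\<lambda>t. g t - f n t))) \<longlonglongrightarrow> 0"
    and u: "(\<lambda>n. energy (weighted (c + r) (\<lambda>t. g t - f n t))) \<longlonglongrightarrow> 0"
  shows "(\<lambda>n. real_fourier (weighted c (f n)) x) \<longlonglongrightarrow> real_fourier (weighted c g) x"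
proof -
  have [measurable]: "\<And>n. f n \<in> borel_measurable borel" "g \<in> borel_measurable borel"
    using measurable_of_integrable_weighted f g by auto
  have wd: "weighted c (\<lambda>t. g t - f n t) = (\<lambda>t. weighted c g t - weighted c (f n) t)" for n
    by (simp add: weighted_diff fun_eq_iff)
  have i: "integrable lborel (weighted c (\<lambda>t. g t - f n t))" for n
    unfolding wd using f g by auto
  let ?E = "energy (\<lambda>t. of_real (exp (- r * \<bar>t\<bar>)))"
  let ?e = "\<lambda>n. ?E * (2 * energy (weighted (c - r) (\<lambda>t. g t - f n t)) + 2 * energy (weighted (c + r) (\<lambda>t. g t - f n t)))"
  have "(\<lambda>n. cmod (real_fourier (weighted c g) x - real_fourier (weighted c (f n)) x)) \<longlonglongrightarrow> 0"
  proof (rule tendsto_0_of_ennreal_square[of _ ?e])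
    fix n
    have "cmod (real_fourier (weighted c g) x - real_fourier (weighted c (f n)) x) \<le> (LINT t|lborel. cmod (weighted c (\<lambda>t. g t - f n t) t))"
      using cmod_fourier_le[OF i[of n], of x] unfolding wd real_fourier_diff[OF g f] .
    then have "ennreal (cmod (real_fourier (weighted c g) x - real_fourier (weighted c (f n)) x))
        \<le> ennreal (LINT t|lborel. cmod (weighted c (\<lambda>t. g t - f n t) t))"
      by (rule ennreal_leI)
    also have "\<dots> = (\<integral>\<^sup>+t. ennreal (cmod (weighted c (\<lambda>t. g t - f n t) t)) \<partial>lborel)"
      by (rule nn_integral_eq_integral[symmetric]) (use integrable_norm[OF i] in auto)
    finally have "(ennreal (cmod (real_fourier (weighted c g) x - real_fourier (weighted c (f n)) x)))\<^sup>2
        \<le> (\<integral>\<^sup>+t. ennreal (cmod (weighted c (\<lambda>t. g t - f n t) t)) \<partial>lborel)\<^sup>2"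
      by (rule power_mono) simp
    also have "\<dots> \<le> ?e n"
      by (rule nn_integral_weighted_le[OF _ r]) measurable
    finally show "ennreal ((cmod (real_fourier (weighted c g) x - real_fourier (weighted c (f n)) x))\<^sup>2) \<le> ?e n"
      by (simp add: ennreal_power)
  next
    have fin: "?E < top"
      using L2D(2)[OF exp_abs_L2[OF r]] by simp
    have "(\<lambda>n. 2 * energy (weighted (c - r) (\<lambda>t. g t - f n t)) + 2 * energy (weighted (c + r) (\<lambda>t. g t - f n t))) \<longlonglongrightarrow> 2 * 0 + 2 * 0"
      by (rule tendsto_add[OF ennreal_tendsto_cmult[OF _ l] ennreal_tendsto_cmult[OF _ u]]) auto
    from ennreal_tendsto_cmult[OF fin this]
    show "?e \<longlonglongrightarrow> 0"
      by simp
  qed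
  then have "(\<lambda>n. real_fourier (weighted c g) x - real_fourier (weighted c (f n)) x) \<longlonglongrightarrow> 0"
    by (rule tendsto_norm_zero_cancel)
  then have "(\<lambda>n. real_fourier (weighted c g) x - (real_fourier (weighted c g) x - real_fourier (weighted c (f n)) x)) \<longlonglongrightarrow> real_fourier (weighted c g) x - 0"
    by (intro tendsto_diff tendsto_const)
  then show ?thesis
    by simp
qed

text \<open>
  The regularised functions \<open>G z * exp (- \<delta> z\<^sup>2 / 2)\<close> have Gaussian decay, hence
  inverse transforms \<open>k n\<close>. By Bessel's inequality, the differences \<open>k m - k n\<close> are as
  small, on every line, as those of the regularised functions. So a subsequence, chosen with the
  help of one line only, converges almost everywhere, and Fatou's lemma shows that its limit
  \<open>\<kappa>\<close> is the limit in mean on all lines simultaneously. The relations between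
  \<open>\<kappa>\<close> and \<open>G\<close> are inherited from the regularised functions.
\<close>

theorem Paley_Wiener_strip:
  assumes ab: "a < b" and holo: "G holomorphic_on strip a b" and bdd: "bounded_on_substrips a b G"
    and GL2: "\<And>c. a < c \<Longrightarrow> c < b \<Longrightarrow> (\<lambda>x. G (Complex x c)) \<in> L2"
  obtains \<kappa> where "is_strip_inverse_fourier a b G \<kappa>"
    and "\<And>c. a < c \<Longrightarrow> c < b \<Longrightarrow> weighted c \<kappa> \<in> L2"
    and "\<And>c. a < c \<Longrightarrow> c < b \<Longrightarrow> integrable lborel (weighted c \<kappa>)"
    and "\<And>c. a < c \<Longrightarrow> c < b \<Longrightarrow> energy (weighted c \<kappa>) \<le> energy (\<lambda>x. G (Complex x c))"
    and "\<And>z. z \<in> strip a b \<Longrightarrow> fourier \<kappa> z = G z"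
proof -
  define \<delta> where "\<delta> n = 1 / real (Suc n)" for n
  have \<delta>: "\<delta> n > 0" "\<delta> n \<le> 1" for n
    by (auto simp: \<delta>_def)
  have \<delta>lim: "\<delta> \<longlonglongrightarrow> 0"
    unfolding \<delta>_def using LIMSEQ_Suc[OF lim_1_over_n[where 'a=real]] by simp
  define w where "w n z = exp (- of_real (\<delta> n) * z\<^sup>2 / 2)" for n and z :: complex
  have cmod_w: "cmod (w n z) = exp (\<delta> n * (Im z)\<^sup>2 / 2) * exp (- \<delta> n * (Re z)\<^sup>2 / 2)" for n z
    by (simp add: w_def power2_eq_square algebra_simps diff_divide_distrib flip: exp_add)
  have wlim: "(\<lambda>n. w n z) \<longlonglongrightarrow> 1" for z
  proof -
    have "(\<lambda>n. exp (- of_real (\<delta> n) * z\<^sup>2 / 2)) \<longlonglongrightarrow> exp (- of_real 0 * z\<^sup>2 / 2)"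
      by (intro tendsto_intros \<delta>lim) auto
    then show ?thesis
      by (simp add: w_def)
  qed
  define H where "H n z = G z * w n z" for n z
  have Hholo: "H n holomorphic_on strip a b" for n
    unfolding H_def w_def by (intro holomorphic_intros holo) auto
  have Hdec: "\<exists>C. \<forall>z. c \<le> Im z \<and> Im z \<le> d \<longrightarrow> cmod (H n z) \<le> C * exp (- \<delta> n * (Re z)\<^sup>2 / 2)"
    if cd: "a < c" "c \<le> d" "d < b" for c d n
  proof -
    obtain B where B: "\<And>z. c \<le> Im z \<Longrightarrow> Im z \<le> d \<Longrightarrow> cmod (G z) \<le> B"
      using bdd cd unfolding bounded_on_substrips_def by meson
    have B0: "B \<ge> 0"
      using order_trans[OF norm_ge_zero B[of "Complex 0 c"]] cd by simp
    have "cmod (H n z) \<le> (B * exp (\<delta> n * (c\<^sup>2 + d\<^sup>2) / 2)) * exp (- \<delta> n * (Re z)\<^sup>2 / 2)" if z: "c \<le> Im z" "Im z \<le> d" for z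
    proof -
      have "(Im z)\<^sup>2 \<le> c\<^sup>2 + d\<^sup>2"
      proof (cases "Im z \<ge> 0")
        case True
        then have "(Im z)\<^sup>2 \<le> d\<^sup>2"
          using z by (intro power_mono) auto
        then show ?thesis by (simp add: add_increasing)
      next
        case False
        then have "(- Im z)\<^sup>2 \<le> (- c)\<^sup>2"
          using z by (intro power_mono) auto
        then show ?thesis by (simp add: add_increasing2)
      qed
      then have "\<delta> n * (Im z)\<^sup>2 / 2 \<le> \<delta> n * (c\<^sup>2 + d\<^sup>2) / 2"
        using \<delta>(1)[of n] by (intro divide_right_mono mult_left_mono) auto
      then have "cmod (G z) * exp (\<delta> n * (Im z)\<^sup>2 / 2) \<le> B * exp (\<delta> n * (c\<^sup>2 + d\<^sup>2) / 2)"
        using B[OF z] B0 by (intro mult_mono) auto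
      then have "cmod (G z) * exp (\<delta> n * (Im z)\<^sup>2 / 2) * exp (- \<delta> n * (Re z)\<^sup>2 / 2)
          \<le> B * exp (\<delta> n * (c\<^sup>2 + d\<^sup>2) / 2) * exp (- \<delta> n * (Re z)\<^sup>2 / 2)"
        by (rule mult_right_mono) simp
      then show ?thesis
        unfolding H_def norm_mult cmod_w by (simp only: mult.assoc)
    qed
    then show ?thesis
      by blast
  qed
  define Q where "Q n \<kappa> \<longleftrightarrow> (\<forall>c. a < c \<longrightarrow> c < b \<longrightarrow>
      (\<forall>t. weighted c \<kappa> t = real_fourier (\<lambda>x. H n (Complex x c)) (- t))
      \<and> integrable lborel (\<lambda>x. H n (Complex x c)) \<and> integrable lborel (weighted c \<kappa>) \<and> weighted c \<kappa> \<in> L2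
      \<and> (\<forall>x. real_fourier (weighted c \<kappa>) x = H n (Complex x c)))" for n \<kappa>
  have "\<exists>\<kappa>. Q n \<kappa>" for n
  proof (rule strip_inverse_of_gaussian_decay[OF ab Hholo \<delta>(1)])
    show "\<exists>C. \<forall>z. c \<le> Im z \<and> Im z \<le> d \<longrightarrow> cmod (H n z) \<le> C * exp (- \<delta> n * (Re z)\<^sup>2 / 2)"
      if "a < c" "c \<le> d" "d < b" for c d
      using that by (rule Hdec)
  next
    fix \<kappa>
    assume "\<And>c t. a < c \<Longrightarrow> c < b \<Longrightarrow> weighted c \<kappa> t = real_fourier (\<lambda>x. H n (Complex x c)) (- t)"
      "\<And>c. a < c \<Longrightarrow> c < b \<Longrightarrow> integrable lborel (\<lambda>x. H n (Complex x c))"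
      "\<And>c. a < c \<Longrightarrow> c < b \<Longrightarrow> integrable lborel (weighted c \<kappa>)"
      "\<And>c. a < c \<Longrightarrow> c < b \<Longrightarrow> weighted c \<kappa> \<in> L2"
      "\<And>c x. a < c \<Longrightarrow> c < b \<Longrightarrow> real_fourier (weighted c \<kappa>) x = H n (Complex x c)"
    note * = this
    show "\<exists>\<kappa>. Q n \<kappa>"
      unfolding Q_def by (intro exI[of _ \<kappa>] allI impI conjI) (rule *; assumption)+
  qed
  then have "\<exists>k. \<forall>n. Q n (k n)"
    by (intro choice allI)
  then obtain k where k: "\<And>n. Q n (k n)"
    by blast
  have k1: "weighted c (k n) t = real_fourier (\<lambda>x. H n (Complex x c)) (- t)"
    and k2: "integrable lborel (\<lambda>x. H n (Complex x c))"
    and k3: "integrable lborel (weighted c (k n))"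
    and k5: "real_fourier (weighted c (k n)) x = H n (Complex x c)" if c: "a < c" "c < b" for n c t x
    using k[of n] c unfolding Q_def by blast+
  have Gm: "(\<lambda>x. G (Complex x c)) \<in> borel_measurable borel" if "a < c" "c < b" for c
    using that by (rule borel_measurable_line[OF holo])
  have Hm: "(\<lambda>x. H n (Complex x c)) \<in> borel_measurable borel" if "a < c" "c < b" for c n
    using that by (rule borel_measurable_line[OF Hholo])
  have km [measurable]: "k n \<in> borel_measurable borel" for n
    using k3[of "(a + b) / 2" n] ab by (intro measurable_of_integrable_weighted[of "(a + b) / 2"]) auto
  define e where "e n c = energy (\<lambda>x. G (Complex x c) - H n (Complex x c))" for n c
  have elim: "(\<lambda>n. e n c) \<longlonglongrightarrow> 0" if c: "a < c" "c < b" for c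
    unfolding e_def
  proof (rule energy_tendsto_0[where g="\<lambda>x. of_real (1 + exp (c\<^sup>2 / 2)) * G (Complex x c)"])
    show "(\<lambda>x. G (Complex x c) - H n (Complex x c)) \<in> borel_measurable borel" for n
      using Gm[OF c] Hm[OF c] by (rule borel_measurable_diff)
    show "(\<lambda>x. complex_of_real (1 + exp (c\<^sup>2 / 2)) * G (Complex x c)) \<in> L2"
    proof (rule L2_mono_cmult[OF GL2[OF c], of _ "1 + exp (c\<^sup>2 / 2)"])
      show "(\<lambda>x. complex_of_real (1 + exp (c\<^sup>2 / 2)) * G (Complex x c)) \<in> borel_measurable borel"
        using Gm[OF c] by (intro borel_measurable_times) auto
    qed (simp add: norm_mult del: of_real_add)
    show "cmod (G (Complex x c) - H n (Complex x c)) \<le> cmod (complex_of_real (1 + exp (c\<^sup>2 / 2)) * G (Complex x c))" for n x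
    proof -
      have "cmod (w n (Complex x c)) \<le> exp (c\<^sup>2 / 2) * 1"
        unfolding cmod_w using \<delta>[of n] by (intro mult_mono) (auto simp: mult_left_le_one_le)
      then have "cmod (1 - w n (Complex x c)) \<le> 1 + exp (c\<^sup>2 / 2)"
        using norm_triangle_ineq4[of 1 "w n (Complex x c)"] by simp
      then have "cmod (G (Complex x c)) * cmod (1 - w n (Complex x c)) \<le> cmod (G (Complex x c)) * (1 + exp (c\<^sup>2 / 2))"
        by (rule mult_left_mono) simp
      moreover have "G (Complex x c) - H n (Complex x c) = G (Complex x c) * (1 - w n (Complex x c))"
        by (simp add: H_def right_diff_distrib)
      moreover have "cmod (complex_of_real (1 + exp (c\<^sup>2 / 2))) = 1 + exp (c\<^sup>2 / 2)"
        unfolding norm_of_real by (simp add: add_nonneg_nonneg)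
      ultimately show ?thesis
        by (simp only: norm_mult mult.commute)
    qed
    fix x
    have "(\<lambda>n. G (Complex x c) - G (Complex x c) * w n (Complex x c)) \<longlonglongrightarrow> G (Complex x c) - G (Complex x c) * 1"
      by (intro tendsto_intros wlim)
    then show "(\<lambda>n. G (Complex x c) - H n (Complex x c)) \<longlonglongrightarrow> 0"
      by (simp add: H_def)
  qed
  have kdiff: "energy (weighted c (\<lambda>t. k m t - k n t)) \<le> 2 * e m c + 2 * e n c" if c: "a < c" "c < b" for c m n
  proof -
    let ?D = "\<lambda>x. H m (Complex x c) - H n (Complex x c)"
    have Dm: "real_fourier ?D \<in> borel_measurable borel"
      by (intro borel_measurable_fourier borel_measurable_diff Hm c)
    have "weighted c (\<lambda>t. k m t - k n t) = (\<lambda>t. real_fourier ?D (- t))"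
    proof
      fix t
      show "weighted c (\<lambda>t. k m t - k n t) t = real_fourier ?D (- t)"
        unfolding weighted_diff k1[OF c] by (rule real_fourier_diff[OF k2[OF c] k2[OF c], symmetric])
    qed
    then have "energy (weighted c (\<lambda>t. k m t - k n t)) = energy (real_fourier ?D)"
      using energy_reflect[OF Dm] by simp
    also have "\<dots> \<le> energy ?D"
      by (rule Bessel_inequality[OF Bochner_Integration.integrable_diff[OF k2[OF c] k2[OF c]]])
    also have "\<dots> = energy (\<lambda>x. (G (Complex x c) - H n (Complex x c)) - (G (Complex x c) - H m (Complex x c)))"
      by simp
    also have "\<dots> \<le> 2 * e n c + 2 * e m c"
      unfolding e_def by (intro energy_diff_le borel_measurable_diff Gm Hm c)
    finally show ?thesis
      by (simp add: add.commute)
  qed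
  obtain c0 where c0: "a < c0" "c0 < b"
    using dense[OF ab] by blast
  \<comment> \<open>The bounds \<open>m \<ge> n\<close> make the chosen indices tend to infinity, so that errors on all other lines vanish too.\<close>
  have "\<exists>m\<ge>n. e m c0 \<le> ennreal ((1 / 4) ^ n)" for n
  proof -
    have "eventually (\<lambda>m. e m c0 < ennreal ((1 / 4) ^ n)) sequentially"
      using elim[OF c0] by (rule order_tendstoD) simp
    moreover have "eventually (\<lambda>m. m \<ge> n) sequentially"
      by (rule eventually_ge_at_top)
    ultimately have "eventually (\<lambda>m. m \<ge> n \<and> e m c0 \<le> ennreal ((1 / 4) ^ n)) sequentially"
      by eventually_elim auto
    then show ?thesis
      by (rule eventually_happens'[OF sequentially_bot])
  qed
  then obtain r where r: "\<And>n. r n \<ge> n" "\<And>n. e (r n) c0 \<le> ennreal ((1 / 4) ^ n)"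
    by metis
  have rlim: "filterlim r at_top sequentially"
    using r(1) by (intro filterlim_at_top_mono[OF filterlim_ident]) (auto intro: always_eventually)
  have erlim: "(\<lambda>n. e (r n) c) \<longlonglongrightarrow> 0" if "a < c" "c < b" for c
    by (rule filterlim_compose[OF elim[OF that] rlim])
  have two: "2 * ennreal x = ennreal (2 * x)" if "x \<ge> 0" for x
    using that by (simp add: ennreal_mult)
  have "AE t in lborel. convergent (\<lambda>n. weighted c0 (k (r n)) t)"
  proof (rule AE_convergent_of_fast_energy)
    fix n
    have "energy (\<lambda>t. weighted c0 (k (r (Suc n))) t - weighted c0 (k (r n)) t) \<le> 2 * e (r (Suc n)) c0 + 2 * e (r n) c0"
      using kdiff[OF c0, of "r (Suc n)" "r n"] by (simp add: weighted_diff[abs_def])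
    also have "\<dots> \<le> 2 * ennreal ((1 / 4) ^ Suc n) + 2 * ennreal ((1 / 4) ^ n)"
      by (intro add_mono mult_left_mono r) auto
    also have "\<dots> = ennreal (2 * (1 / 4) ^ Suc n + 2 * (1 / 4) ^ n)"
      by (simp only: two ennreal_plus[symmetric] zero_le_power zero_le_divide_1_iff zero_le_numeral mult_nonneg_nonneg)
    also have "\<dots> \<le> ennreal (4 * (1 / 4) ^ n)"
      by (rule ennreal_leI) simp
    finally show "energy (\<lambda>t. weighted c0 (k (r (Suc n))) t - weighted c0 (k (r n)) t) \<le> ennreal (4 * (1 / 4) ^ n)" .
  qed measurable
  then have kconv: "AE t in lborel. convergent (\<lambda>n. k (r n) t)"
  proof eventually_elim
    case (elim t)
    then obtain l where "(\<lambda>n. weighted c0 (k (r n)) t) \<longlonglongrightarrow> l"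
      by (auto simp: convergent_def)
    then have "(\<lambda>n. of_real (exp (c0 * t)) * weighted c0 (k (r n)) t) \<longlonglongrightarrow> of_real (exp (c0 * t)) * l"
      by (rule tendsto_mult_left)
    moreover have "of_real (exp (c0 * t)) * weighted c0 (k (r n)) t = k (r n) t" for n
      unfolding weighted_def of_real_mult_mult exp_add[symmetric] by simp
    ultimately show ?case
      by (auto simp: convergent_def)
  qed
  define \<kappa> where "\<kappa> t = lim (\<lambda>n. k (r n) t)" for t
  have \<kappa>m [measurable]: "\<kappa> \<in> borel_measurable borel"
    unfolding \<kappa>_def by measurable
  have klim: "AE t in lborel. (\<lambda>n. k (r n) t) \<longlonglongrightarrow> \<kappa> t"
    using kconv by eventually_elim (simp add: \<kappa>_def convergent_LIMSEQ_iff)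
  have wklim: "AE t in lborel. (\<lambda>n. weighted c (k (r n)) t) \<longlonglongrightarrow> weighted c \<kappa> t" for c
    using klim by eventually_elim (auto simp: weighted_def intro!: tendsto_mult_left)
  have diffE: "energy (weighted c (\<lambda>t. \<kappa> t - k (r n) t)) \<le> 2 * e (r n) c" if c: "a < c" "c < b" for c n
  proof (rule energy_Fatou[where f="\<lambda>m. weighted c (\<lambda>t. k (r m) t - k (r n) t)" and u="\<lambda>m. 2 * e (r m) c + 2 * e (r n) c"])
    show "AE t in lborel. (\<lambda>m. weighted c (\<lambda>t. k (r m) t - k (r n) t) t) \<longlonglongrightarrow> weighted c (\<lambda>t. \<kappa> t - k (r n) t) t"
      using wklim[of c] by eventually_elim (auto simp: weighted_diff intro!: tendsto_diff)
    show "energy (weighted c (\<lambda>t. k (r m) t - k (r n) t)) \<le> 2 * e (r m) c + 2 * e (r n) c" for m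
      by (rule kdiff[OF c])
    show "(\<lambda>m. 2 * e (r m) c + 2 * e (r n) c) \<longlonglongrightarrow> 2 * e (r n) c"
      using tendsto_add[OF ennreal_tendsto_cmult[OF _ erlim[OF c], of 2] tendsto_const[of "2 * e (r n) c"]] by simp
  qed measurable
  have difflim: "(\<lambda>n. energy (weighted c (\<lambda>t. \<kappa> t - k (r n) t))) \<longlonglongrightarrow> 0" if c: "a < c" "c < b" for c
  proof (rule tendsto_sandwich[OF _ _ tendsto_const])
    show "eventually (\<lambda>n. energy (weighted c (\<lambda>t. \<kappa> t - k (r n) t)) \<le> 2 * e (r n) c) sequentially"
      by (intro always_eventually allI diffE c)
    show "(\<lambda>n. 2 * e (r n) c) \<longlonglongrightarrow> 0"
      using ennreal_tendsto_cmult[OF _ erlim[OF c], of 2] by simp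
  qed auto
  have energy_bd: "energy (weighted c \<kappa>) \<le> energy (\<lambda>x. G (Complex x c))" if c: "a < c" "c < b" for c
  proof (rule energy_Fatou[OF _ wklim])
    let ?u = "\<lambda>n. energy (\<lambda>x. G (Complex x c)) * ennreal ((exp (\<delta> (r n) * c\<^sup>2 / 2))\<^sup>2)"
    show "energy (weighted c (k (r n))) \<le> ?u n" for n
    proof -
      have "weighted c (k (r n)) = (\<lambda>t. real_fourier (\<lambda>x. H (r n) (Complex x c)) (- t))"
        using k1[OF c] by auto
      then have "energy (weighted c (k (r n))) = energy (real_fourier (\<lambda>x. H (r n) (Complex x c)))"
        using energy_reflect[OF borel_measurable_fourier[OF Hm[OF c]]] by simp
      also have "\<dots> \<le> energy (\<lambda>x. H (r n) (Complex x c))"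
        by (rule Bessel_inequality[OF k2[OF c]])
      also have "\<dots> \<le> ennreal ((exp (\<delta> (r n) * c\<^sup>2 / 2))\<^sup>2) * energy (\<lambda>x. G (Complex x c))"
      proof (rule energy_mono_cmult[OF _ Gm[OF c]])
        fix x
        have "cmod (w (r n) (Complex x c)) \<le> exp (\<delta> (r n) * c\<^sup>2 / 2) * 1"
          unfolding cmod_w complex.sel using \<delta>(1)[of "r n"] by (intro mult_left_mono) auto
        then have "cmod (G (Complex x c)) * cmod (w (r n) (Complex x c)) \<le> cmod (G (Complex x c)) * exp (\<delta> (r n) * c\<^sup>2 / 2)"
          by (intro mult_left_mono) auto
        then show "cmod (H (r n) (Complex x c)) \<le> exp (\<delta> (r n) * c\<^sup>2 / 2) * cmod (G (Complex x c))"
          by (simp add: H_def norm_mult mult.commute)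
      qed
      finally show ?thesis
        by (simp add: mult.commute)
    qed
    have "(\<lambda>n. (exp (\<delta> (r n) * c\<^sup>2 / 2))\<^sup>2) \<longlonglongrightarrow> (exp (0 * c\<^sup>2 / 2))\<^sup>2"
      by (intro tendsto_intros filterlim_compose[OF \<delta>lim rlim]) auto
    then have "?u \<longlonglongrightarrow> energy (\<lambda>x. G (Complex x c)) * ennreal ((exp (0 * c\<^sup>2 / 2))\<^sup>2)"
      using L2D(2)[OF GL2[OF c]] by (intro ennreal_tendsto_cmult tendsto_ennrealI) auto
    then show "?u \<longlonglongrightarrow> energy (\<lambda>x. G (Complex x c))"
      by simp
  qed measurable
  have \<kappa>L2: "weighted c \<kappa> \<in> L2" if c: "a < c" "c < b" for c
    using le_less_trans[OF energy_bd[OF c] L2D(2)[OF GL2[OF c]]] by (simp add: L2_iff)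
  have room: "\<exists>r>0. a < c - r \<and> c + r < b" if c: "a < c" "c < b" for c
    using c by (intro exI[of _ "min (c - a) (b - c) / 2"]) (auto simp: min_def field_simps)
  have \<kappa>int: "integrable lborel (weighted c \<kappa>)" if c: "a < c" "c < b" for c
  proof -
    obtain r where "r > 0" "a < c - r" "c + r < b"
      using room[OF c] by blast
    then show ?thesis
      by (intro integrable_weighted_of_L2[of c r] \<kappa>L2) auto
  qed
  have fourier_\<kappa>: "fourier \<kappa> z = G z" if z: "z \<in> strip a b" for z
  proof -
    define c where "c = Im z"
    have c: "a < c" "c < b"
      using z by (auto simp: c_def strip_def)
    obtain s where s: "s > 0" "a < c - s" "c + s < b"
      using room[OF c] by blast
    have "(\<lambda>n. real_fourier (weighted c (k (r n))) (Re z)) \<longlonglongrightarrow> real_fourier (weighted c \<kappa>) (Re z)"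
      by (rule fourier_tendsto_of_weighted_energy[OF k3[OF c] \<kappa>int[OF c] s(1)])
        (use s c in \<open>auto intro!: difflim\<close>)
    moreover have "(\<lambda>n. real_fourier (weighted c (k (r n))) (Re z)) = (\<lambda>n. G z * w (r n) z)"
      unfolding k5[OF c] by (simp add: H_def c_def complex_surj)
    moreover have "(\<lambda>n. G z * w (r n) z) \<longlonglongrightarrow> G z * 1"
      by (intro tendsto_mult_left filterlim_compose[OF wlim rlim])
    ultimately have "real_fourier (weighted c \<kappa>) (Re z) = G z * 1"
      using LIMSEQ_unique by metis
    then show ?thesis
      by (simp add: fourier_weighted[of \<kappa> z] c_def)
  qed
  have inv: "is_strip_inverse_fourier a b G \<kappa>"
    unfolding is_strip_inverse_fourier_def
  proof (intro allI impI)
    fix c assume "a < c \<and> c < b"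
    then have c: "a < c" "c < b" by auto
    have "has_L2_inverse_fourier (\<lambda>x. G (Complex x c)) (weighted c \<kappa>)"
      unfolding has_L2_inverse_fourier_iff
    proof (rule has_L2_fourier_approx[OF GL2[OF c], where g="\<lambda>n x. H (r n) (Complex x c)"])
      show "(\<lambda>t. weighted c \<kappa> (- t)) \<in> L2"
        by (rule L2_reflect[OF \<kappa>L2[OF c]])
      show "integrable lborel (\<lambda>x. H (r n) (Complex x c))" for n
        by (rule k2[OF c])
      show "(\<lambda>n. energy (\<lambda>t. G (Complex t c) - H (r n) (Complex t c))) \<longlonglongrightarrow> 0"
        using erlim[OF c] by (simp add: e_def)
      have "energy (\<lambda>t. weighted c \<kappa> (- t) - real_fourier (\<lambda>x. H (r n) (Complex x c)) t)
          = energy (weighted c (\<lambda>t. \<kappa> t - k (r n) t))" for n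
      proof -
        have "(\<lambda>t. weighted c \<kappa> (- t) - real_fourier (\<lambda>x. H (r n) (Complex x c)) t)
            = (\<lambda>t. weighted c (\<lambda>t. \<kappa> t - k (r n) t) (- t))"
          unfolding weighted_diff k1[OF c] by simp
        then show ?thesis
          by (simp add: energy_reflect)
      qed
      then show "(\<lambda>n. energy (\<lambda>t. weighted c \<kappa> (- t) - real_fourier (\<lambda>x. H (r n) (Complex x c)) t)) \<longlonglongrightarrow> 0"
        using difflim[OF c] by simp
    qed
    then show "has_L2_inverse_fourier (\<lambda>x. G (Complex x c)) (\<lambda>t. of_real (exp (- c * t)) * \<kappa> t)"
      unfolding weighted_def[abs_def] .
  qed
  show thesis
    by (rule that[OF inv \<kappa>L2 \<kappa>int energy_bd fourier_\<kappa>])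
qed

section \<open>Logarithms near infinity\<close>

lemma bounded_on_substripsD:
  assumes "bounded_on_substrips a b G" "a < c" "c \<le> d" "d < b"
  obtains B where "B \<ge> 0" "\<And>z. c \<le> Im z \<Longrightarrow> Im z \<le> d \<Longrightarrow> cmod (G z) \<le> B"
proof -
  obtain B where B: "\<And>z. c \<le> Im z \<Longrightarrow> Im z \<le> d \<Longrightarrow> cmod (G z) \<le> B"
    using assms unfolding bounded_on_substrips_def by meson
  have "B \<ge> 0"
    using order_trans[OF norm_ge_zero B[of "Complex 0 c"]] assms by simp
  then show thesis
    using that B by blast
qed

lemma bounded_on_substrips_fourier:
  assumes "\<And>c. a < c \<Longrightarrow> c < b \<Longrightarrow> integrable lborel (weighted c f)"
  shows "bounded_on_substrips a b (fourier f)"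
  unfolding bounded_on_substrips_def
proof (intro allI impI)
  fix c d assume cd: "a < c \<and> c \<le> d \<and> d < b"
  then have "integrable lborel (weighted c f)" "integrable lborel (weighted d f)"
    using assms by auto
  from cmod_fourier_strip_le[OF this]
  show "\<exists>B. \<forall>z. c \<le> Im z \<and> Im z \<le> d \<longrightarrow> cmod (fourier f z) \<le> B"
    by blast
qed

lemma holomorphic_fourier_strip:
  assumes "\<And>c. a < c \<Longrightarrow> c < b \<Longrightarrow> integrable lborel (weighted c f)"
  shows "fourier f holomorphic_on strip a b"
  using holomorphic_fourier[of "{a<..<b}" f] assms by (simp add: strip_def)

text \<open>
  Cauchy's inequality on discs that reach into a slightly larger substrip bounds the derivative.
\<close>

lemma Lipschitz_on_substrip:
  assumes holo: "G holomorphic_on strip a b" and bdd: "bounded_on_substrips a b G"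
    and cd: "a < c" "c \<le> d" "d < b"
  obtains M where "M \<ge> 0"
    "\<And>z w. c \<le> Im z \<Longrightarrow> Im z \<le> d \<Longrightarrow> c \<le> Im w \<Longrightarrow> Im w \<le> d \<Longrightarrow> cmod (G z - G w) \<le> M * cmod (z - w)"
proof -
  \<comment> \<open>Half the distance to the boundary leaves discs of radius \<open>r\<close> inside the strip.\<close>
  define r where "r = min (c - a) (b - d) / 2"
  have r: "r > 0" "a < c - r" "d + r < b"
    using cd by (auto simp: r_def min_def field_simps)
  obtain B where B: "B \<ge> 0" "\<And>z. c - r \<le> Im z \<Longrightarrow> Im z \<le> d + r \<Longrightarrow> cmod (G z) \<le> B"
    using bounded_on_substripsD[OF bdd, of "c - r" "d + r"] r cd by auto
  let ?S = "{z. c \<le> Im z \<and> Im z \<le> d}"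
  have sub: "cball z r \<subseteq> strip a b" if "z \<in> ?S" for z
  proof
    fix w assume "w \<in> cball z r"
    then have "\<bar>Im w - Im z\<bar> \<le> r"
      using abs_Im_le_cmod[of "w - z"] by (simp add: dist_norm norm_minus_commute)
    then show "w \<in> strip a b"
      using that r by (auto simp: strip_def)
  qed
  have deriv_bd: "cmod (deriv G z) \<le> B / r" if z: "z \<in> ?S" for z
  proof -
    have "cmod ((deriv ^^ 1) G z) \<le> fact 1 * B / r ^ 1"
    proof (rule Cauchy_inequality)
      show "G holomorphic_on ball z r"
        using sub[OF z] ball_subset_cball by (blast intro: holomorphic_on_subset[OF holo])
      show "continuous_on (cball z r) G"
        using holomorphic_on_imp_continuous_on[OF holo] sub[OF z] by (rule continuous_on_subset)
      fix x assume "cmod (z - x) = r"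
      then have "\<bar>Im x - Im z\<bar> \<le> r"
        using abs_Im_le_cmod[of "z - x"] by (simp add: abs_minus_commute)
      then show "cmod (G x) \<le> B"
        using z by (intro B(2)) auto
    qed (use r in auto)
    then show ?thesis
      by simp
  qed
  have "cmod (G z - G w) \<le> B / r * cmod (z - w)"
    if "c \<le> Im z" "Im z \<le> d" "c \<le> Im w" "Im w \<le> d" for z w
  proof (rule field_differentiable_bound[where S="?S" and f'="deriv G"])
    have "?S = {z. Im z \<ge> c} \<inter> {z. Im z \<le> d}"
      by auto
    then show "convex ?S"
      by (simp add: convex_Int convex_halfspace_Im_ge convex_halfspace_Im_le)
    show "(G has_field_derivative deriv G z) (at z within ?S)" if "z \<in> ?S" for z
    proof -
      have "z \<in> strip a b"
        using that cd by (auto simp: strip_def)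
      then show ?thesis
        by (rule holomorphic_derivI[OF holo open_strip])
    qed
  qed (use that deriv_bd in auto)
  moreover have "B / r \<ge> 0"
    using B r by simp
  ultimately show thesis
    using that by blast
qed

lemma uniformly_continuous_on_line:
  assumes "G holomorphic_on strip a b" "bounded_on_substrips a b G" "a < c" "c < b"
  shows "uniformly_continuous_on UNIV (\<lambda>x. G (Complex x c))"
proof -
  obtain M where M: "M \<ge> 0"
    "\<And>z w. c \<le> Im z \<Longrightarrow> Im z \<le> c \<Longrightarrow> c \<le> Im w \<Longrightarrow> Im w \<le> c \<Longrightarrow> cmod (G z - G w) \<le> M * cmod (z - w)"
    using Lipschitz_on_substrip[OF assms(1,2,3) order_refl assms(4)] by blast
  have le: "dist (G (Complex x c)) (G (Complex y c)) \<le> M * dist x y" for x y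
    using M(2)[of "Complex x c" "Complex y c"] by (simp add: dist_norm complex_diff cmod_def)
  show ?thesis
    unfolding uniformly_continuous_on_def
  proof (intro allI impI)
    fix e :: real assume e: "e > 0"
    have "dist (G (Complex y c)) (G (Complex x c)) < e" if "dist y x < e / (M + 1)" for x y
    proof -
      have "dist (G (Complex y c)) (G (Complex x c)) \<le> M * dist y x"
        by (rule le)
      also have "\<dots> \<le> (M + 1) * dist y x"
        by (intro mult_right_mono) auto
      also have "\<dots> < (M + 1) * (e / (M + 1))"
        using M(1) that by (intro mult_strict_left_mono) auto
      also have "\<dots> = e"
        using M(1) by simp
      finally show ?thesis .
    qed
    then show "\<exists>d>0. \<forall>x\<in>UNIV. \<forall>y\<in>UNIV. dist y x < d \<longrightarrow> dist (G (Complex y c)) (G (Complex x c)) < e"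
      using e M(1) by (intro exI[of _ "e / (M + 1)"]) auto
  qed
qed

text \<open>
  The decay on one line extends to nearby lines by the Lipschitz bound, and to a compact range
  of heights by bisection.
\<close>

lemma uniform_decay_on_substrip:
  assumes holo: "G holomorphic_on strip a b" and bdd: "bounded_on_substrips a b G"
    and GL2: "\<And>c. a < c \<Longrightarrow> c < b \<Longrightarrow> (\<lambda>x. G (Complex x c)) \<in> L2"
    and cd: "a < c" "c \<le> d" "d < b" and e: "e > 0"
  shows "\<exists>X. \<forall>z. c \<le> Im z \<and> Im z \<le> d \<and> X \<le> \<bar>Re z\<bar> \<longrightarrow> cmod (G z) < e"
proof -
  let ?P = "\<lambda>u v. \<exists>X. \<forall>z. u \<le> Im z \<and> Im z \<le> v \<and> X \<le> \<bar>Re z\<bar> \<longrightarrow> cmod (G z) < e"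
  from cd(2) show "?P c d"
  proof (induction rule: Bolzano)
    case (trans u v w)
    from trans(1) obtain X where X: "\<And>z. u \<le> Im z \<Longrightarrow> Im z \<le> v \<Longrightarrow> X \<le> \<bar>Re z\<bar> \<Longrightarrow> cmod (G z) < e"
      by blast
    from trans(2) obtain Y where Y: "\<And>z. v \<le> Im z \<Longrightarrow> Im z \<le> w \<Longrightarrow> Y \<le> \<bar>Re z\<bar> \<Longrightarrow> cmod (G z) < e"
      by blast
    have "cmod (G z) < e" if "u \<le> Im z" "Im z \<le> w" "max X Y \<le> \<bar>Re z\<bar>" for z
      using X[of z] Y[of z] that by (cases "Im z \<le> v") auto
    then show ?case
      by blast
  next
    case (local y)
    then have y: "a < y" "y < b"
      using cd by auto
    define r where "r = min (y - a) (b - y) / 2"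
    have r: "r > 0" "a < y - r" "y + r < b"
      using y by (auto simp: r_def min_def field_simps)
    obtain M where M: "M \<ge> 0" "\<And>z w. y - r \<le> Im z \<Longrightarrow> Im z \<le> y + r \<Longrightarrow> y - r \<le> Im w \<Longrightarrow> Im w \<le> y + r
        \<Longrightarrow> cmod (G z - G w) \<le> M * cmod (z - w)"
      using Lipschitz_on_substrip[OF holo bdd r(2) _ r(3)] r(1) by auto
    have lim: "((\<lambda>x. G (Complex x y)) \<longlongrightarrow> 0) at_infinity"
      by (rule uniformly_continuous_L2_tendsto_0[OF GL2[OF y] uniformly_continuous_on_line[OF holo bdd y]])
    obtain X where X: "\<And>x. X \<le> \<bar>x\<bar> \<Longrightarrow> cmod (G (Complex x y)) < e / 2"
      using lim[unfolded Lim_at_infinity, rule_format, of "e / 2"] e by auto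
    define \<eta> where "\<eta> = min r (e / (2 * (M + 1)))"
    have \<eta>: "\<eta> > 0" "\<eta> \<le> r" "\<eta> \<le> e / (2 * (M + 1))"
      using r e M(1) by (auto simp: \<eta>_def)
    have "cmod (G z) < e" if z: "\<bar>Im z - y\<bar> < \<eta>" "X \<le> \<bar>Re z\<bar>" for z
    proof -
      have d: "cmod (z - Complex (Re z) y) = \<bar>Im z - y\<bar>"
        by (simp add: cmod_def)
      have "cmod (G z - G (Complex (Re z) y)) \<le> M * cmod (z - Complex (Re z) y)"
        using z \<eta> r(1) by (intro M(2)) (auto simp: abs_less_iff)
      also have "\<dots> \<le> (M + 1) * (e / (2 * (M + 1)))"
        unfolding d using z \<eta> M(1) by (intro mult_mono) auto
      also have "\<dots> = e / 2"
        using M(1) by (simp add: field_simps)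
      finally have "cmod (G z - G (Complex (Re z) y)) \<le> e / 2" .
      then show ?thesis
        using X[OF z(2)] norm_triangle_ineq2[of "G z" "G (Complex (Re z) y)"] by linarith
    qed
    then have "?P u v" if "u \<le> y \<and> y \<le> v \<and> v - u < \<eta>" for u v
      using that by (intro exI[of _ X]) (auto simp: abs_less_iff)
    then show ?case
      using \<eta>(1) by blast
  qed
qed

text \<open>
  The values of \<open>D\<close> lie in the discrete set of integer multiples of \<open>2 \<pi> i\<close>.
\<close>

lemma log_constant_of_exp_eq_1:
  fixes D :: "'a::topological_space \<Rightarrow> complex"
  assumes "connected S" "continuous_on S D" "\<And>x. x \<in> S \<Longrightarrow> exp (D x) = 1"
  shows "\<exists>m. exp m = 1 \<and> (\<forall>x\<in>S. D x = m)"
proof -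
  have "D constant_on S"
  proof (rule continuous_discrete_range_constant[OF assms(1,2)])
    fix x assume x: "x \<in> S"
    have "2 * pi \<le> cmod (D y - D x)" if "y \<in> S" "D y \<noteq> D x" for y
    proof -
      have "exp (D y) = exp (D x)"
        using assms(3) that(1) x by simp
      then have "2 * pi \<le> \<bar>Im (D y) - Im (D x)\<bar>"
        using exp_complex_eqI[of "D y" "D x"] that(2) by (meson not_less)
      also have "\<dots> \<le> cmod (D y - D x)"
        using abs_Im_le_cmod[of "D y - D x"] by simp
      finally show ?thesis .
    qed
    then show "\<exists>e>0. \<forall>y. y \<in> S \<and> D y \<noteq> D x \<longrightarrow> e \<le> cmod (D y - D x)"
      by (intro exI[of _ "2 * pi"]) (auto simp: pi_gt_zero)
  qed
  then obtain m where m: "\<And>x. x \<in> S \<Longrightarrow> D x = m"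
    by (auto simp: constant_on_def)
  show ?thesis
  proof (cases "S = {}")
    case True
    then show ?thesis by (intro exI[of _ 0]) auto
  next
    case False
    then show ?thesis using m assms(3) by (intro exI[of _ m]) force
  qed
qed

lemma Ln_near_1:
  assumes "continuous_on S w" "\<And>x. x \<in> S \<Longrightarrow> cmod (w x) < 1 / 2"
  shows "continuous_on S (\<lambda>x. Ln (1 + w x))" "\<And>x. x \<in> S \<Longrightarrow> exp (Ln (1 + w x)) = 1 + w x"
proof -
  have *: "1 + w x \<notin> \<real>\<^sub>\<le>\<^sub>0" if "x \<in> S" for x
  proof -
    have "\<bar>Re (w x)\<bar> < 1 / 2"
      using abs_Re_le_cmod[of "w x"] assms(2)[OF that] by linarith
    then show ?thesis
      by (auto simp: complex_nonpos_Reals_iff)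
  qed
  show "continuous_on S (\<lambda>x. Ln (1 + w x))"
    by (intro continuous_intros assms(1) *)
  show "exp (Ln (1 + w x)) = 1 + w x" if "x \<in> S" for x
    using *[OF that] by (intro exp_Ln) auto
qed

text \<open>
  Far out in the direction \<open>\<sigma>\<close>, the values of \<open>1 + G\<close> stay within 1/2 of 1, where the
  principal branch of the logarithm is continuous. On a connected half-strip \<open>L\<close> can differ
  from that branch only by a constant \<open>m\<close>.
\<close>

lemma log_near_infinity:
  assumes L: "L holomorphic_on strip a b" and expL: "\<And>z. z \<in> strip a b \<Longrightarrow> exp (L z) = 1 + G z"
    and holo: "G holomorphic_on strip a b" and bdd: "bounded_on_substrips a b G"
    and GL2: "\<And>c. a < c \<Longrightarrow> c < b \<Longrightarrow> (\<lambda>x. G (Complex x c)) \<in> L2"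
    and cd: "a < c" "c \<le> d" "d < b" and \<sigma>: "\<sigma> = 1 \<or> \<sigma> = - 1"
  shows "\<exists>X m. exp m = 1 \<and> (\<forall>z. c \<le> Im z \<and> Im z \<le> d \<and> X \<le> \<sigma> * Re z \<longrightarrow>
    cmod (L z - m) \<le> 2 * cmod (G z) \<and> cmod (G z) < 1 / 2)"
proof -
  obtain X where X: "\<And>z. c \<le> Im z \<Longrightarrow> Im z \<le> d \<Longrightarrow> X \<le> \<bar>Re z\<bar> \<Longrightarrow> cmod (G z) < 1 / 2"
    using uniform_decay_on_substrip[OF holo bdd GL2 cd, of "1 / 2"] by auto
  let ?S = "{z. c \<le> Im z \<and> Im z \<le> d \<and> X \<le> \<sigma> * Re z}"
  have Gs: "cmod (G z) < 1 / 2" if "z \<in> ?S" for z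
    using that \<sigma> by (intro X) auto
  have sub: "?S \<subseteq> strip a b"
    using cd by (auto simp: strip_def)
  have conn: "connected ?S"
  proof (rule convex_connected)
    have "?S = {z. Im z \<ge> c} \<inter> {z. Im z \<le> d} \<inter> {z. X \<le> \<sigma> * Re z}"
      by auto
    moreover have "convex {z. X \<le> \<sigma> * Re z}"
      using \<sigma> convex_halfspace_Re_ge[of X] convex_halfspace_Re_le[of "- X"] by (auto simp: le_minus_iff)
    ultimately show "convex ?S"
      by (simp add: convex_Int convex_halfspace_Im_ge convex_halfspace_Im_le)
  qed
  have Gc: "continuous_on ?S G" "continuous_on ?S L"
    using holomorphic_on_imp_continuous_on[OF holo] holomorphic_on_imp_continuous_on[OF L] sub
    by (auto intro: continuous_on_subset)
  have Ln1: "continuous_on ?S (\<lambda>z. Ln (1 + G z))"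
    by (rule Ln_near_1(1)[OF Gc(1)]) (rule Gs)
  have Ln2: "exp (Ln (1 + G z)) = 1 + G z" if "z \<in> ?S" for z
    by (rule Ln_near_1(2)[OF Gc(1) _ that]) (rule Gs)
  have "\<exists>m. exp m = 1 \<and> (\<forall>z\<in>?S. L z - Ln (1 + G z) = m)"
  proof (rule log_constant_of_exp_eq_1[OF conn])
    show "continuous_on ?S (\<lambda>z. L z - Ln (1 + G z))"
      by (rule continuous_on_diff[OF Gc(2) Ln1])
    fix z assume z: "z \<in> ?S"
    have "exp (L z) = 1 + G z"
      using expL sub z by blast
    moreover note Ln2[OF z]
    moreover have "exp (L z) \<noteq> 0" by simp
    ultimately show "exp (L z - Ln (1 + G z)) = 1"
      by (simp add: exp_diff)
  qed
  then obtain m where m: "exp m = 1" "\<And>z. z \<in> ?S \<Longrightarrow> L z - Ln (1 + G z) = m"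
    by blast
  show ?thesis
  proof (intro exI[of _ X] exI[of _ m] conjI m(1) allI impI)
    fix z assume "c \<le> Im z \<and> Im z \<le> d \<and> X \<le> \<sigma> * Re z"
    then have zS: "z \<in> ?S" by simp
    have "L z - m = Ln (1 + G z)"
      using m(2)[OF zS] by (simp add: algebra_simps)
    then show "cmod (L z - m) \<le> 2 * cmod (G z)"
      using norm_Ln_le[OF Gs[OF zS]] by simp
    show "cmod (G z) < 1 / 2"
      by (rule Gs[OF zS])
  qed
qed

text \<open>
  The normalisation at infinity forces the constant of the previous lemma to be 0 at both ends,
  so \<open>\<bar>L\<bar> \<le> 2 \<bar>G\<bar>\<close> far out. The rest of a closed substrip is a compact
  rectangle. The two conclusions are what \<open>Paley_Wiener_strip\<close> requires of \<open>L\<close>.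
\<close>

lemma strip_ln_bounds:
  assumes ab: "a < b" and ln: "is_strip_ln a b K L" and K: "\<And>z. z \<in> strip a b \<Longrightarrow> K z = 1 + G z"
    and holo: "G holomorphic_on strip a b" and bdd: "bounded_on_substrips a b G"
    and GL2: "\<And>c. a < c \<Longrightarrow> c < b \<Longrightarrow> (\<lambda>x. G (Complex x c)) \<in> L2"
  shows "bounded_on_substrips a b L" and "\<And>c. a < c \<Longrightarrow> c < b \<Longrightarrow> (\<lambda>x. L (Complex x c)) \<in> L2"
proof -
  have L: "L holomorphic_on strip a b" and expL: "\<And>z. z \<in> strip a b \<Longrightarrow> exp (L z) = 1 + G z"
    and Ltop: "\<And>c. a < c \<Longrightarrow> c < b \<Longrightarrow> ((\<lambda>x. L (Complex x c)) \<longlongrightarrow> 0) at_top"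
    and Lbot: "\<And>c. a < c \<Longrightarrow> c < b \<Longrightarrow> ((\<lambda>x. L (Complex x c)) \<longlongrightarrow> 0) at_bot"
    using ln K by (auto simp: is_strip_ln_def)
  have zero: "m = 0" if m: "exp m = 1" "cmod m < 2 * pi" for m
  proof -
    have "\<bar>Im m - Im 0\<bar> < 2 * pi"
      using m(2) abs_Im_le_cmod[of m] by simp
    then show ?thesis
      using exp_complex_eqI[of m 0] m(1) by simp
  qed
  have far: "\<exists>X. \<forall>z. c \<le> Im z \<and> Im z \<le> d \<and> X \<le> \<bar>Re z\<bar> \<longrightarrow> cmod (L z) \<le> 2 * cmod (G z) \<and> cmod (G z) < 1 / 2"
    if cd: "a < c" "c \<le> d" "d < b" for c d
  proof -
    have "\<exists>X m. exp m = 1 \<and> (\<forall>z. c \<le> Im z \<and> Im z \<le> d \<and> X \<le> 1 * Re z \<longrightarrow>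
        cmod (L z - m) \<le> 2 * cmod (G z) \<and> cmod (G z) < 1 / 2)"
      by (rule log_near_infinity[OF L expL holo bdd GL2 cd]) simp_all
    then obtain X m where X: "exp m = 1" "\<And>z. c \<le> Im z \<Longrightarrow> Im z \<le> d \<Longrightarrow> X \<le> 1 * Re z \<Longrightarrow> cmod (L z - m) \<le> 2 * cmod (G z)"
      "\<And>z. c \<le> Im z \<Longrightarrow> Im z \<le> d \<Longrightarrow> X \<le> 1 * Re z \<Longrightarrow> cmod (G z) < 1 / 2"
      by blast
    have "\<exists>X m. exp m = 1 \<and> (\<forall>z. c \<le> Im z \<and> Im z \<le> d \<and> X \<le> - 1 * Re z \<longrightarrow>
        cmod (L z - m) \<le> 2 * cmod (G z) \<and> cmod (G z) < 1 / 2)"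
      by (rule log_near_infinity[OF L expL holo bdd GL2 cd]) simp_all
    then obtain Y n where Y: "exp n = 1" "\<And>z. c \<le> Im z \<Longrightarrow> Im z \<le> d \<Longrightarrow> Y \<le> - 1 * Re z \<Longrightarrow> cmod (L z - n) \<le> 2 * cmod (G z)"
      "\<And>z. c \<le> Im z \<Longrightarrow> Im z \<le> d \<Longrightarrow> Y \<le> - 1 * Re z \<Longrightarrow> cmod (G z) < 1 / 2"
      by blast
    \<comment> \<open>A multiple of \<open>2 \<pi> i\<close> of modulus less than \<open>2 \<pi>\<close> is 0.\<close>
    have "eventually (\<lambda>x. cmod (L (Complex x c)) < 1) at_top"
      using order_tendstoD(2)[OF tendsto_norm[OF Ltop[of c]], of 1] cd by simp
    then have "eventually (\<lambda>x. cmod (L (Complex x c)) < 1 \<and> x \<ge> X) at_top"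
      using eventually_ge_at_top by (rule eventually_conj)
    then obtain x where x: "cmod (L (Complex x c)) < 1" "x \<ge> X"
      using eventually_happens'[OF trivial_limit_at_top_linorder] by blast
    have "cmod (L (Complex x c) - m) < 1"
      using X(2)[of "Complex x c"] X(3)[of "Complex x c"] x cd by simp
    then have "cmod m < 2"
      using x norm_triangle_ineq2[of m "L (Complex x c)"] by (simp add: norm_minus_commute)
    then have m0: "m = 0"
      using zero[OF X(1)] pi_gt3 by simp
    have "eventually (\<lambda>x. cmod (L (Complex x c)) < 1) at_bot"
      using order_tendstoD(2)[OF tendsto_norm[OF Lbot[of c]], of 1] cd by simp
    then have "eventually (\<lambda>x. cmod (L (Complex x c)) < 1 \<and> x \<le> - Y) at_bot"
      using eventually_le_at_bot by (rule eventually_conj)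
    then obtain x where x: "cmod (L (Complex x c)) < 1" "x \<le> - Y"
      using eventually_happens'[OF trivial_limit_at_bot_linorder] by blast
    have "cmod (L (Complex x c) - n) < 1"
      using Y(2)[of "Complex x c"] Y(3)[of "Complex x c"] x cd by simp
    then have "cmod n < 2"
      using x norm_triangle_ineq2[of n "L (Complex x c)"] by (simp add: norm_minus_commute)
    then have n0: "n = 0"
      using zero[OF Y(1)] pi_gt3 by simp
    have "cmod (L z) \<le> 2 * cmod (G z) \<and> cmod (G z) < 1 / 2" if z: "c \<le> Im z" "Im z \<le> d" "max X Y \<le> \<bar>Re z\<bar>" for z
      using X(2,3)[OF z(1,2)] Y(2,3)[OF z(1,2)] z(3) by (cases "Re z \<ge> 0") (auto simp: m0 n0)
    then show ?thesis
      by blast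
  qed
  have near: "\<exists>B. \<forall>z. c \<le> Im z \<and> Im z \<le> d \<and> \<bar>Re z\<bar> \<le> X \<longrightarrow> cmod (L z) \<le> B"
    if cd: "a < c" "c \<le> d" "d < b" for c d X
  proof -
    let ?Q = "cbox (Complex (- X) c) (Complex X d)"
    have "?Q \<subseteq> strip a b"
      using cd by (auto simp: in_cbox_complex_iff strip_def)
    then have "compact (L ` ?Q)"
      by (intro compact_continuous_image continuous_on_subset[OF holomorphic_on_imp_continuous_on[OF L]]) auto
    then obtain B where "\<And>z. z \<in> ?Q \<Longrightarrow> cmod (L z) \<le> B"
      using compact_imp_bounded bounded_iff by (metis imageI)
    then show ?thesis
      by (intro exI[of _ B]) (auto simp: in_cbox_complex_iff abs_le_iff)
  qed
  show "bounded_on_substrips a b L"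
    unfolding bounded_on_substrips_def
  proof (intro allI impI)
    fix c d assume "a < c \<and> c \<le> d \<and> d < b"
    then have cd: "a < c" "c \<le> d" "d < b" by auto
    obtain X where X: "\<And>z. c \<le> Im z \<Longrightarrow> Im z \<le> d \<Longrightarrow> X \<le> \<bar>Re z\<bar> \<Longrightarrow> cmod (L z) \<le> 2 * cmod (G z) \<and> cmod (G z) < 1 / 2"
      using far[OF cd] by blast
    obtain B where B: "\<And>z. c \<le> Im z \<Longrightarrow> Im z \<le> d \<Longrightarrow> \<bar>Re z\<bar> \<le> X \<Longrightarrow> cmod (L z) \<le> B"
      using near[OF cd, of X] by blast
    have "cmod (L z) \<le> max 1 B" if "c \<le> Im z" "Im z \<le> d" for z
      using X[OF that] B[OF that] by (cases "X \<le> \<bar>Re z\<bar>") auto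
    then show "\<exists>B. \<forall>z. c \<le> Im z \<and> Im z \<le> d \<longrightarrow> cmod (L z) \<le> B"
      by blast
  qed
  fix c assume c: "a < c" "c < b"
  obtain X where X: "\<And>z. c \<le> Im z \<Longrightarrow> Im z \<le> c \<Longrightarrow> X \<le> \<bar>Re z\<bar> \<Longrightarrow> cmod (L z) \<le> 2 * cmod (G z) \<and> cmod (G z) < 1 / 2"
    using far[OF c(1) order_refl c(2)] by blast
  obtain B where B: "\<And>z. c \<le> Im z \<Longrightarrow> Im z \<le> c \<Longrightarrow> \<bar>Re z\<bar> \<le> X \<Longrightarrow> cmod (L z) \<le> B"
    using near[OF c(1) order_refl c(2), of X] by blast
  define B' where "B' = max B 0"
  let ?g = "\<lambda>x. complex_of_real (2 * cmod (G (Complex x c))) + complex_of_real (B' * indicator {-X..X} x)"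
  show "(\<lambda>x. L (Complex x c)) \<in> L2"
  proof (rule L2_mono_cmult[of ?g _ 1])
    have "(\<lambda>x. complex_of_real (2 * cmod (G (Complex x c)))) \<in> L2"
      using borel_measurable_line[OF holo c] by (intro L2_mono_cmult[OF GL2[OF c], of _ 2]) auto
    moreover have "(\<lambda>x. complex_of_real (B' * indicator {-X..X} x)) \<in> L2"
      by (rule L2_mono_cmult[OF indicator_L2[of "- X" X], of _ B']) (auto simp: B'_def indicator_def)
    ultimately show "?g \<in> L2"
      by (rule L2_add)
    show "(\<lambda>x. L (Complex x c)) \<in> borel_measurable borel"
      by (rule borel_measurable_line[OF L c])
    fix x
    have "cmod (L (Complex x c)) \<le> 2 * cmod (G (Complex x c)) + B' * indicator {-X..X} x"
      using X[of "Complex x c"] B[of "Complex x c"]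
      by (cases "X \<le> \<bar>x\<bar>") (auto simp: B'_def indicator_def abs_le_iff intro: add_increasing2 add_increasing)
    also have "\<dots> = 1 * cmod (?g x)"
      unfolding of_real_add[symmetric] norm_of_real by (simp add: B'_def)
    finally show "cmod (L (Complex x c)) \<le> 1 * cmod (?g x)" .
  qed
qed

section \<open>Functions of one-sided and two-sided classes\<close>

lemma class1_iff: "g \<in> class1 a \<longleftrightarrow> (\<exists>F. F \<in> L2 \<and> Hoelder_continuous F \<and> has_L2_fourier (weighted a g) F)"
proof -
  have "(\<lambda>x. of_real (exp (- a * x)) * g x) = weighted a g"
    by (simp add: weighted_def fun_eq_iff)
  then show ?thesis
    by (auto simp: class1_def class0_def hat_class0_def)
qed

lemma cmod_weighted_right_le:
  assumes supp: "\<And>t. t < 0 \<Longrightarrow> g t = 0" and c: "a \<le> c"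
  shows "cmod (weighted c g t) \<le> cmod (weighted a g t)"
  using supp[of t] c by (cases "t < 0") (auto simp: cmod_weighted intro!: mult_right_mono)

lemma cmod_weighted_left_le:
  assumes supp: "\<And>t. t > 0 \<Longrightarrow> g t = 0" and c: "c \<le> b"
  shows "cmod (weighted c g t) \<le> cmod (weighted b g t)"
proof (cases "t > 0")
  case False
  then have "b * t \<le> c * t"
    using c by (intro mult_right_mono_neg) auto
  then show ?thesis
    by (auto simp: cmod_weighted intro!: mult_right_mono)
qed (simp add: supp weighted_def)

lemma weighted_L2_right:
  assumes supp: "\<And>t. t < 0 \<Longrightarrow> g t = 0" and L2: "weighted a g \<in> L2" and c: "a \<le> c"
  shows "weighted c g \<in> L2"
  by (rule L2_mono_cmult[OF L2, of _ 1])
    (use cmod_weighted_right_le[of g, OF supp c] L2D(1)[OF L2] in \<open>auto simp: borel_measurable_weighted_iff\<close>)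

lemma weighted_L2_left:
  assumes supp: "\<And>t. t > 0 \<Longrightarrow> g t = 0" and L2: "weighted b g \<in> L2" and c: "c \<le> b"
  shows "weighted c g \<in> L2"
  by (rule L2_mono_cmult[OF L2, of _ 1])
    (use cmod_weighted_left_le[of g, OF supp c] L2D(1)[OF L2] in \<open>auto simp: borel_measurable_weighted_iff\<close>)

lemma integrable_weighted_right:
  assumes supp: "\<And>t. t < 0 \<Longrightarrow> g t = 0" and int: "integrable lborel (weighted a g)" and c: "a \<le> c"
  shows "integrable lborel (weighted c g)"
  by (rule Bochner_Integration.integrable_bound[OF int])
    (use cmod_weighted_right_le[of g, OF supp c] measurable_of_integrable_weighted[OF int] in auto)

lemma integrable_weighted_left:
  assumes supp: "\<And>t. t > 0 \<Longrightarrow> g t = 0" and int: "integrable lborel (weighted b g)" and c: "c \<le> b"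
  shows "integrable lborel (weighted c g)"
  by (rule Bochner_Integration.integrable_bound[OF int])
    (use cmod_weighted_left_le[of g, OF supp c] measurable_of_integrable_weighted[OF int] in auto)

lemma plus_part_L2_integrable:
  assumes "plus_part f \<in> class1 a"
  shows "a \<le> c \<Longrightarrow> weighted c (plus_part f) \<in> L2"
    and "a < c \<Longrightarrow> integrable lborel (weighted c (plus_part f))"
proof -
  have supp: "\<And>t. t < 0 \<Longrightarrow> plus_part f t = 0"
    by (simp add: plus_part_def)
  have L2: "weighted a (plus_part f) \<in> L2"
    using assms by (auto simp: class1_iff has_L2_fourier_def)
  show L2': "weighted c (plus_part f) \<in> L2" if "a \<le> c" for c
    using supp L2 that by (rule weighted_L2_right)
  show "integrable lborel (weighted c (plus_part f))" if "a < c"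
    using L2'[of "c - (c - a)"] L2'[of "c + (c - a)"] that
    by (intro integrable_weighted_of_L2[of c "c - a"]) auto
qed

lemma minus_part_L2_integrable:
  assumes "minus_part f \<in> class1 b"
  shows "c \<le> b \<Longrightarrow> weighted c (minus_part f) \<in> L2"
    and "c < b \<Longrightarrow> integrable lborel (weighted c (minus_part f))"
proof -
  have supp: "\<And>t. t > 0 \<Longrightarrow> minus_part f t = 0"
    by (simp add: minus_part_def)
  have L2: "weighted b (minus_part f) \<in> L2"
    using assms by (auto simp: class1_iff has_L2_fourier_def)
  show L2': "weighted c (minus_part f) \<in> L2" if "c \<le> b" for c
    using supp L2 that by (rule weighted_L2_left)
  show "integrable lborel (weighted c (minus_part f))" if "c < b"
    using L2'[of "c - (b - c)"] L2'[of "c + (b - c)"] that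
    by (intro integrable_weighted_of_L2[of c "b - c"]) auto
qed

lemma fourier_AE_add:
  assumes "integrable lborel (weighted (Im z) g)" "integrable lborel (weighted (Im z) h)"
    and f: "f \<in> borel_measurable borel" and eq: "AE t in lborel. f t = g t + h t"
  shows "fourier f z = fourier g z + fourier h z"
proof -
  have i: "integrable lborel (\<lambda>t. g t * exp (\<i> * z * of_real t))" "integrable lborel (\<lambda>t. h t * exp (\<i> * z * of_real t))"
    using assms by (simp_all add: integrable_weighted_iff)
  have [measurable]: "f \<in> borel_measurable borel" "g \<in> borel_measurable borel" "h \<in> borel_measurable borel"
    using f measurable_of_integrable_weighted assms(1,2) by auto
  have "(LINT t|lborel. f t * exp (\<i> * z * of_real t)) = (LINT t|lborel. g t * exp (\<i> * z * of_real t) + h t * exp (\<i> * z * of_real t))"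
    by (rule integral_cong_AE) (use eq in \<open>auto elim!: eventually_mono simp: distrib_right\<close>)
  also have "\<dots> = (LINT t|lborel. g t * exp (\<i> * z * of_real t)) + (LINT t|lborel. h t * exp (\<i> * z * of_real t))"
    by (rule Bochner_Integration.integral_add[OF i])
  finally show ?thesis
    by (simp add: fourier_def distrib_left)
qed

lemma fourier_uminus: "fourier (\<lambda>t. - f t) z = - fourier f z"
  using fourier_cmult[of "- 1" f z] by simp

lemma line_transform_L2:
  assumes "weighted c f \<in> L2" "integrable lborel (weighted c f)"
  shows "(\<lambda>x. fourier f (Complex x c)) \<in> L2"
    "energy (\<lambda>x. fourier f (Complex x c)) \<le> energy (weighted c f)"
proof -
  have eq: "(\<lambda>x. fourier f (Complex x c)) = real_fourier (weighted c f)"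
    by (simp add: fourier_Complex)
  show le: "energy (\<lambda>x. fourier f (Complex x c)) \<le> energy (weighted c f)"
    unfolding eq by (rule Bessel_inequality[OF assms(2)])
  have "real_fourier (weighted c f) \<in> borel_measurable borel"
    by (rule borel_measurable_fourier) (use assms(2) in auto)
  then show "(\<lambda>x. fourier f (Complex x c)) \<in> L2"
    using le_less_trans[OF le L2D(2)[OF assms(1)]] by (simp add: L2_iff eq)
qed

text \<open>
  Here \<open>1 + fourier f\<close> is the function to be factorised.
\<close>

locale strip_transform =
  fixes a b :: real and f :: "real \<Rightarrow> complex"
  assumes ab: "a < b" and plus: "plus_part f \<in> class1 a" and minus: "minus_part f \<in> class1 b"
    and int: "\<And>c. a < c \<Longrightarrow> c < b \<Longrightarrow> integrable lborel (weighted c f)"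
begin

lemma holo: "fourier f holomorphic_on strip a b"
  using int by (rule holomorphic_fourier_strip)

lemma bdd: "bounded_on_substrips a b (fourier f)"
  using int by (rule bounded_on_substrips_fourier)

lemma meas: "f \<in> borel_measurable borel"
  using measurable_of_integrable_weighted[OF int[of "(a + b) / 2"]] ab by auto

lemma AE_split: "AE t in lborel. f t = plus_part f t - minus_part f t"
  using AE_lborel_singleton[of 0] by eventually_elim (auto simp: plus_part_def minus_part_def)

lemma fourier_split:
  assumes "z \<in> strip a b"
  shows "fourier f z = fourier (plus_part f) z - fourier (minus_part f) z"
proof -
  have i: "integrable lborel (weighted (Im z) (plus_part f))" "integrable lborel (weighted (Im z) (minus_part f))"
    using assms plus_part_L2_integrable(2)[OF plus] minus_part_L2_integrable(2)[OF minus] by (auto simp: strip_def)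
  have "weighted (Im z) (\<lambda>t. - minus_part f t) = (\<lambda>t. - weighted (Im z) (minus_part f) t)"
    by (simp add: weighted_def fun_eq_iff)
  then have i2: "integrable lborel (weighted (Im z) (\<lambda>t. - minus_part f t))"
    using i(2) by simp
  have "fourier f z = fourier (plus_part f) z + fourier (\<lambda>t. - minus_part f t) z"
    by (rule fourier_AE_add[OF i(1) i2 meas]) (use AE_split in auto)
  then show ?thesis
    by (simp add: fourier_uminus)
qed

lemma weighted_L2:
  assumes "a < c" "c < b"
  shows "weighted c f \<in> L2"
proof -
  have [measurable]: "f \<in> borel_measurable borel"
    by (rule meas)
  have L: "weighted c (plus_part f) \<in> L2" "weighted c (minus_part f) \<in> L2"
    using plus_part_L2_integrable(1)[OF plus] minus_part_L2_integrable(1)[OF minus] assms by auto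
  have "energy (weighted c f) = energy (\<lambda>t. weighted c (plus_part f) t - weighted c (minus_part f) t)"
    unfolding energy_def
    by (rule nn_integral_cong_AE) (use AE_split in \<open>auto elim!: eventually_mono simp: weighted_def right_diff_distrib\<close>)
  also have "\<dots> \<le> 2 * energy (weighted c (plus_part f)) + 2 * energy (weighted c (minus_part f))"
    by (rule energy_diff_le[OF L2D(1)[OF L(1)] L2D(1)[OF L(2)]])
  also have "\<dots> < \<infinity>"
    using L2D(2)[OF L(1)] L2D(2)[OF L(2)] by (simp add: ennreal_mult_less_top)
  finally show ?thesis
    by (simp add: L2_iff)
qed

lemma line_L2: "a < c \<Longrightarrow> c < b \<Longrightarrow> (\<lambda>x. fourier f (Complex x c)) \<in> L2"
  by (intro line_transform_L2 weighted_L2 int)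

lemma line_tendsto_0:
  assumes "a < c" "c < b"
  shows "((\<lambda>x. fourier f (Complex x c)) \<longlongrightarrow> 0) at_infinity"
  by (rule uniformly_continuous_L2_tendsto_0[OF line_L2[OF assms] uniformly_continuous_on_line[OF holo bdd assms]])

text \<open>
  Each closed substrip has its own constant at infinity. Any two heights lie in a common closed
  substrip, so the constants agree.
\<close>

lemma log_limits:
  fixes \<sigma> :: real and F :: "real filter"
  assumes L: "L holomorphic_on strip a b" and expL: "\<And>z. z \<in> strip a b \<Longrightarrow> exp (L z) = 1 + fourier f z"
    and F: "\<sigma> = 1 \<and> F = at_top \<or> \<sigma> = - 1 \<and> F = at_bot"
  shows "\<exists>m. exp m = 1 \<and> (\<forall>c. a < c \<and> c < b \<longrightarrow> ((\<lambda>x. L (Complex x c)) \<longlongrightarrow> m) F)"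
proof -
  have F0: "F \<noteq> bot"
    using F trivial_limit_at_top_linorder trivial_limit_at_bot_linorder by metis
  have Finf: "F \<le> at_infinity"
    using F at_top_le_at_infinity at_bot_le_at_infinity by auto
  have ev: "eventually (\<lambda>x. X \<le> \<sigma> * x) F" for X
  proof -
    have t: "eventually (\<lambda>x. X \<le> 1 * x) at_top"
      by (simp add: eventually_ge_at_top)
    have "eventually (\<lambda>x. x \<le> - X) at_bot"
      by (rule eventually_le_at_bot)
    then have "eventually (\<lambda>x. X \<le> - 1 * x) at_bot"
      by eventually_elim simp
    then show ?thesis
      using F t by metis
  qed
  have ex: "\<exists>m. exp m = 1 \<and> (\<forall>y. c \<le> y \<and> y \<le> d \<longrightarrow> ((\<lambda>x. L (Complex x y)) \<longlongrightarrow> m) F)"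
    if cd: "a < c" "c \<le> d" "d < b" for c d
  proof -
    have "\<exists>X m. exp m = 1 \<and> (\<forall>z. c \<le> Im z \<and> Im z \<le> d \<and> X \<le> \<sigma> * Re z \<longrightarrow>
        cmod (L z - m) \<le> 2 * cmod (fourier f z) \<and> cmod (fourier f z) < 1 / 2)"
      by (rule log_near_infinity[OF L expL holo bdd line_L2 cd]) (use F in auto)
    then obtain X m where m: "exp m = 1" and X: "\<And>z. c \<le> Im z \<Longrightarrow> Im z \<le> d \<Longrightarrow> X \<le> \<sigma> * Re z \<Longrightarrow>
        cmod (L z - m) \<le> 2 * cmod (fourier f z)"
      by blast
    have "((\<lambda>x. L (Complex x y)) \<longlongrightarrow> m) F" if y: "c \<le> y" "y \<le> d" for y
    proof -
      have "((\<lambda>x. fourier f (Complex x y)) \<longlongrightarrow> 0) F"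
        using line_tendsto_0[of y] y cd by (intro tendsto_mono[OF Finf]) auto
      then have "((\<lambda>x. 2 * cmod (fourier f (Complex x y))) \<longlongrightarrow> 2 * 0) F"
        by (intro tendsto_mult_left tendsto_norm_zero)
      moreover have "eventually (\<lambda>x. norm (L (Complex x y) - m) \<le> 2 * cmod (fourier f (Complex x y))) F"
        using ev[of X] by eventually_elim (use X y in auto)
      ultimately have "((\<lambda>x. L (Complex x y) - m) \<longlongrightarrow> 0) F"
        by (intro Lim_null_comparison[of "\<lambda>x. L (Complex x y) - m" "\<lambda>x. 2 * cmod (fourier f (Complex x y))"]) simp_all
      then show ?thesis
        by (rule LIM_zero_cancel)
    qed
    then show ?thesis
      using m by blast
  qed
  obtain c0 where c0: "a < c0" "c0 < b"
    using dense[OF ab] by blast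
  obtain m where m: "exp m = 1" "((\<lambda>x. L (Complex x c0)) \<longlongrightarrow> m) F"
    using ex[OF c0(1) order_refl c0(2)] by auto
  have "((\<lambda>x. L (Complex x c)) \<longlongrightarrow> m) F" if c: "a < c" "c < b" for c
  proof -
    obtain m' where m': "\<And>y. min c c0 \<le> y \<Longrightarrow> y \<le> max c c0 \<Longrightarrow> ((\<lambda>x. L (Complex x y)) \<longlongrightarrow> m') F"
    proof -
      have "a < min c c0" "min c c0 \<le> max c c0" "max c c0 < b"
        using c c0 by auto
      then show thesis
        using ex that by blast
    qed
    have "m' = m"
      by (rule tendsto_unique[OF F0 m' m(2)]) auto
    then show ?thesis
      using m'[of c] by auto
  qed
  then show ?thesis
    using m(1) by blast
qed

text \<open>
  Of the two parts of \<open>fourier f\<close>, the one from \<open>t > 0\<close> converges uniformly to its Hoelder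
  continuous boundary function. The one from \<open>t < 0\<close> is holomorphic across the lower edge and
  Lipschitz continuous there.
\<close>

lemma lower_edge_uniform:
  assumes K: "\<And>z. z \<in> strip a b \<Longrightarrow> K z = 1 + fourier f z"
  shows "((\<lambda>x. lower_edge K a x - 1) \<longlongrightarrow> 0) at_infinity"
    and "\<And>e. e > 0 \<Longrightarrow> eventually (\<lambda>y. \<forall>x. cmod (K (Complex x y) - lower_edge K a x) < e) (at_right a)"
proof -
  obtain Fa where Fa: "Fa \<in> L2" "Hoelder_continuous Fa" "has_L2_fourier (weighted a (plus_part f)) Fa"
    using plus by (auto simp: class1_iff)
  let ?m = "fourier (minus_part f)"
  define k where "k x = 1 + Fa x - ?m (Complex x a)" for x
  have mint: "integrable lborel (weighted c (minus_part f))" if "a - 1 < c" "c < b" for c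
    by (rule minus_part_L2_integrable(2)[OF minus that(2)])
  have mholo: "?m holomorphic_on strip (a - 1) b"
    using mint by (rule holomorphic_fourier_strip)
  have mbdd: "bounded_on_substrips (a - 1) b ?m"
    using mint by (rule bounded_on_substrips_fourier)
  obtain c1 where c1: "a < c1" "c1 < b"
    using dense[OF ab] by blast
  obtain M where M: "M \<ge> 0" "\<And>z w. a \<le> Im z \<Longrightarrow> Im z \<le> c1 \<Longrightarrow> a \<le> Im w \<Longrightarrow> Im w \<le> c1 \<Longrightarrow> cmod (?m z - ?m w) \<le> M * cmod (z - w)"
    using Lipschitz_on_substrip[OF mholo mbdd, of a c1] c1 by auto
  have unif: "eventually (\<lambda>y. \<forall>x. cmod (K (Complex x y) - k x) < e) (at_right a)" if e: "e > 0" for e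
  proof -
    have "eventually (\<lambda>s. \<forall>x. cmod (real_fourier (weighted s (weighted a (plus_part f))) x - Fa x) < e / 2) (at_right 0)"
      using e by (intro fourier_boundary_uniform[OF Fa(3,2)]) (auto simp: weighted_def plus_part_def)
    then have 1: "eventually (\<lambda>s. \<forall>x. cmod (real_fourier (weighted (s + a) (plus_part f)) x - Fa x) < e / 2) (at_right 0)"
      unfolding weighted_weighted .
    have 2: "eventually (\<lambda>s. s > 0) (at_right (0::real))"
      by (simp add: eventually_at_right_less)
    have "min (c1 - a) (e / (2 * (M + 1))) > 0"
      using c1 e M(1) by auto
    then have 3: "eventually (\<lambda>s. s < min (c1 - a) (e / (2 * (M + 1)))) (at_right (0::real))"
      using eventually_at_right[of 0] by (metis gt_ex eventually_at_right_field)
    from 1 2 3 have "eventually (\<lambda>s. \<forall>x. cmod (K (Complex x (s + a)) - k x) < e) (at_right 0)"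
    proof eventually_elim
      case (elim s)
      show ?case
      proof
        fix x
        have st: "Complex x (s + a) \<in> strip a b"
          using elim c1 by auto
        have "cmod (?m (Complex x (s + a)) - ?m (Complex x a)) \<le> M * cmod (Complex x (s + a) - Complex x a)"
          using elim by (intro M(2)) auto
        also have "cmod (Complex x (s + a) - Complex x a) = s"
          using elim by (simp add: complex_diff cmod_def)
        also have "M * s \<le> (M + 1) * (e / (2 * (M + 1)))"
          using elim M(1) by (intro mult_mono) auto
        also have "\<dots> = e / 2"
          using M(1) by (simp add: field_simps)
        finally have m: "cmod (?m (Complex x (s + a)) - ?m (Complex x a)) \<le> e / 2" .
        have "K (Complex x (s + a)) - k x = (real_fourier (weighted (s + a) (plus_part f)) x - Fa x) - (?m (Complex x (s + a)) - ?m (Complex x a))"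
          unfolding K[OF st] fourier_split[OF st] k_def by (simp add: fourier_Complex[of "plus_part f"])
        then show "cmod (K (Complex x (s + a)) - k x) < e"
          using elim(1)[rule_format, of x] m norm_triangle_ineq4[of "real_fourier (weighted (s + a) (plus_part f)) x - Fa x" "?m (Complex x (s + a)) - ?m (Complex x a)"]
          by simp
      qed
    qed
    then show ?thesis
      by (simp add: eventually_at_right_to_0[of _ a])
  qed
  have edge: "lower_edge K a x = k x" for x
  proof -
    have "((\<lambda>y. K (Complex x y)) \<longlongrightarrow> k x) (at_right a)"
    proof (rule tendstoI)
      fix e :: real assume "e > 0"
      from unif[OF this] show "eventually (\<lambda>y. dist (K (Complex x y)) (k x) < e) (at_right a)"
        by eventually_elim (simp add: dist_norm)
    qed
    then show ?thesis
      unfolding lower_edge_def by (intro tendsto_Lim) auto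
  qed
  show "eventually (\<lambda>y. \<forall>x. cmod (K (Complex x y) - lower_edge K a x) < e) (at_right a)" if "e > 0" for e
    unfolding edge by (rule unif[OF that])
  have "(Fa \<longlongrightarrow> 0) at_infinity"
    by (rule uniformly_continuous_L2_tendsto_0[OF Fa(1) Hoelder_uniformly_continuous[OF Fa(2)]])
  moreover have "((\<lambda>x. ?m (Complex x a)) \<longlongrightarrow> 0) at_infinity"
  proof (rule uniformly_continuous_L2_tendsto_0)
    show "(\<lambda>x. ?m (Complex x a)) \<in> L2"
      using ab by (intro line_transform_L2 minus_part_L2_integrable[OF minus]) auto
    show "uniformly_continuous_on UNIV (\<lambda>x. ?m (Complex x a))"
      using ab by (intro uniformly_continuous_on_line[OF mholo mbdd]) auto
  qed
  ultimately have "((\<lambda>x. Fa x - ?m (Complex x a)) \<longlongrightarrow> 0 - 0) at_infinity"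
    by (rule tendsto_diff)
  then show "((\<lambda>x. lower_edge K a x - 1) \<longlongrightarrow> 0) at_infinity"
    unfolding edge k_def by (simp add: algebra_simps)
qed

text \<open>
  Some logarithm \<open>L0\<close> exists on the strip, and it has limits \<open>p\<close> and \<open>q\<close> at the right and
  left ends of every line. On the lower edge a continuous logarithm \<open>lk\<close> is given by the
  argument function of the index, and it has the same limit at both ends because the index is 0.
  On a line close to the edge, \<open>K\<close> divided by its boundary function stays within 1/2 of 1, so
  \<open>L0\<close> and \<open>lk\<close> differ by a constant and a principal logarithm that vanishes at infinity.
  Hence \<open>p = q\<close>, and subtracting \<open>p\<close> normalises \<open>L0\<close>.
\<close>

theorem strip_ln_exists:
  assumes K: "\<And>z. z \<in> strip a b \<Longrightarrow> K z = 1 + fourier f z" and K0: "\<And>z. z \<in> strip a b \<Longrightarrow> K z \<noteq> 0"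
    and index: "has_index (lower_edge K a) 0"
  shows "\<exists>L. is_strip_ln a b K L"
proof -
  let ?k = "lower_edge K a"
  have Kholo: "K holomorphic_on strip a b"
    by (rule holomorphic_transform[of "\<lambda>z. 1 + fourier f z"]) (auto intro!: holomorphic_intros holo simp: K)
  obtain c0 where c0: "a < c0" "c0 < b"
    using dense[OF ab] by blast
  obtain L0 where L0: "L0 holomorphic_on strip a b" "\<And>z. z \<in> strip a b \<Longrightarrow> exp (L0 z) = K z"
    using holomorphic_logarithm_exists[OF convex_strip open_strip Kholo K0, of "Complex 0 c0"] c0 by auto
  have expL0: "\<And>z. z \<in> strip a b \<Longrightarrow> exp (L0 z) = 1 + fourier f z"
    using L0(2) K by simp
  obtain p where p: "exp p = 1" "\<And>c. a < c \<Longrightarrow> c < b \<Longrightarrow> ((\<lambda>x. L0 (Complex x c)) \<longlongrightarrow> p) at_top"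
    using log_limits[OF L0(1) expL0, of 1 at_top] by auto
  obtain q where q: "exp q = 1" "\<And>c. a < c \<Longrightarrow> c < b \<Longrightarrow> ((\<lambda>x. L0 (Complex x c)) \<longlongrightarrow> q) at_bot"
    using log_limits[OF L0(1) expL0, of "- 1" at_bot] by auto
  have kcont: "continuous_on UNIV ?k" and k0: "\<And>x. ?k x \<noteq> 0"
    using index by (auto simp: has_index_def)
  obtain \<theta> l where \<theta>: "continuous_on UNIV \<theta>" "\<And>t. ?k t = of_real (cmod (?k t)) * cis (\<theta> t)"
    "(\<theta> \<longlongrightarrow> l) at_top" "(\<theta> \<longlongrightarrow> l) at_bot"
    using index by (auto simp: has_index_def)
  have kinf: "((\<lambda>x. ?k x - 1) \<longlongrightarrow> 0) at_infinity"
    by (rule lower_edge_uniform(1)[OF K])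
  then have k1: "(?k \<longlongrightarrow> 1) at_infinity"
    by (rule LIM_zero_cancel)
  \<comment> \<open>\<open>1 / k - 1\<close> is continuous and tends to 0, hence is bounded; this bounds \<open>k\<close> away from 0.\<close>
  have "((\<lambda>x. 1 / ?k x - 1) \<longlongrightarrow> 1 / 1 - 1) at_infinity"
    by (intro tendsto_intros k1) simp
  then have "\<exists>B. \<forall>x. cmod (1 / ?k x - 1) \<le> B"
    by (intro bounded_if_tendsto_0_at_infinity) (auto intro!: continuous_intros kcont k0)
  then obtain B where B: "\<And>x. cmod (1 / ?k x - 1) \<le> B"
    by blast
  have B0: "B \<ge> 0"
    using order_trans[OF norm_ge_zero B[of 0]] .
  have klow: "cmod (1 / ?k x) \<le> B + 1" for x
    using norm_triangle_ineq[of "1 / ?k x - 1" 1] B[of x] by simp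
  have "eventually (\<lambda>y. \<forall>x. cmod (K (Complex x y) - ?k x) < 1 / (2 * (B + 1))) (at_right a)"
    using B0 by (intro lower_edge_uniform(2)[OF K]) auto
  moreover have "eventually (\<lambda>y. a < y \<and> y < b) (at_right a)"
    using ab by (auto simp: eventually_at_right_field)
  ultimately have "eventually (\<lambda>y. (\<forall>x. cmod (K (Complex x y) - ?k x) < 1 / (2 * (B + 1))) \<and> a < y \<and> y < b) (at_right a)"
    by (rule eventually_conj)
  then obtain y where y: "\<And>x. cmod (K (Complex x y) - ?k x) < 1 / (2 * (B + 1))" "a < y" "y < b"
    using eventually_happens'[OF trivial_limit_at_right_real] by blast
  define w where "w x = K (Complex x y) / ?k x - 1" for x
  have w: "cmod (w x) < 1 / 2" for x
  proof -
    have "w x = (K (Complex x y) - ?k x) * (1 / ?k x)"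
      using k0[of x] by (simp add: w_def diff_divide_distrib)
    then have "cmod (w x) \<le> cmod (K (Complex x y) - ?k x) * (B + 1)"
      using mult_left_mono[OF klow[of x] norm_ge_zero] by (simp only: norm_mult)
    also have "\<dots> < 1 / (2 * (B + 1)) * (B + 1)"
      using y(1) B0 by (intro mult_strict_right_mono) auto
    also have "\<dots> = 1 / 2"
      using B0 by (simp add: field_simps)
    finally show ?thesis .
  qed
  have Kc: "continuous_on UNIV (\<lambda>x. K (Complex x y))"
    by (rule continuous_on_line[OF Kholo y(2,3)])
  have wc: "continuous_on UNIV w"
    unfolding w_def by (intro continuous_intros Kc kcont) (simp add: k0)
  define lk where "lk x = of_real (ln (cmod (?k x))) + \<i> * of_real (\<theta> x)" for x
  have lkc: "continuous_on UNIV lk"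
    unfolding lk_def by (intro continuous_intros kcont \<theta>(1)) (simp add: k0)
  have explk: "exp (lk x) = ?k x" for x
  proof -
    have "exp (lk x) = of_real (cmod (?k x)) * cis (\<theta> x)"
      using k0[of x] by (simp add: lk_def exp_add exp_of_real cis_conv_exp)
    then show ?thesis
      using \<theta>(2)[of x] by simp
  qed
  have "\<exists>N. exp N = 1 \<and> (\<forall>x\<in>UNIV. L0 (Complex x y) - lk x - Ln (1 + w x) = N)"
  proof (rule log_constant_of_exp_eq_1)
    show "continuous_on UNIV (\<lambda>x. L0 (Complex x y) - lk x - Ln (1 + w x))"
      by (intro continuous_on_diff continuous_on_line[OF L0(1) y(2,3)] lkc Ln_near_1(1)[OF wc] w)
    fix x :: real
    have "exp (Ln (1 + w x)) = 1 + w x"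
      by (rule Ln_near_1(2)[OF wc w UNIV_I])
    also have "1 + w x = K (Complex x y) / ?k x"
      by (simp add: w_def)
    finally show "exp (L0 (Complex x y) - lk x - Ln (1 + w x)) = 1"
      using L0(2)[of "Complex x y"] K0[of "Complex x y"] y k0[of x] by (simp add: exp_diff explk)
  qed (rule connected_UNIV)
  then obtain N where N: "\<And>x. L0 (Complex x y) - lk x - Ln (1 + w x) = N"
    by blast
  \<comment> \<open>The constant is evaluated at either end of the line.\<close>
  have limF: "m - (0 + \<i> * of_real l) - Ln (1 + 0) = N"
    if F: "F \<noteq> bot" "F \<le> at_infinity" and m: "((\<lambda>x. L0 (Complex x y)) \<longlongrightarrow> m) F" and \<theta>l: "(\<theta> \<longlongrightarrow> l) F" for F m
  proof -
    have kF: "(?k \<longlongrightarrow> 1) F"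
      by (rule tendsto_mono[OF F(2) k1])
    have "((\<lambda>x. fourier f (Complex x y)) \<longlongrightarrow> 0) F"
      by (rule tendsto_mono[OF F(2) line_tendsto_0[OF y(2,3)]])
    then have "((\<lambda>x. 1 + fourier f (Complex x y)) \<longlongrightarrow> 1 + 0) F"
      by (intro tendsto_add tendsto_const)
    then have KF: "((\<lambda>x. K (Complex x y)) \<longlongrightarrow> 1) F"
      using K[of "Complex _ y"] y by simp
    have wF: "(w \<longlongrightarrow> 0) F"
      unfolding w_def using tendsto_diff[OF tendsto_divide[OF KF kF] tendsto_const[of 1]] by simp
    have "((\<lambda>x. ln (cmod (?k x))) \<longlongrightarrow> ln (cmod 1)) F"
      by (intro tendsto_ln tendsto_norm kF) simp
    then have lnF: "((\<lambda>x. complex_of_real (ln (cmod (?k x)))) \<longlongrightarrow> 0) F"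
      by (metis ln_one norm_one of_real_0 tendsto_of_real)
    have "((\<lambda>x. L0 (Complex x y) - lk x - Ln (1 + w x)) \<longlongrightarrow> m - (0 + \<i> * of_real l) - Ln (1 + 0)) F"
      unfolding lk_def by (intro tendsto_intros m lnF \<theta>l wF) simp
    then have "((\<lambda>x. N) \<longlongrightarrow> m - (0 + \<i> * of_real l) - Ln (1 + 0)) F"
      unfolding N .
    then show ?thesis
      using tendsto_unique[OF F(1) _ tendsto_const[of N F]] by blast
  qed
  have "p - (0 + \<i> * of_real l) - Ln (1 + 0) = N"
    by (rule limF[OF _ at_top_le_at_infinity p(2)[OF y(2,3)] \<theta>(3)]) simp
  moreover have "q - (0 + \<i> * of_real l) - Ln (1 + 0) = N"
    by (rule limF[OF _ at_bot_le_at_infinity q(2)[OF y(2,3)] \<theta>(4)]) simp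
  ultimately have pq: "q = p"
    by (metis add_diff_cancel_right' diff_add_cancel)
  have "is_strip_ln a b K (\<lambda>z. L0 z - p)"
    unfolding is_strip_ln_def
  proof (intro conjI ballI allI impI)
    show "(\<lambda>z. L0 z - p) holomorphic_on strip a b"
      by (intro holomorphic_intros L0)
    show "exp (L0 z - p) = K z" if "z \<in> strip a b" for z
      using L0(2)[OF that] p(1) by (simp add: exp_diff)
    fix c assume "a < c \<and> c < b"
    then show "((\<lambda>x. L0 (Complex x c) - p) \<longlongrightarrow> 0) at_top" "((\<lambda>x. L0 (Complex x c) - p) \<longlongrightarrow> 0) at_bot"
      using p(2)[of c] q(2)[of c] by (auto simp: pq intro: LIM_zero)
  qed
  then show ?thesis
    by blast
qed

end

section \<open>Membership of the right factor\<close>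

text \<open>
  The point 0 belongs to both halves, as it does to the two ranges of integration in the
  factors.
\<close>

definition right_half :: "(real \<Rightarrow> complex) \<Rightarrow> real \<Rightarrow> complex" where
  "right_half f t = indicator {0..} t *\<^sub>R f t"

definition left_half :: "(real \<Rightarrow> complex) \<Rightarrow> real \<Rightarrow> complex" where
  "left_half f t = indicator {..0} t *\<^sub>R f t"

lemma fourier_right_half:
  "fourier (right_half f) z = 1 / sqrt (2 * pi) * (LINT t:{0..}|lborel. f t * exp (\<i> * z * of_real t))"
  by (simp add: fourier_def right_half_def set_lebesgue_integral_def)

lemma fourier_left_half:
  "fourier (left_half f) z = 1 / sqrt (2 * pi) * (LINT t:{..0}|lborel. f t * exp (\<i> * z * of_real t))"
  by (simp add: fourier_def left_half_def set_lebesgue_integral_def)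

lemma halves_sum: "AE t in lborel. f t = right_half f t + left_half f t"
  using AE_lborel_singleton[of 0] by eventually_elim (auto simp: right_half_def left_half_def indicator_def)

lemma right_half_eq_plus_part: "AE t in lborel. right_half f t = plus_part f t"
  using AE_lborel_singleton[of 0] by eventually_elim (auto simp: right_half_def plus_part_def indicator_def)

lemma integrable_weighted_right_half:
  assumes f: "\<And>c. a < c \<Longrightarrow> c < b \<Longrightarrow> integrable lborel (weighted c f)" and ab: "a < b" and c: "a < c"
  shows "integrable lborel (weighted c (right_half f))"
proof -
  obtain d where d: "a < d" "d < b" "d \<le> c"
    using dense[of a "min b c"] ab c by auto
  have [measurable]: "f \<in> borel_measurable borel"
    using f[OF d(1,2)] by (rule measurable_of_integrable_weighted)
  have "integrable lborel (weighted d (right_half f))"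
  proof (rule Bochner_Integration.integrable_bound[OF f[OF d(1,2)]])
    show "weighted d (right_half f) \<in> borel_measurable lborel"
      unfolding weighted_def[abs_def] right_half_def by measurable
  qed (auto simp: cmod_weighted right_half_def indicator_def)
  then show ?thesis
    by (rule integrable_weighted_right[rotated, OF _ d(3)]) (simp add: right_half_def)
qed

lemma integrable_weighted_left_half:
  assumes f: "\<And>c. a < c \<Longrightarrow> c < b \<Longrightarrow> integrable lborel (weighted c f)" and ab: "a < b" and c: "c < b"
  shows "integrable lborel (weighted c (left_half f))"
proof -
  obtain d where d: "a < d" "d < b" "c \<le> d"
    using dense[of "max a c" b] ab c by auto
  have [measurable]: "f \<in> borel_measurable borel"
    using f[OF d(1,2)] by (rule measurable_of_integrable_weighted)
  have "integrable lborel (weighted d (left_half f))"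
  proof (rule Bochner_Integration.integrable_bound[OF f[OF d(1,2)]])
    show "weighted d (left_half f) \<in> borel_measurable lborel"
      unfolding weighted_def[abs_def] left_half_def by measurable
  qed (auto simp: cmod_weighted left_half_def indicator_def)
  then show ?thesis
    by (rule integrable_weighted_left[rotated, OF _ d(3)]) (simp add: left_half_def)
qed

lemma fourier_halves:
  assumes f: "\<And>c. a < c \<Longrightarrow> c < b \<Longrightarrow> integrable lborel (weighted c f)" and z: "z \<in> strip a b"
  shows "fourier f z = fourier (right_half f) z + fourier (left_half f) z"
proof (rule fourier_AE_add)
  have ab: "a < Im z" "Im z < b" "a < b"
    using z by (auto simp: strip_def)
  show "integrable lborel (weighted (Im z) (right_half f))"
    by (rule integrable_weighted_right_half[OF f ab(3,1)])
  show "integrable lborel (weighted (Im z) (left_half f))"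
    by (rule integrable_weighted_left_half[OF f ab(3,2)])
  show "f \<in> borel_measurable borel"
    using f[OF ab(1,2)] by (rule measurable_of_integrable_weighted)
qed (rule halves_sum)

lemma holomorphic_fourier_right:
  assumes "\<And>c. a < c \<Longrightarrow> integrable lborel (weighted c g)"
  shows "fourier g holomorphic_on {z. a < Im z}"
  using holomorphic_fourier[of "{a<..}" g] assms by simp

lemma holomorphic_fourier_left:
  assumes "\<And>c. c < b \<Longrightarrow> integrable lborel (weighted c g)"
  shows "fourier g holomorphic_on {z. Im z < b}"
  using holomorphic_fourier[of "{..<b}" g] assms by simp

lemma fourier_right_bounded:
  assumes supp: "\<And>t. t < 0 \<Longrightarrow> g t = 0" and int: "integrable lborel (weighted c g)" and z: "c \<le> Im z"
  shows "cmod (fourier g z) \<le> (LINT t|lborel. cmod (weighted c g t))"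
proof -
  have i: "integrable lborel (weighted (Im z) g)"
    by (rule integrable_weighted_right[OF supp int z])
  have le: "cmod (weighted (Im z) g t) \<le> cmod (weighted c g t)" for t
    by (rule cmod_weighted_right_le[OF supp z])
  show ?thesis
    unfolding fourier_weighted[of g z]
    by (rule order_trans[OF cmod_fourier_le[OF i] integral_mono]) (use i int le in auto)
qed

lemma fourier_left_bounded:
  assumes supp: "\<And>t. t > 0 \<Longrightarrow> g t = 0" and int: "integrable lborel (weighted c g)" and z: "Im z \<le> c"
  shows "cmod (fourier g z) \<le> (LINT t|lborel. cmod (weighted c g t))"
proof -
  have i: "integrable lborel (weighted (Im z) g)"
    by (rule integrable_weighted_left[OF supp int z])
  have le: "cmod (weighted (Im z) g t) \<le> cmod (weighted c g t)" for t
    by (rule cmod_weighted_left_le[OF supp z])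
  show ?thesis
    unfolding fourier_weighted[of g z]
    by (rule order_trans[OF cmod_fourier_le[OF i] integral_mono]) (use i int le in auto)
qed

lemma fourier_right_tendsto_0:
  assumes supp: "\<And>t. t < 0 \<Longrightarrow> g t = 0" and int: "integrable lborel (weighted c g)"
  shows "(\<lambda>n. fourier g (Complex 0 (c + real n))) \<longlonglongrightarrow> 0"
proof -
  have [measurable]: "g \<in> borel_measurable borel"
    using int by (rule measurable_of_integrable_weighted)
  have "(\<lambda>n. LINT t|lborel. weighted (c + real n) g t) \<longlonglongrightarrow> (LINT t::real|lborel. 0)"
  proof (rule integral_dominated_convergence)
    show "integrable lborel (\<lambda>t. cmod (weighted c g t))"
      by (rule integrable_norm[OF int])
    show "AE t in lborel. cmod (weighted (c + real n) g t) \<le> cmod (weighted c g t)" for n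
    proof (intro always_eventually allI)
      fix t
      show "cmod (weighted (c + real n) g t) \<le> cmod (weighted c g t)"
        by (rule cmod_weighted_right_le) (use supp in auto)
    qed
    show "AE t in lborel. (\<lambda>n. weighted (c + real n) g t) \<longlonglongrightarrow> 0"
      using AE_lborel_singleton[of 0]
    proof eventually_elim
      case (elim t)
      show ?case
      proof (cases "t < 0")
        case False
        with elim have t: "t > 0" by simp
        have "(\<lambda>n. weighted c g t * of_real (exp (- t) ^ n)) \<longlonglongrightarrow> weighted c g t * of_real 0"
          using t by (intro tendsto_mult_left tendsto_of_real LIMSEQ_realpow_zero) auto
        moreover have "weighted (c + real n) g t = weighted c g t * of_real (exp (- t) ^ n)" for n
        proof -
          have "exp (- (c + real n) * t) = exp (- c * t) * exp (- t) ^ n"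
            by (simp add: algebra_simps flip: exp_of_nat_mult exp_add)
          then show ?thesis
            unfolding weighted_def by simp
        qed
        ultimately show ?thesis
          by simp
      qed (simp add: supp weighted_def)
    qed
  qed measurable
  then have "(\<lambda>n. 1 / complex_of_real (sqrt (2 * pi)) * (LINT t|lborel. weighted (c + real n) g t)) \<longlonglongrightarrow> 1 / complex_of_real (sqrt (2 * pi)) * (LINT t::real|lborel. 0)"
    by (rule tendsto_mult_left)
  then show ?thesis
    unfolding fourier_Complex unfolding fourier_def by simp
qed

lemma bounded_on_substrips_mult:
  assumes "bounded_on_substrips a b F" "bounded_on_substrips a b G"
  shows "bounded_on_substrips a b (\<lambda>z. F z * G z)"
  unfolding bounded_on_substrips_def
proof (intro allI impI)
  fix c d assume "a < c \<and> c \<le> d \<and> d < b"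
  then have cd: "a < c" "c \<le> d" "d < b" by auto
  obtain A where A: "A \<ge> 0" "\<And>z. c \<le> Im z \<Longrightarrow> Im z \<le> d \<Longrightarrow> cmod (F z) \<le> A"
    using bounded_on_substripsD[OF assms(1) cd] by blast
  obtain B where B: "B \<ge> 0" "\<And>z. c \<le> Im z \<Longrightarrow> Im z \<le> d \<Longrightarrow> cmod (G z) \<le> B"
    using bounded_on_substripsD[OF assms(2) cd] by blast
  have "cmod (F z * G z) \<le> A * B" if "c \<le> Im z" "Im z \<le> d" for z
    unfolding norm_mult using A B that by (intro mult_mono) auto
  then show "\<exists>B. \<forall>z. c \<le> Im z \<and> Im z \<le> d \<longrightarrow> cmod (F z * G z) \<le> B"
    by blast
qed

lemma bounded_on_substrips_exp:
  assumes "bounded_on_substrips a b F"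
  shows "bounded_on_substrips a b (\<lambda>z. exp (- F z))"
  unfolding bounded_on_substrips_def
proof (intro allI impI)
  fix c d assume "a < c \<and> c \<le> d \<and> d < b"
  then have cd: "a < c" "c \<le> d" "d < b" by auto
  obtain A where A: "A \<ge> 0" "\<And>z. c \<le> Im z \<Longrightarrow> Im z \<le> d \<Longrightarrow> cmod (F z) \<le> A"
    using bounded_on_substripsD[OF assms cd] by blast
  have "cmod (exp (- F z)) \<le> exp A" if "c \<le> Im z" "Im z \<le> d" for z
    by (rule order_trans[OF norm_exp]) (use A(2)[OF that] in simp)
  then show "\<exists>B. \<forall>z. c \<le> Im z \<and> Im z \<le> d \<longrightarrow> cmod (exp (- F z)) \<le> B"
    by blast
qed

text \<open>
  For increments up to 1 the Lipschitz bound is dominated by the power \<open>\<mu> \<le> 1\<close>; for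
  larger ones the bound on \<open>Q\<close> suffices.
\<close>

lemma Hoelder_mult_Lipschitz:
  assumes F: "Hoelder_continuous F" and FB: "\<And>x. cmod (F x) \<le> B"
    and Q: "\<And>x y. cmod (Q x - Q y) \<le> M * \<bar>x - y\<bar>" and QC: "\<And>x. cmod (Q x) \<le> C"
  shows "Hoelder_continuous (\<lambda>x. F x * Q x)"
proof -
  obtain \<mu> A where \<mu>: "0 < \<mu>" "\<mu> \<le> 1" and A: "\<And>x y. cmod (F x - F y) \<le> A * \<bar>x - y\<bar> powr \<mu>"
    using F by (auto simp: Hoelder_continuous_def)
  have A0: "A \<ge> 0" and B0: "B \<ge> 0" and C0: "C \<ge> 0" and M0: "M \<ge> 0"
    using order_trans[OF norm_ge_zero A[of 1 0]] order_trans[OF norm_ge_zero FB[of 0]]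
      order_trans[OF norm_ge_zero QC[of 0]] order_trans[OF norm_ge_zero Q[of 1 0]] by simp_all
  have Q': "cmod (Q x - Q y) \<le> (M + 2 * C) * \<bar>x - y\<bar> powr \<mu>" for x y
  proof (cases "\<bar>x - y\<bar> \<le> 1")
    case True
    show ?thesis
    proof (cases "x = y")
      case False
      have "\<bar>x - y\<bar> powr 1 \<le> \<bar>x - y\<bar> powr \<mu>"
        using True \<mu> False by (intro powr_mono') auto
      then have "M * \<bar>x - y\<bar> \<le> (M + 2 * C) * \<bar>x - y\<bar> powr \<mu>"
        using M0 C0 False by (intro mult_mono) auto
      then show ?thesis
        using Q[of x y] by linarith
    qed (use M0 C0 in simp)
  next
    case False
    have "1 \<le> \<bar>x - y\<bar> powr \<mu>"
      using False \<mu> by (intro ge_one_powr_ge_zero) auto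
    then have le: "(M + 2 * C) * 1 \<le> (M + 2 * C) * \<bar>x - y\<bar> powr \<mu>"
      using M0 C0 by (intro mult_left_mono) auto
    have "cmod (Q x - Q y) \<le> (M + 2 * C) * 1"
      using norm_triangle_ineq4[of "Q x" "Q y"] QC[of x] QC[of y] M0 by simp
    then show ?thesis
      using le by (rule order_trans)
  qed
  have "cmod (F x * Q x - F y * Q y) \<le> (A * C + B * (M + 2 * C)) * \<bar>x - y\<bar> powr \<mu>" for x y
  proof -
    have "F x * Q x - F y * Q y = (F x - F y) * Q x + F y * (Q x - Q y)"
      by (simp add: algebra_simps)
    then have "cmod (F x * Q x - F y * Q y) \<le> cmod (F x - F y) * cmod (Q x) + cmod (F y) * cmod (Q x - Q y)"
      by (metis norm_mult norm_triangle_ineq)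
    also have "\<dots> \<le> (A * \<bar>x - y\<bar> powr \<mu>) * C + B * ((M + 2 * C) * \<bar>x - y\<bar> powr \<mu>)"
      using A Q' FB QC A0 B0 by (intro add_mono mult_mono) auto
    finally show ?thesis
      by (simp add: algebra_simps)
  qed
  then show ?thesis
    using \<mu> unfolding Hoelder_continuous_def by blast
qed

lemma energy_shift_tendsto_0:
  assumes L2: "\<phi> \<in> L2" and supp: "\<And>t. t < 0 \<Longrightarrow> \<phi> t = 0" and s: "\<And>n. s n \<ge> 0" "s \<longlonglongrightarrow> 0"
  shows "(\<lambda>n. energy (\<lambda>t. \<phi> t - weighted (s n) \<phi> t)) \<longlonglongrightarrow> 0"
proof (rule energy_tendsto_0[OF _ L2])
  have [measurable]: "\<phi> \<in> borel_measurable borel"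
    using L2 by (rule L2D)
  show "(\<lambda>t. \<phi> t - weighted (s n) \<phi> t) \<in> borel_measurable borel" for n
    by measurable
  have eq: "\<phi> t - weighted (s n) \<phi> t = of_real (1 - exp (- s n * t)) * \<phi> t" for n t
    by (simp add: weighted_def left_diff_distrib)
  show "cmod (\<phi> t - weighted (s n) \<phi> t) \<le> cmod (\<phi> t)" for n t
  proof (cases "t < 0")
    case False
    then have "\<bar>1 - exp (- s n * t)\<bar> \<le> 1"
      using s(1)[of n] by simp
    then show ?thesis
      unfolding eq norm_mult norm_of_real by (rule mult_left_le_one_le[OF norm_ge_zero abs_ge_zero])
  qed (simp add: supp weighted_def)
  fix t
  have "(\<lambda>n. \<phi> t - of_real (exp (- s n * t)) * \<phi> t) \<longlonglongrightarrow> \<phi> t - of_real (exp (- 0 * t)) * \<phi> t"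
    by (intro tendsto_intros s(2))
  then show "(\<lambda>n. \<phi> t - weighted (s n) \<phi> t) \<longlonglongrightarrow> 0"
    by (simp add: weighted_def)
qed

text \<open>
  On the line at height \<open>c\<close> the transform of \<open>h\<close> is \<open>fourier (plus_part f) * Q\<close>. As \<open>c\<close>
  decreases to \<open>a\<close>, the first factor tends in mean to its boundary function \<open>Fa\<close>, and \<open>Q\<close>
  tends uniformly to its values on the edge, which is interior to its domain; at the same time
  \<open>weighted c h\<close> tends in mean to \<open>weighted a h\<close>. So the transform of \<open>weighted a h\<close> is
  the product of \<open>Fa\<close> with a bounded Lipschitz function, which is again Hoelder continuous and
  square integrable.
\<close>

theorem right_factor_boundary:
  assumes ab: "a < b" and plus: "plus_part f \<in> class1 a"
    and Q: "Q holomorphic_on strip a' b" and Qb: "bounded_on_substrips a' b Q" and a': "a' < a"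
    and h: "\<And>c. a < c \<Longrightarrow> c < b \<Longrightarrow> weighted c h \<in> L2"
      "\<And>c. a < c \<Longrightarrow> c < b \<Longrightarrow> integrable lborel (weighted c h)"
      "\<And>c. a < c \<Longrightarrow> c < b \<Longrightarrow> energy (weighted c h) \<le> energy (\<lambda>x. fourier (plus_part f) (Complex x c) * Q (Complex x c))"
      "\<And>z. z \<in> strip a b \<Longrightarrow> fourier h z = fourier (plus_part f) z * Q z"
  shows "h \<in> class1 a"
proof -
  let ?p = "plus_part f"
  define \<phi> where "\<phi> = weighted a ?p"
  obtain Fa where Fa: "Fa \<in> L2" "Hoelder_continuous Fa" "has_L2_fourier \<phi> Fa"
    using plus by (auto simp: class1_iff \<phi>_def)
  have \<phi>L2: "\<phi> \<in> L2"
    using Fa(3) by (simp add: has_L2_fourier_def)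
  have \<phi>supp: "\<And>t. t < 0 \<Longrightarrow> \<phi> t = 0"
    by (simp add: \<phi>_def weighted_def plus_part_def)
  note pL2 = plus_part_L2_integrable[OF plus]
  obtain c1 where c1: "a < c1" "c1 < b"
    using dense[OF ab] by blast
  obtain M where M: "M \<ge> 0" "\<And>z w. a \<le> Im z \<Longrightarrow> Im z \<le> c1 \<Longrightarrow> a \<le> Im w \<Longrightarrow> Im w \<le> c1 \<Longrightarrow> cmod (Q z - Q w) \<le> M * cmod (z - w)"
    using Lipschitz_on_substrip[OF Q Qb a' less_imp_le[OF c1(1)] c1(2)] by blast
  obtain C where C: "C \<ge> 0" "\<And>z. a \<le> Im z \<Longrightarrow> Im z \<le> c1 \<Longrightarrow> cmod (Q z) \<le> C"
    using bounded_on_substripsD[OF Qb a' less_imp_le[OF c1(1)] c1(2)] by blast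
  define F where "F x = Fa x * Q (Complex x a)" for x
  have Qm: "(\<lambda>x. Q (Complex x c)) \<in> borel_measurable borel" if "a \<le> c" "c < b" for c
    using that a' by (intro borel_measurable_line[OF Q]) auto
  have Fam [measurable]: "Fa \<in> borel_measurable borel"
    by (rule L2D(1)[OF Fa(1)])
  have Fm [measurable]: "F \<in> borel_measurable borel"
    unfolding F_def using Fam Qm[of a] ab by (intro borel_measurable_times) auto
  have hm [measurable]: "h \<in> borel_measurable borel"
    using h(2)[OF c1] by (rule measurable_of_integrable_weighted)
  have FL2: "F \<in> L2"
  proof (rule L2_mono_cmult[OF Fa(1) Fm])
    fix x
    have "cmod (Q (Complex x a)) * cmod (Fa x) \<le> C * cmod (Fa x)"
      using C(2)[of "Complex x a"] c1 by (intro mult_right_mono) auto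
    then show "cmod (F x) \<le> C * cmod (Fa x)"
      by (simp add: F_def norm_mult mult.commute)
  qed
  have FH: "Hoelder_continuous F"
  proof -
    have uc: "uniformly_continuous_on UNIV Fa"
      by (rule Hoelder_uniformly_continuous[OF Fa(2)])
    obtain B where B: "\<And>x. cmod (Fa x) \<le> B"
      using bounded_if_tendsto_0_at_infinity[OF uniformly_continuous_L2_tendsto_0[OF Fa(1) uc] uniformly_continuous_imp_continuous[OF uc]] by blast
    show ?thesis
      unfolding F_def
    proof (rule Hoelder_mult_Lipschitz[OF Fa(2) B])
      show "cmod (Q (Complex x a) - Q (Complex y a)) \<le> M * \<bar>x - y\<bar>" for x y
        using M(2)[of "Complex x a" "Complex y a"] c1 by (simp add: complex_diff cmod_def)
      show "cmod (Q (Complex x a)) \<le> C" for x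
        using C(2)[of "Complex x a"] c1 by simp
    qed
  qed
  define s where "s n = (c1 - a) / real (Suc n)" for n
  have s: "s n > 0" "s n \<le> c1 - a" for n
  proof -
    show "s n > 0"
      using c1 by (simp add: s_def)
    have "(c1 - a) / real (Suc n) \<le> (c1 - a) / 1"
      using c1 by (intro divide_left_mono) auto
    then show "s n \<le> c1 - a"
      by (simp add: s_def)
  qed
  have slim: "s \<longlonglongrightarrow> 0"
  proof -
    have "(\<lambda>n. (c1 - a) * (1 / real (Suc n))) \<longlonglongrightarrow> (c1 - a) * 0"
      by (intro tendsto_mult_left LIMSEQ_Suc[OF lim_1_over_n])
    then show ?thesis
      by (simp add: s_def[abs_def])
  qed
  define c where "c n = a + s n" for n
  have c: "a < c n" "c n \<le> c1" "c n < b" for n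
    using s[of n] c1 by (auto simp: c_def)
  have clim: "c \<longlonglongrightarrow> a"
    unfolding c_def using tendsto_add[OF tendsto_const[of a] slim] by simp
  have wlim: "(\<lambda>n. weighted (c n) h t) \<longlonglongrightarrow> weighted a h t" for t
    unfolding weighted_def by (intro tendsto_intros clim)
  have pe: "energy (\<lambda>x. fourier ?p (Complex x (c n))) \<le> energy \<phi>" for n
  proof -
    have "energy (\<lambda>x. fourier ?p (Complex x (c n))) \<le> energy (weighted (c n) ?p)"
      by (rule line_transform_L2(2)[OF pL2(1) pL2(2)]) (use c[of n] in auto)
    also have "\<dots> \<le> energy \<phi>"
      unfolding \<phi>_def by (intro energy_mono cmod_weighted_right_le) (use c[of n] in \<open>auto simp: plus_part_def\<close>)
    finally show ?thesis .
  qed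
  have pm: "(\<lambda>x. fourier ?p (Complex x (c n))) \<in> borel_measurable borel" for n
    by (rule L2D(1)[OF line_transform_L2(1)[OF pL2(1) pL2(2)]]) (use c[of n] in auto)
  have haL2: "weighted a h \<in> L2"
  proof -
    have "energy (weighted a h) \<le> ennreal (C\<^sup>2) * energy \<phi>"
    proof (rule energy_Fatou[where f="\<lambda>n. weighted (c n) h" and u="\<lambda>n. ennreal (C\<^sup>2) * energy \<phi>"])
      show "AE t in lborel. (\<lambda>n. weighted (c n) h t) \<longlonglongrightarrow> weighted a h t"
        using wlim by simp
      fix n
      have "energy (weighted (c n) h) \<le> energy (\<lambda>x. fourier ?p (Complex x (c n)) * Q (Complex x (c n)))"
        by (rule h(3)[OF c(1) c(3)])
      also have "\<dots> \<le> ennreal (C\<^sup>2) * energy (\<lambda>x. fourier ?p (Complex x (c n)))"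
      proof (rule energy_mono_cmult[OF _ pm])
        fix x
        have "cmod (Q (Complex x (c n))) * cmod (fourier ?p (Complex x (c n))) \<le> C * cmod (fourier ?p (Complex x (c n)))"
          using C(2)[of "Complex x (c n)"] c[of n] by (intro mult_right_mono) auto
        then show "cmod (fourier ?p (Complex x (c n)) * Q (Complex x (c n))) \<le> C * cmod (fourier ?p (Complex x (c n)))"
          by (simp add: norm_mult mult.commute)
      qed
      also have "\<dots> \<le> ennreal (C\<^sup>2) * energy \<phi>"
        by (intro mult_left_mono pe) simp
      finally show "energy (weighted (c n) h) \<le> ennreal (C\<^sup>2) * energy \<phi>" .
    qed (auto intro: tendsto_const)
    also have "\<dots> < \<infinity>"
      using L2D(2)[OF \<phi>L2] by (simp add: ennreal_mult_less_top)
    finally show ?thesis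
      by (simp add: L2_iff)
  qed
  have "has_L2_fourier (weighted a h) F"
  proof (rule has_L2_fourier_approx[OF haL2 FL2, where g="\<lambda>n. weighted (c n) h"])
    show "integrable lborel (weighted (c n) h)" for n
      by (rule h(2)[OF c(1) c(3)])
    let ?g = "\<lambda>t. complex_of_real (2 * cmod (weighted a h t)) + complex_of_real (cmod (weighted c1 h t))"
    have gm: "(\<lambda>t. complex_of_real (2 * cmod (weighted a h t))) \<in> borel_measurable borel"
      "(\<lambda>t. complex_of_real (cmod (weighted c1 h t))) \<in> borel_measurable borel"
      by measurable
    show "(\<lambda>n. energy (\<lambda>t. weighted a h t - weighted (c n) h t)) \<longlonglongrightarrow> 0"
    proof (rule energy_tendsto_0[where g="?g"])
      show "?g \<in> L2"
        using gm by (intro L2_add L2_mono_cmult[OF haL2, of _ 2] L2_mono_cmult[OF h(1)[OF c1], of _ 1]) auto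
      show "cmod (weighted a h t - weighted (c n) h t) \<le> cmod (?g t)" for n t
      proof -
        have "cmod (weighted (c n) h t) \<le> cmod (weighted a h t) + cmod (weighted c1 h t)"
          by (rule cmod_weighted_le) (use c[of n] in auto)
        then have "cmod (weighted a h t - weighted (c n) h t) \<le> 2 * cmod (weighted a h t) + cmod (weighted c1 h t)"
          using norm_triangle_ineq4[of "weighted a h t" "weighted (c n) h t"] by simp
        also have "\<dots> = cmod (?g t)"
          unfolding of_real_add[symmetric] norm_of_real by simp
        finally show ?thesis .
      qed
      show "(\<lambda>n. weighted a h t - weighted (c n) h t) \<longlonglongrightarrow> 0" for t
        using tendsto_diff[OF tendsto_const[of "weighted a h t"] wlim[of t]] by simp
    qed measurable
    let ?P = "\<lambda>n x. fourier ?p (Complex x (c n))"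
    let ?u = "\<lambda>n. 2 * (ennreal (C\<^sup>2) * (4 * energy (\<lambda>t. \<phi> t - weighted (s n) \<phi> t))) + 2 * (ennreal ((M * s n)\<^sup>2) * energy \<phi>)"
    show "(\<lambda>n. energy (\<lambda>x. F x - real_fourier (weighted (c n) h) x)) \<longlonglongrightarrow> 0"
    proof (rule tendsto_sandwich[OF _ _ tendsto_const])
      show "eventually (\<lambda>n. energy (\<lambda>x. F x - real_fourier (weighted (c n) h) x) \<le> ?u n) sequentially"
      proof (intro always_eventually allI)
        fix n
        have dm: "(\<lambda>x. Fa x - ?P n x) \<in> borel_measurable borel"
          by (rule borel_measurable_diff[OF Fam pm])
        have Qd: "(\<lambda>x. Q (Complex x a) - Q (Complex x (c n))) \<in> borel_measurable borel"
          using Qm[of a] Qm[of "c n"] c[of n] ab by (intro borel_measurable_diff) auto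
        have eq: "F x - real_fourier (weighted (c n) h) x
            = (Fa x - ?P n x) * Q (Complex x a) + ?P n x * (Q (Complex x a) - Q (Complex x (c n)))" for x
          using h(4)[of "Complex x (c n)"] c[of n] by (simp add: F_def algebra_simps flip: fourier_Complex)
        have "energy (\<lambda>x. F x - real_fourier (weighted (c n) h) x)
            \<le> 2 * energy (\<lambda>x. (Fa x - ?P n x) * Q (Complex x a)) + 2 * energy (\<lambda>x. ?P n x * (Q (Complex x a) - Q (Complex x (c n))))"
          unfolding eq using Qm[of a] ab by (intro energy_add_le borel_measurable_times dm pm Qd) auto
        also have "\<dots> \<le> ?u n"
        proof (intro add_mono mult_left_mono)
          have "energy (\<lambda>x. (Fa x - ?P n x) * Q (Complex x a)) \<le> ennreal (C\<^sup>2) * energy (\<lambda>x. Fa x - ?P n x)"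
          proof (rule energy_mono_cmult[OF _ dm])
            fix x
            have "cmod (Q (Complex x a)) * cmod (Fa x - ?P n x) \<le> C * cmod (Fa x - ?P n x)"
              using C(2)[of "Complex x a"] c1 by (intro mult_right_mono) auto
            then show "cmod ((Fa x - ?P n x) * Q (Complex x a)) \<le> C * cmod (Fa x - ?P n x)"
              by (simp add: norm_mult mult.commute)
          qed
          also have "\<dots> \<le> ennreal (C\<^sup>2) * (4 * energy (\<lambda>t. \<phi> t - weighted (s n) \<phi> t))"
          proof (intro mult_left_mono)
            have w: "weighted (s n) \<phi> = weighted (c n) ?p"
              by (simp add: \<phi>_def weighted_weighted c_def add.commute)
            have "energy (\<lambda>x. Fa x - real_fourier (weighted (s n) \<phi>) x) \<le> 4 * energy (\<lambda>t. \<phi> t - weighted (s n) \<phi> t)"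
              by (rule energy_fourier_diff_le[OF Fa(3)]) (use pL2(2)[of "c n"] c[of n] w in simp)
            then show "energy (\<lambda>x. Fa x - ?P n x) \<le> 4 * energy (\<lambda>t. \<phi> t - weighted (s n) \<phi> t)"
              by (simp add: w fourier_Complex)
          qed simp
          finally show "energy (\<lambda>x. (Fa x - ?P n x) * Q (Complex x a)) \<le> ennreal (C\<^sup>2) * (4 * energy (\<lambda>t. \<phi> t - weighted (s n) \<phi> t))" .
          have "energy (\<lambda>x. ?P n x * (Q (Complex x a) - Q (Complex x (c n)))) \<le> ennreal ((M * s n)\<^sup>2) * energy (?P n)"
          proof (rule energy_mono_cmult[OF _ pm])
            fix x
            have "cmod (Q (Complex x a) - Q (Complex x (c n))) \<le> M * s n"
              using M(2)[of "Complex x a" "Complex x (c n)"] c[of n] c1 s(1)[of n] by (simp add: complex_diff cmod_def c_def)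
            then have "cmod (Q (Complex x a) - Q (Complex x (c n))) * cmod (?P n x) \<le> (M * s n) * cmod (?P n x)"
              by (rule mult_right_mono) simp
            then show "cmod (?P n x * (Q (Complex x a) - Q (Complex x (c n)))) \<le> (M * s n) * cmod (?P n x)"
              by (simp add: norm_mult mult.commute)
          qed
          also have "\<dots> \<le> ennreal ((M * s n)\<^sup>2) * energy \<phi>"
            by (intro mult_left_mono pe) simp
          finally show "energy (\<lambda>x. ?P n x * (Q (Complex x a) - Q (Complex x (c n)))) \<le> ennreal ((M * s n)\<^sup>2) * energy \<phi>" .
        qed auto
        finally show "energy (\<lambda>x. F x - real_fourier (weighted (c n) h) x) \<le> ?u n" .
      qed
      have 1: "(\<lambda>n. energy (\<lambda>t. \<phi> t - weighted (s n) \<phi> t)) \<longlonglongrightarrow> 0"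
        by (rule energy_shift_tendsto_0[OF \<phi>L2 \<phi>supp]) (use s(1) slim less_imp_le in auto)
      have u1: "(\<lambda>n. 2 * (ennreal (C\<^sup>2) * (4 * energy (\<lambda>t. \<phi> t - weighted (s n) \<phi> t)))) \<longlonglongrightarrow> 2 * (ennreal (C\<^sup>2) * (4 * 0))"
        by (rule ennreal_tendsto_cmult[OF _ ennreal_tendsto_cmult[OF _ ennreal_tendsto_cmult[OF _ 1]]]) auto
      have "(\<lambda>n. (M * s n)\<^sup>2) \<longlonglongrightarrow> (M * 0)\<^sup>2"
        by (intro tendsto_intros slim)
      then have "(\<lambda>n. ennreal ((M * s n)\<^sup>2)) \<longlonglongrightarrow> ennreal ((M * 0)\<^sup>2)"
        by (rule tendsto_ennrealI)
      then have "(\<lambda>n. energy \<phi> * ennreal ((M * s n)\<^sup>2)) \<longlonglongrightarrow> energy \<phi> * ennreal ((M * 0)\<^sup>2)"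
        using L2D(2)[OF \<phi>L2] by (intro ennreal_tendsto_cmult) auto
      then have "(\<lambda>n. 2 * (energy \<phi> * ennreal ((M * s n)\<^sup>2))) \<longlonglongrightarrow> 2 * (energy \<phi> * ennreal ((M * 0)\<^sup>2))"
        by (rule ennreal_tendsto_cmult[rotated]) simp
      from tendsto_add[OF u1 this] show "?u \<longlonglongrightarrow> 0"
        by (simp add: mult.commute)
    qed auto
  qed
  then show ?thesis
    using FL2 FH by (auto simp: class1_iff)
qed

lemma plus_part_integrable_of_right_half:
  assumes "integrable lborel (weighted c (right_half f))"
  shows "integrable lborel (weighted c (plus_part f))"
proof (rule integrable_cong_AE_imp[OF assms])
  have [measurable]: "right_half f \<in> borel_measurable borel"
    using assms by (rule measurable_of_integrable_weighted)
  have "plus_part f = (\<lambda>t. indicator {0<..} t *\<^sub>R right_half f t)"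
    by (auto simp: plus_part_def right_half_def indicator_def)
  then have "plus_part f \<in> borel_measurable borel"
    by simp
  then show "weighted c (plus_part f) \<in> borel_measurable lborel"
    by simp
  show "AE t in lborel. weighted c (right_half f) t = weighted c (plus_part f) t"
    using right_half_eq_plus_part[of f] by eventually_elim (simp add: weighted_def)
qed

lemma AE_eq_reflect:
  fixes u v :: "real \<Rightarrow> complex"
  assumes [measurable]: "u \<in> borel_measurable borel" "v \<in> borel_measurable borel"
    and "AE t in lborel. u (- t) = v (- t)"
  shows "AE t in lborel. u t = v t"
proof -
  have "AE t in distr lborel borel uminus. u t = v t"
    using assms(3) by (subst AE_distr_iff) auto
  then show ?thesis
    unfolding lborel_distr_uminus .
qed

text \<open>
  Let \<open>Q\<close> be the reciprocal of the left factor; it is holomorphic below \<open>b\<close>, hence across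
  the lower edge. On the strip the right factor is \<open>(1 + fourier f) * Q\<close>. Splitting \<open>f\<close> at
  0, the right factor minus 1 equals \<open>A + (Q * (1 + fourier (left_half f)) - 1)\<close> with
  \<open>A = fourier (plus_part f) * Q\<close>. Only \<open>A\<close> feels the lower edge, and \<open>A = fourier h\<close>
  where \<open>h\<close> belongs to \<open>class1 a\<close> by \<open>right_factor_boundary\<close>.

  Moving the left half of \<open>h\<close> to the other side gives a function \<open>U\<close> holomorphic above \<open>a\<close>
  and a function \<open>V\<close> holomorphic below \<open>b\<close> that agree on the strip. The entire function so
  defined is bounded and tends to 0 along the positive imaginary axis, so it vanishes, and the
  right factor minus 1 is the transform of the right half of \<open>h\<close>.
\<close>

theorem right_factor_in_hat_class_right:
  assumes ab: "a < b" and plus: "plus_part f \<in> class1 a"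
    and f: "\<And>c. a < c \<Longrightarrow> c < b \<Longrightarrow> integrable lborel (weighted c f)"
    and \<kappa>: "\<And>c. a < c \<Longrightarrow> c < b \<Longrightarrow> integrable lborel (weighted c \<kappa>)"
    and eq: "\<And>z. z \<in> strip a b \<Longrightarrow> exp (fourier \<kappa> z) = 1 + fourier f z"
  shows "(\<lambda>z. exp (fourier (right_half \<kappa>) z) - 1) \<in> hat_class_right a"
proof -
  let ?Gp = "fourier (right_half \<kappa>)" and ?Gm = "fourier (left_half \<kappa>)"
  let ?Fp = "fourier (plus_part f)" and ?Fm = "fourier (left_half f)"
  define Q where "Q z = exp (- ?Gm z)" for z
  have Gpint: "integrable lborel (weighted c (right_half \<kappa>))" if "a < c" for c
    by (rule integrable_weighted_right_half[OF \<kappa> ab that])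
  have Gmint: "integrable lborel (weighted c (left_half \<kappa>))" if "c < b" for c
    by (rule integrable_weighted_left_half[OF \<kappa> ab that])
  have Fmint: "integrable lborel (weighted c (left_half f))" if "c < b" for c
    by (rule integrable_weighted_left_half[OF f ab that])
  note Fp = plus_part_L2_integrable[OF plus]
  have Gpholo: "?Gp holomorphic_on {z. a < Im z}"
    using Gpint by (rule holomorphic_fourier_right)
  have Qholo: "Q holomorphic_on {z. Im z < b}"
    unfolding Q_def by (intro holomorphic_intros holomorphic_fourier_left Gmint)
  have Qholo': "Q holomorphic_on strip a' b" for a'
    by (rule holomorphic_on_subset[OF Qholo]) (auto simp: strip_def)
  have Qb: "bounded_on_substrips a' b Q" for a'
    unfolding Q_def by (intro bounded_on_substrips_exp bounded_on_substrips_fourier Gmint)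
  define A where "A z = ?Fp z * Q z" for z
  have Fpholo: "?Fp holomorphic_on strip a b"
    by (rule holomorphic_fourier_strip) (rule Fp(2))
  have Aholo: "A holomorphic_on strip a b"
    unfolding A_def by (intro holomorphic_on_mult Fpholo Qholo')
  have Ab: "bounded_on_substrips a b A"
    unfolding A_def by (intro bounded_on_substrips_mult bounded_on_substrips_fourier Fp(2) Qb)
  have AL2: "(\<lambda>x. A (Complex x c)) \<in> L2" if c: "a < c" "c < b" for c
  proof -
    obtain C where C: "C \<ge> 0" "\<And>z. c \<le> Im z \<Longrightarrow> Im z \<le> c \<Longrightarrow> cmod (Q z) \<le> C"
      using bounded_on_substripsD[OF Qb c(1) order_refl c(2)] by blast
    have L: "(\<lambda>x. ?Fp (Complex x c)) \<in> L2"
      using c by (intro line_transform_L2 Fp) auto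
    show ?thesis
    proof (rule L2_mono_cmult[OF L borel_measurable_line[OF Aholo c]])
      fix x
      have "cmod (Q (Complex x c)) * cmod (?Fp (Complex x c)) \<le> C * cmod (?Fp (Complex x c))"
        using C(2)[of "Complex x c"] by (intro mult_right_mono) auto
      then show "cmod (A (Complex x c)) \<le> C * cmod (?Fp (Complex x c))"
        by (simp add: A_def norm_mult mult.commute)
    qed
  qed
  obtain h where h: "\<And>c. a < c \<Longrightarrow> c < b \<Longrightarrow> weighted c h \<in> L2"
      "\<And>c. a < c \<Longrightarrow> c < b \<Longrightarrow> integrable lborel (weighted c h)"
      "\<And>c. a < c \<Longrightarrow> c < b \<Longrightarrow> energy (weighted c h) \<le> energy (\<lambda>x. A (Complex x c))"
      "\<And>z. z \<in> strip a b \<Longrightarrow> fourier h z = A z"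
  proof (rule Paley_Wiener_strip[OF ab Aholo Ab AL2], goal_cases)
    case (3 \<kappa>)
    show ?case
      by (rule 3(1)[OF 3(3-6)])
  qed
  have hclass: "h \<in> class1 a"
    by (rule right_factor_boundary[where a'="a - 1", OF ab plus Qholo' Qb _ h(1,2) h(3)[unfolded A_def] h(4)[unfolded A_def]]) simp_all
  let ?hp = "right_half h" and ?hm = "left_half h"
  have hpint: "integrable lborel (weighted c ?hp)" if "a < c" for c
    by (rule integrable_weighted_right_half[OF h(2) ab that])
  have hmint: "integrable lborel (weighted c ?hm)" if "c < b" for c
    by (rule integrable_weighted_left_half[OF h(2) ab that])
  define U where "U z = exp (?Gp z) - 1 - fourier ?hp z" for z
  define V where "V z = Q z * (1 + ?Fm z) - 1 + fourier ?hm z" for z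
  have UV: "U z = V z" if z: "z \<in> strip a b" for z
  proof -
    have "fourier \<kappa> z = ?Gp z + ?Gm z"
      by (rule fourier_halves[OF \<kappa> z])
    then have "exp (?Gp z) = (1 + fourier f z) * Q z"
      unfolding Q_def eq[OF z, symmetric] by (simp add: exp_add exp_minus)
    moreover have "fourier f z = ?Fp z + ?Fm z"
    proof -
      have im: "a < Im z" "Im z < b"
        using z by (auto simp: strip_def)
      have "AE t in lborel. f t = plus_part f t + left_half f t"
        using halves_sum[of f] right_half_eq_plus_part[of f] by eventually_elim simp
      then show ?thesis
        using measurable_of_integrable_weighted[OF f[OF im]]
        by (intro fourier_AE_add Fp(2) Fmint im)
    qed
    moreover have "fourier ?hp z + fourier ?hm z = A z"
      using fourier_halves[OF h(2) z] h(4)[OF z] by simp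
    ultimately show ?thesis
      by (simp add: U_def V_def A_def algebra_simps)
  qed
  have Uholo: "U holomorphic_on {z. a < Im z}"
    unfolding U_def by (intro holomorphic_intros Gpholo holomorphic_fourier_right hpint)
  have Vholo: "V holomorphic_on {z. Im z < b}"
    unfolding V_def by (intro holomorphic_intros Qholo holomorphic_fourier_left Fmint hmint)
  \<comment> \<open>The entire function to which Liouville's theorem applies.\<close>
  define E where "E z = (if a < Im z then U z else V z)" for z
  have EV: "E z = V z" if "Im z < b" for z
    using UV[of z] that by (simp add: E_def strip_def)
  have "E holomorphic_on {z. a < Im z} \<union> {z. Im z < b}"
  proof (rule holomorphic_on_Un)
    show "E holomorphic_on {z. a < Im z}"
      by (rule holomorphic_transform[OF Uholo]) (simp add: E_def)
    show "E holomorphic_on {z. Im z < b}"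
      by (rule holomorphic_transform[OF Vholo]) (simp add: EV)
  qed (auto intro: open_halfspace_Im_gt open_halfspace_Im_lt)
  moreover have "{z. a < Im z} \<union> {z. Im z < b} = UNIV"
    using ab by auto
  ultimately have Eholo: "E holomorphic_on UNIV"
    by simp
  obtain c where c: "a < c" "c < b"
    using dense[OF ab] by blast
  have bdp: "\<exists>B. \<forall>z. c \<le> Im z \<longrightarrow> cmod (fourier (right_half g) z) \<le> B"
    if "integrable lborel (weighted c (right_half g))" for g
    using fourier_right_bounded[OF _ that] by (auto simp: right_half_def)
  have bdm: "\<exists>B. \<forall>z. Im z \<le> c \<longrightarrow> cmod (fourier (left_half g) z) \<le> B"
    if "integrable lborel (weighted c (left_half g))" for g
    using fourier_left_bounded[OF _ that] by (auto simp: left_half_def)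
  obtain B1 where B1: "\<And>z. c \<le> Im z \<Longrightarrow> cmod (?Gp z) \<le> B1"
    using bdp[OF Gpint[OF c(1)]] by blast
  obtain B2 where B2: "\<And>z. c \<le> Im z \<Longrightarrow> cmod (fourier ?hp z) \<le> B2"
    using bdp[OF hpint[OF c(1)]] by blast
  obtain B3 where B3: "\<And>z. Im z \<le> c \<Longrightarrow> cmod (?Gm z) \<le> B3"
    using bdm[OF Gmint[OF c(2)]] by blast
  obtain B4 where B4: "\<And>z. Im z \<le> c \<Longrightarrow> cmod (?Fm z) \<le> B4"
    using bdm[OF Fmint[OF c(2)]] by blast
  obtain B5 where B5: "\<And>z. Im z \<le> c \<Longrightarrow> cmod (fourier ?hm z) \<le> B5"
    using bdm[OF hmint[OF c(2)]] by blast
  have Ebound: "cmod (E z) \<le> max (exp B1 + 1 + B2) (exp B3 * (1 + B4) + 1 + B5)" for z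
  proof (cases "c \<le> Im z")
    case True
    have "cmod (exp (?Gp z)) \<le> exp B1"
      by (rule order_trans[OF norm_exp]) (use B1[OF True] in simp)
    then have "cmod (U z) \<le> exp B1 + 1 + B2"
      unfolding U_def
      using B2[OF True] norm_triangle_ineq4[of "exp (?Gp z) - 1" "fourier ?hp z"] norm_triangle_ineq4[of "exp (?Gp z)" 1]
        norm_one[where 'a=complex] by linarith
    then show ?thesis
      using True c by (simp add: E_def)
  next
    case False
    then have z: "Im z \<le> c" by simp
    have "cmod (Q z) \<le> exp B3"
      unfolding Q_def by (rule order_trans[OF norm_exp]) (use B3[OF z] in simp)
    moreover have "cmod (1 + ?Fm z) \<le> 1 + B4"
      using norm_triangle_ineq[of 1 "?Fm z"] B4[OF z] by simp
    ultimately have "cmod (Q z * (1 + ?Fm z)) \<le> exp B3 * (1 + B4)"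
      unfolding norm_mult by (intro mult_mono) auto
    then have "cmod (V z) \<le> exp B3 * (1 + B4) + 1 + B5"
      unfolding V_def
      using B5[OF z] norm_triangle_ineq[of "Q z * (1 + ?Fm z) - 1" "fourier ?hm z"] norm_triangle_ineq4[of "Q z * (1 + ?Fm z)" 1]
      by simp
    then show ?thesis
      using EV[of z] z c by simp
  qed
  then have "bounded (range E)"
    unfolding bounded_iff by blast
  then obtain e where e: "\<And>z. E z = e"
    using Liouville_theorem[OF Eholo] by (auto simp: constant_on_def)
  have "(\<lambda>n. ?Gp (Complex 0 (c + real n))) \<longlonglongrightarrow> 0" "(\<lambda>n. fourier ?hp (Complex 0 (c + real n))) \<longlonglongrightarrow> 0"
    by (rule fourier_right_tendsto_0[OF _ Gpint[OF c(1)]], simp add: right_half_def,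
        rule fourier_right_tendsto_0[OF _ hpint[OF c(1)]], simp add: right_half_def)
  then have "(\<lambda>n. exp (?Gp (Complex 0 (c + real n))) - 1 - fourier ?hp (Complex 0 (c + real n))) \<longlonglongrightarrow> exp 0 - 1 - 0"
    by (intro tendsto_intros)
  moreover have "exp (?Gp (Complex 0 (c + real n))) - 1 - fourier ?hp (Complex 0 (c + real n)) = e" for n
    using e[of "Complex 0 (c + real n)"] c by (simp add: E_def U_def)
  ultimately have e0: "e = 0"
    by (simp add: LIMSEQ_const_iff)
  have val: "exp (?Gp z) - 1 = fourier (plus_part h) z" and hint: "integrable lborel (weighted (Im z) (plus_part h))"
    if z: "a < Im z" for z
  proof -
    show hint: "integrable lborel (weighted (Im z) (plus_part h))"
      by (rule plus_part_integrable_of_right_half[OF hpint[OF z]])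
    have "fourier ?hp z = fourier (plus_part h) z + fourier (\<lambda>t. 0) z"
      using measurable_of_integrable_weighted[OF hpint[OF z]] right_half_eq_plus_part[of h]
      by (intro fourier_AE_add hint) (auto simp: weighted_def[abs_def])
    then have "fourier ?hp z = fourier (plus_part h) z"
      by (simp add: fourier_def)
    then show "exp (?Gp z) - 1 = fourier (plus_part h) z"
      using e[of z] z by (simp add: e0 E_def U_def)
  qed
  show ?thesis
    unfolding hat_class_right_def fourier_image_def class_right_def
    using hclass val hint by (auto simp: integrable_weighted_iff)
qed

section \<open>The left factor by reflection\<close>

text \<open>
  The minus sign matches the one in \<open>minus_part\<close>, so that the reflection exchanges
  \<open>plus_part\<close> and \<open>minus_part\<close>.
\<close>

lemma class1_reflect:
  assumes "g \<in> class1 b"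
  shows "(\<lambda>t. - g (- t)) \<in> class1 (- b)"
proof -
  obtain F where F: "F \<in> L2" "Hoelder_continuous F" "has_L2_fourier (weighted b g) F"
    using assms by (auto simp: class1_iff)
  have L2r: "(\<lambda>t. - u (- t)) \<in> L2" if "u \<in> L2" for u
    using L2_reflect[OF that] by (rule L2_mono_cmult[of _ _ 1]) (use L2D(1)[OF L2_reflect[OF that]] in auto)
  have w: "weighted (- b) (\<lambda>t. - g (- t)) = (\<lambda>t. - weighted b g (- t))"
    by (simp add: weighted_def fun_eq_iff)
  have H: "Hoelder_continuous (\<lambda>x. - F (- x))"
  proof -
    obtain \<mu> A where \<mu>: "0 < \<mu>" "\<mu> \<le> 1" and A: "\<And>x y. cmod (F x - F y) \<le> A * \<bar>x - y\<bar> powr \<mu>"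
      using F(2) by (auto simp: Hoelder_continuous_def)
    have "cmod (- F (- x) - - F (- y)) \<le> A * \<bar>x - y\<bar> powr \<mu>" for x y
      using A[of "- y" "- x"] by (simp add: norm_minus_commute add.commute)
    then show ?thesis
      using \<mu> unfolding Hoelder_continuous_def by blast
  qed
  have gL2: "weighted b g \<in> L2"
    using F(3) by (simp add: has_L2_fourier_def)
  have [measurable]: "weighted b g \<in> borel_measurable borel" "F \<in> borel_measurable borel"
    using gL2 F(1) by (auto dest: L2D)
  have tr: "truncation R (\<lambda>t. - weighted b g (- t)) = (\<lambda>t. - truncation R (weighted b g) (- t))" for R
    by (auto simp: truncation_def indicator_def fun_eq_iff)
  have "energy (\<lambda>x. - F (- x) - fourier_cut R (\<lambda>t. - weighted b g (- t)) x)
      = energy (\<lambda>x. F x - fourier_cut R (weighted b g) x)" for R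
  proof -
    have "real_fourier (\<lambda>t. - truncation R (weighted b g) (- t)) x = - real_fourier (truncation R (weighted b g)) (- x)" for x
      using fourier_reflect[of "\<lambda>t. - truncation R (weighted b g) t" "of_real x"] by (simp add: fourier_uminus)
    then have "energy (\<lambda>x. - F (- x) - fourier_cut R (\<lambda>t. - weighted b g (- t)) x)
        = energy (\<lambda>x. - (F (- x) - real_fourier (truncation R (weighted b g)) (- x)))"
      by (simp add: fourier_cut_eq tr)
    also have "\<dots> = energy (\<lambda>x. F (- x) - real_fourier (truncation R (weighted b g)) (- x))"
      unfolding energy_def norm_minus_cancel ..
    also have "\<dots> = energy (\<lambda>x. F x - real_fourier (truncation R (weighted b g)) x)"
      using energy_reflect[of "\<lambda>x. F x - real_fourier (truncation R (weighted b g)) x"] by simp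
    finally show ?thesis
      by (simp add: fourier_cut_eq)
  qed
  then have "has_L2_fourier (weighted (- b) (\<lambda>t. - g (- t))) (\<lambda>x. - F (- x))"
    using F(3) L2r[OF gL2] L2r[OF F(1)] unfolding w has_L2_fourier_def energy_def by simp
  then show ?thesis
    using L2r[OF F(1)] H by (auto simp: class1_iff)
qed

lemma hat_class_left_of_right:
  assumes "F \<in> hat_class_right (- b)"
  shows "(\<lambda>z. F (- z)) \<in> hat_class_left b"
proof -
  obtain h where h: "h \<in> class1 (- b)" and hz: "\<And>z. - b < Im z \<Longrightarrow>
      integrable lborel (\<lambda>t. plus_part h t * exp (\<i> * z * of_real t)) \<and> F z = fourier (plus_part h) z"
    using assms unfolding hat_class_right_def fourier_image_def class_right_def by auto
  let ?g = "\<lambda>t. - h (- t)"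
  have g: "?g \<in> class1 b"
    using class1_reflect[OF h] by simp
  have eq: "minus_part ?g = (\<lambda>t. plus_part h (- t))"
    by (auto simp: minus_part_def plus_part_def fun_eq_iff)
  have "integrable lborel (\<lambda>t. minus_part ?g t * exp (\<i> * z * of_real t)) \<and> F (- z) = fourier (minus_part ?g) z"
    if z: "Im z < b" for z
  proof
    have "integrable lborel (\<lambda>t. plus_part h (0 + (- 1) * t) * exp (\<i> * (- z) * of_real (0 + (- 1) * t)))"
      using hz[of "- z"] z by (intro lborel_integrable_real_affine) auto
    then show "integrable lborel (\<lambda>t. minus_part ?g t * exp (\<i> * z * of_real t))"
      by (simp add: eq)
    show "F (- z) = fourier (minus_part ?g) z"
      unfolding eq fourier_reflect using hz[of "- z"] z by simp
  qed
  then show ?thesis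
    unfolding hat_class_left_def fourier_image_def class_left_def using g by auto
qed

text \<open>
  Replacing \<open>t\<close> by \<open>- t\<close> and \<open>z\<close> by \<open>- z\<close> maps the strip between \<open>a\<close> and \<open>b\<close> to the
  one between \<open>- b\<close> and \<open>- a\<close> and exchanges the two factors.
\<close>

theorem left_factor_in_hat_class_left:
  assumes ab: "a < b" and minus: "minus_part f \<in> class1 b"
    and f: "\<And>c. a < c \<Longrightarrow> c < b \<Longrightarrow> integrable lborel (weighted c f)"
    and \<kappa>: "\<And>c. a < c \<Longrightarrow> c < b \<Longrightarrow> integrable lborel (weighted c \<kappa>)"
    and eq: "\<And>z. z \<in> strip a b \<Longrightarrow> exp (fourier \<kappa> z) = 1 + fourier f z"
  shows "(\<lambda>z. exp (fourier (left_half \<kappa>) z) - 1) \<in> hat_class_left b"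
proof -
  have w: "integrable lborel (weighted c (\<lambda>t. g (- t)))"
    if "\<And>c. a < c \<Longrightarrow> c < b \<Longrightarrow> integrable lborel (weighted c g)" "- b < c" "c < - a" for c g
  proof -
    have "integrable lborel (\<lambda>t. weighted (- c) g (0 + (- 1) * t))"
      using that by (intro lborel_integrable_real_affine) auto
    then show ?thesis
      by (simp add: weighted_def[abs_def])
  qed
  have "(\<lambda>z. exp (fourier (right_half (\<lambda>t. \<kappa> (- t))) z) - 1) \<in> hat_class_right (- b)"
  proof (rule right_factor_in_hat_class_right[of "- b" "- a" "\<lambda>t. f (- t)"])
    have "plus_part (\<lambda>t. f (- t)) = (\<lambda>t. - minus_part f (- t))"
      by (auto simp: plus_part_def minus_part_def fun_eq_iff)
    then show "plus_part (\<lambda>t. f (- t)) \<in> class1 (- b)"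
      using class1_reflect[OF minus] by simp
    show "exp (fourier (\<lambda>t. \<kappa> (- t)) z) = 1 + fourier (\<lambda>t. f (- t)) z" if "z \<in> strip (- b) (- a)" for z
      unfolding fourier_reflect using that by (intro eq) (auto simp: strip_def)
  qed (use ab w[OF f] w[OF \<kappa>] in auto)
  from hat_class_left_of_right[OF this]
  have "(\<lambda>z. exp (fourier (right_half (\<lambda>t. \<kappa> (- t))) (- z)) - 1) \<in> hat_class_left b" .
  moreover have "fourier (right_half (\<lambda>t. \<kappa> (- t))) (- z) = fourier (left_half \<kappa>) z" for z
  proof -
    have "left_half \<kappa> = (\<lambda>t. right_half (\<lambda>t. \<kappa> (- t)) (- t))"
      by (auto simp: left_half_def right_half_def indicator_def fun_eq_iff)
    then show ?thesis
      by (simp add: fourier_reflect)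
  qed
  ultimately show ?thesis
    by simp
qed

section \<open>The factorisation\<close>

theorem theorem6p8:
  fixes a b :: real and K :: "complex \<Rightarrow> complex"
  assumes "a < b"
    and "\<forall>z \<in> strip a b. K z \<noteq> 0"
    and "(\<lambda>z. K z - 1) \<in> hat_class2 a b"
    and "has_index (lower_edge K a) 0"
  shows "(\<exists>lnK \<kappa>. is_strip_ln a b K lnK \<and> is_strip_inverse_fourier a b lnK \<kappa>) \<and>
    (\<forall>lnK \<kappa>. is_strip_ln a b K lnK \<and> is_strip_inverse_fourier a b lnK \<kappa> \<longrightarrow>
       (\<forall>z. a < Im z \<longrightarrow>
          set_integrable lborel {0..} (\<lambda>t. \<kappa> t * exp (\<i> * z * of_real t))) \<and>
       (\<forall>z. Im z < b \<longrightarrow>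
          set_integrable lborel {..0} (\<lambda>t. \<kappa> t * exp (\<i> * z * of_real t))) \<and>
       Wiener_Hopf_factors a b K
         (\<lambda>z. exp (1 / sqrt (2 * pi) * (LINT t:{0..}|lborel. \<kappa> t * exp (\<i> * z * of_real t))))
         (\<lambda>z. exp (1 / sqrt (2 * pi) * (LINT t:{..0}|lborel. \<kappa> t * exp (\<i> * z * of_real t)))))"
proof -
  obtain f where fc: "f \<in> class2 a b"
    and fz: "\<And>z. z \<in> strip a b \<Longrightarrow> integrable lborel (\<lambda>t. f t * exp (\<i> * z * of_real t)) \<and> K z - 1 = fourier f z"
    using assms(3) unfolding hat_class2_def fourier_image_def by auto
  have plus: "plus_part f \<in> class1 a" and minus: "minus_part f \<in> class1 b"
    using fc by (auto simp: class2_def)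
  have fint: "integrable lborel (weighted c f)" if "a < c" "c < b" for c
    using fz[of "Complex 0 c"] that by (simp add: integrable_weighted_iff)
  interpret strip_transform a b f
    using assms(1) plus minus fint by unfold_locales
  have K: "K z = 1 + fourier f z" if "z \<in> strip a b" for z
    using fz[OF that] by (simp add: algebra_simps)
  have PW: "\<exists>\<kappa>. is_strip_inverse_fourier a b L \<kappa> \<and> (\<forall>c. a < c \<longrightarrow> c < b \<longrightarrow> integrable lborel (weighted c \<kappa>))
      \<and> (\<forall>z\<in>strip a b. fourier \<kappa> z = L z)" if L: "is_strip_ln a b K L" for L
  proof -
    have Lholo: "L holomorphic_on strip a b"
      using L by (simp add: is_strip_ln_def)
    note bd = strip_ln_bounds[OF assms(1) L K holo bdd line_L2]
    show ?thesis
    proof (rule Paley_Wiener_strip[OF assms(1) Lholo bd(1) bd(2)])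
      fix \<kappa>
      assume "is_strip_inverse_fourier a b L \<kappa>" "\<And>c. a < c \<Longrightarrow> c < b \<Longrightarrow> integrable lborel (weighted c \<kappa>)"
        "\<And>z. z \<in> strip a b \<Longrightarrow> fourier \<kappa> z = L z"
      then show ?thesis
        by blast
    qed
  qed
  show ?thesis
  proof (intro conjI)
    obtain L where "is_strip_ln a b K L"
      using strip_ln_exists[OF K _ assms(4)] assms(2) by blast
    then show "\<exists>lnK \<kappa>. is_strip_ln a b K lnK \<and> is_strip_inverse_fourier a b lnK \<kappa>"
      using PW by blast
  next
    show "\<forall>lnK \<kappa>. is_strip_ln a b K lnK \<and> is_strip_inverse_fourier a b lnK \<kappa> \<longrightarrow>
       (\<forall>z. a < Im z \<longrightarrow>
          set_integrable lborel {0..} (\<lambda>t. \<kappa> t * exp (\<i> * z * of_real t))) \<and>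
       (\<forall>z. Im z < b \<longrightarrow>
          set_integrable lborel {..0} (\<lambda>t. \<kappa> t * exp (\<i> * z * of_real t))) \<and>
       Wiener_Hopf_factors a b K
         (\<lambda>z. exp (1 / sqrt (2 * pi) * (LINT t:{0..}|lborel. \<kappa> t * exp (\<i> * z * of_real t))))
         (\<lambda>z. exp (1 / sqrt (2 * pi) * (LINT t:{..0}|lborel. \<kappa> t * exp (\<i> * z * of_real t))))"
    proof (intro allI impI, elim conjE)
      fix L \<kappa> assume L: "is_strip_ln a b K L" and inv: "is_strip_inverse_fourier a b L \<kappa>"
      obtain \<kappa>' where inv': "is_strip_inverse_fourier a b L \<kappa>'"
        and int': "\<And>c. a < c \<Longrightarrow> c < b \<Longrightarrow> integrable lborel (weighted c \<kappa>')"
        and val': "\<And>z. z \<in> strip a b \<Longrightarrow> fourier \<kappa>' z = L z"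
        using PW[OF L] by blast
      define c where "c = (a + b) / 2"
      have c: "a < c" "c < b"
        using assms(1) by (auto simp: c_def)
      have "has_L2_inverse_fourier (\<lambda>x. L (Complex x c)) (weighted c \<kappa>)" "has_L2_inverse_fourier (\<lambda>x. L (Complex x c)) (weighted c \<kappa>')"
        using inv inv' c by (auto simp: is_strip_inverse_fourier_def weighted_def[abs_def])
      note inv_c = this
      have \<kappa>m: "\<kappa> \<in> borel_measurable borel"
        using inv_c(1) L2D(1) by (auto simp: has_L2_inverse_fourier_def borel_measurable_weighted_iff dest: L2D(1))
      \<comment> \<open>The given \<open>\<kappa>\<close> is determined up to a null set by uniqueness of limits in mean.\<close>
      have "AE t in lborel. weighted c \<kappa> (- t) = weighted c \<kappa>' (- t)"
        using inv_c unfolding has_L2_inverse_fourier_iff by (rule AE_eq_of_L2_fourier)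
      then have AE: "AE t in lborel. \<kappa> (- t) = \<kappa>' (- t)"
        by eventually_elim (simp add: weighted_def)
      have \<kappa>AE: "AE t in lborel. \<kappa> t = \<kappa>' t"
        by (rule AE_eq_reflect[OF \<kappa>m measurable_of_integrable_weighted[OF int'[OF c]] AE])
      have int: "integrable lborel (weighted d \<kappa>)" if "a < d" "d < b" for d
      proof (rule integrable_cong_AE_imp[OF int'[OF that]])
        show "weighted d \<kappa> \<in> borel_measurable lborel"
          using \<kappa>m by simp
        show "AE t in lborel. weighted d \<kappa>' t = weighted d \<kappa> t"
          using \<kappa>AE by eventually_elim (simp add: weighted_def)
      qed
      have val: "exp (fourier \<kappa> z) = 1 + fourier f z" if z: "z \<in> strip a b" for z
      proof -
        have im: "a < Im z" "Im z < b"
          using z by (auto simp: strip_def)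
        have "fourier \<kappa> z = fourier \<kappa>' z + fourier (\<lambda>t. 0) z"
          using \<kappa>AE by (intro fourier_AE_add int' im \<kappa>m) (auto simp: weighted_def[abs_def])
        then show ?thesis
          using L val'[OF z] K[OF z] z by (simp add: is_strip_ln_def fourier_def)
      qed
      let ?Kp = "\<lambda>z. exp (fourier (right_half \<kappa>) z)" and ?Km = "\<lambda>z. exp (fourier (left_half \<kappa>) z)"
      have ri: "integrable lborel (weighted c (right_half \<kappa>))" if "a < c" for c
        by (rule integrable_weighted_right_half[OF int assms(1) that])
      have li: "integrable lborel (weighted c (left_half \<kappa>))" if "c < b" for c
        by (rule integrable_weighted_left_half[OF int assms(1) that])
      have "set_integrable lborel {0..} (\<lambda>t. \<kappa> t * exp (\<i> * z * of_real t))" if "a < Im z" for z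
        using ri[OF that] unfolding integrable_weighted_iff[symmetric] set_integrable_def right_half_def by simp
      moreover have "set_integrable lborel {..0} (\<lambda>t. \<kappa> t * exp (\<i> * z * of_real t))" if "Im z < b" for z
        using li[OF that] unfolding integrable_weighted_iff[symmetric] set_integrable_def left_half_def by simp
      moreover have "Wiener_Hopf_factors a b K ?Kp ?Km"
        unfolding Wiener_Hopf_factors_def
      proof (intro conjI ballI)
        show "?Kp holomorphic_on {z. a < Im z}"
          by (intro holomorphic_intros holomorphic_fourier_right ri)
        show "?Km holomorphic_on {z. Im z < b}"
          by (intro holomorphic_intros holomorphic_fourier_left li)
        show "(\<lambda>z. ?Kp z - 1) \<in> hat_class_right a"
          by (rule right_factor_in_hat_class_right[OF assms(1) plus fint int val])
        show "(\<lambda>z. ?Km z - 1) \<in> hat_class_left b"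
          by (rule left_factor_in_hat_class_left[OF assms(1) minus fint int val])
        show "K z = ?Kp z * ?Km z" if z: "z \<in> strip a b" for z
          using val[OF z] K[OF z] fourier_halves[OF int z] by (simp add: exp_add)
      qed
      ultimately show "(\<forall>z. a < Im z \<longrightarrow>
          set_integrable lborel {0..} (\<lambda>t. \<kappa> t * exp (\<i> * z * of_real t))) \<and>
       (\<forall>z. Im z < b \<longrightarrow>
          set_integrable lborel {..0} (\<lambda>t. \<kappa> t * exp (\<i> * z * of_real t))) \<and>
       Wiener_Hopf_factors a b K
         (\<lambda>z. exp (1 / sqrt (2 * pi) * (LINT t:{0..}|lborel. \<kappa> t * exp (\<i> * z * of_real t))))
         (\<lambda>z. exp (1 / sqrt (2 * pi) * (LINT t:{..0}|lborel. \<kappa> t * exp (\<i> * z * of_real t))))"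
        unfolding fourier_right_half fourier_left_half by blast
    qed
  qed
qed

end
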